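(* Consider rate $\alpha$ PCF ($\alpha>0$) on the rooted binary tree $\mathbf{T}_2$. There is a critical rate of freezing $\alpha_c=1$ such that for $\alpha<\alpha_c$ infinite clusters form almost surely, but for $\alpha\ge\alpha_c$ all clusters are almost surely finite. Moreover, writing $P_k(\alpha)$ for the probability that the cluster of the root has size $k$ (i.e. $k$ vertices) when it freezes, the following hold as $k\to\infty$: (i) if $\alpha<1$, then $P_k(\alpha)\sim C_\alpha\,k^{-2}$ for some constant $C_\alpha>0$; (ii) if $\alpha=1$, then $P_k(1)\sim C\,k^{-7/4}$ for some constant $C>0$; (iii) if $\alpha>1$, then $P_k(\alpha)$ decays exponentially in $k$ at a rate dependent on $\alpha$, i.e. there are constants $K_\alpha,\lambda_\alpha>0$ with $P_k(\alpha)\le K_\alpha e^{-\lambda_\alpha k}$ for all $k$.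
   Context: The rooted binary tree $\mathbf{T}_2$ is the infinite rooted tree in which every vertex has exactly $2$ children. Percolation with constant freezing (PCF) at rate $\alpha>0$ on a finite graph $\mathbf{H}=(\mathcal{V}_{\mathbf{H}},\mathcal{E}_{\mathbf{H}})$ is the continuous-time Markov chain $(\eta^t)_{t\ge 0}$ on $\{w,f\}^{\mathcal{V}_{\mathbf{H}}}\times\{0,1\}^{\mathcal{E}_{\mathbf{H}}}$ in which vertices are warm ($w$) or frozen ($f$) and edges are open ($1$) or closed ($0$). Initially all vertices are warm and all edges closed. The clusters of a configuration are the connected components of the graph formed by all vertices and the open edges (isolated vertices count as clusters; openness of paths ignores whether vertices are warm or frozen). Transitions: each closed edge whose two end vertices are both warm opens at rate $1$; each cluster $C$ freezes at rate $\alpha$ (all vertices of $C$ are set to $f$); there are no other transitions. The chain reaches a final configuration $\eta^\infty$ in finite time, so the process is indexed by $t\in[0,\infty]$. The (infinite volume) rate $\alpha$ PCF process on an infinite tree $\mathbf{T}$ is the process $(\eta^t)_{t\in[0,\infty]}$ of configurations on $\mathbf{T}$ which is the local limit of finite volume PCF: for every finite subgraph $\mathbf{\Lambda}$ and every increasing exhaustion $\mathbf{G}_1\subseteq\mathbf{G}_2\subseteq\cdots$ of $\mathbf{T}$ by finite connected subgraphs, the restriction to $\mathbf{\Lambda}$ of rate $\alpha$ PCF on $\mathbf{G}_n$ converges in law to the restriction of $(\eta^t)_{t\in[0,\infty]}$ to $\mathbf{\Lambda}$. (This local limit exists and does not depend on the exhaustion.) A cluster no longer changes once it has frozen, so the size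 of the root cluster when it freezes equals its size in the final configuration $\eta^\infty$. *)

theory Defs
  imports "HOL-Probability.Probability" "HOL-Library.Landau_Symbols"
begin

section \<open>Graphs and configurations\<close>

text \<open>Undirected graphs; an edge is the set of its two end vertices.\<close>

record 'v ugraph =
  verts :: "'v set"
  edges :: "'v set set"

definition subgraph :: "'v ugraph \<Rightarrow> 'v ugraph \<Rightarrow> bool" where
  "subgraph H G \<longleftrightarrow> verts H \<subseteq> verts G \<and> edges H \<subseteq> edges G \<and> (\<forall>e\<in>edges H. e \<subseteq> verts H)"

definition finite_subgraph :: "'v ugraph \<Rightarrow> 'v ugraph \<Rightarrow> bool" where
  "finite_subgraph H G \<longleftrightarrow> subgraph H G \<and> finite (verts H) \<and> finite (edges H)"

definition component :: "'v set set \<Rightarrow> 'v \<Rightarrow> 'v set" where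
  "component E v = {w. (v, w) \<in> {(a, b). {a, b} \<in> E}\<^sup>*}"

definition connected_graph :: "'v ugraph \<Rightarrow> bool" where
  "connected_graph G \<longleftrightarrow> verts G \<noteq> {} \<and> (\<forall>v\<in>verts G. verts G \<subseteq> component (edges G) v)"

definition exhaustion :: "'v ugraph \<Rightarrow> (nat \<Rightarrow> 'v ugraph) \<Rightarrow> bool" where
  "exhaustion T G \<longleftrightarrow>
     (\<forall>n. finite_subgraph (G n) T \<and> connected_graph (G n) \<and> subgraph (G n) (G (Suc n))) \<and>
     (\<Union>n. verts (G n)) = verts T \<and> (\<Union>n. edges (G n)) = edges T"

text \<open>
  The rooted binary tree: vertices are finite words over two letters, the root is the empty word,
  and the children of \<open>v\<close> are \<open>False # v\<close> and \<open>True # v\<close>.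
\<close>

definition binary_tree :: "bool list ugraph" where
  "binary_tree = \<lparr>verts = UNIV, edges = {{v, b # v} |v b. True}\<rparr>"

text \<open>
  A configuration is encoded by the set of its frozen vertices (the others are warm) and the set of
  its open edges (the others are closed).
\<close>

record 'v config =
  frozen :: "'v set"
  opened :: "'v set set"

definition config_on :: "'v ugraph \<Rightarrow> 'v config \<Rightarrow> bool" where
  "config_on G x \<longleftrightarrow> frozen x \<subseteq> verts G \<and> opened x \<subseteq> edges G"

definition initial_config :: "'v config" where
  "initial_config = \<lparr>frozen = {}, opened = {}\<rparr>"

definition restrict_config :: "'v ugraph \<Rightarrow> 'v config \<Rightarrow> 'v config" where
  "restrict_config G x = \<lparr>frozen = frozen x \<inter> verts G, opened = opened x \<inter> edges G\<rparr>"

definition cluster :: "'v config \<Rightarrow> 'v \<Rightarrow> 'v set" where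
  "cluster x v = component (opened x) v"

definition clusters :: "'v ugraph \<Rightarrow> 'v config \<Rightarrow> 'v set set" where
  "clusters G x = cluster x ` verts G"


section \<open>Continuous-time Markov chains on finite state spaces\<close>

text \<open>
  A chain is given by its generator \<open>L\<close>, acting on functions of the state.
  \<open>transition L t f x\<close> is the expectation of \<open>f\<close> at time \<open>t\<close> for the chain started in \<open>x\<close>:
  the exponential \<open>exp (t L) f x\<close> for finite \<open>t\<close>, and its limit as the time tends to infinity for
  \<open>t = \<infinity>\<close>. The limit exists for the chains used below, which almost surely reach an absorbing state.
\<close>

definition transition_fin :: "(('s \<Rightarrow> real) \<Rightarrow> 's \<Rightarrow> real) \<Rightarrow> real \<Rightarrow> ('s \<Rightarrow> real) \<Rightarrow> 's \<Rightarrow> real" where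
  "transition_fin L t f x = (\<Sum>n. t ^ n / fact n * (L ^^ n) f x)"

definition transition :: "(('s \<Rightarrow> real) \<Rightarrow> 's \<Rightarrow> real) \<Rightarrow> ennreal \<Rightarrow> ('s \<Rightarrow> real) \<Rightarrow> 's \<Rightarrow> real" where
  "transition L t f x =
     (if t = \<infinity> then Lim at_top (\<lambda>u. transition_fin L u f x)
      else transition_fin L (enn2real t) f x)"

text \<open>
  \<open>chain_prob L x s [(t\<^sub>1, A\<^sub>1), \<dots>, (t\<^sub>m, A\<^sub>m)]\<close>, for \<open>s \<le> t\<^sub>1 < \<dots> < t\<^sub>m\<close>, is the probability that the chain
  with generator \<open>L\<close> that is in state \<open>x\<close> at time \<open>s\<close> is in \<open>A\<^sub>i\<close> at time \<open>t\<^sub>i\<close> for every \<open>i\<close>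
  (Markov property). Since the times increase, only the last one can be infinite.
\<close>

fun chain_prob ::
  "(('s \<Rightarrow> real) \<Rightarrow> 's \<Rightarrow> real) \<Rightarrow> 's \<Rightarrow> ennreal \<Rightarrow> (ennreal \<times> 's set) list \<Rightarrow> real" where
  "chain_prob L x s [] = 1"
| "chain_prob L x s ((t, A) # obs) =
     transition L (t - s) (\<lambda>y. indicator A y * chain_prob L y t obs) x"


section \<open>Percolation with constant freezing\<close>

text \<open>
  In the second sum every cluster, frozen or not, has rate \<open>\<alpha>\<close>; freezing a frozen cluster again
  leaves the configuration unchanged and contributes \<open>0\<close>.
\<close>

definition pcf_generator ::
  "real \<Rightarrow> 'v ugraph \<Rightarrow> ('v config \<Rightarrow> real) \<Rightarrow> 'v config \<Rightarrow> real" where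
  "pcf_generator \<alpha> G f x =
     (\<Sum>e | e \<in> edges G \<and> e \<notin> opened x \<and> e \<inter> frozen x = {}.
        f (x\<lparr>opened := insert e (opened x)\<rparr>) - f x) +
     (\<Sum>C\<in>clusters G x. \<alpha> * (f (x\<lparr>frozen := frozen x \<union> C\<rparr>) - f x))"

text \<open>
  The finite-dimensional distributions of rate \<open>\<alpha>\<close> PCF on the finite graph \<open>G\<close>, restricted to \<open>\<Lambda>\<close>.
\<close>

definition pcf_fdd ::
  "real \<Rightarrow> 'v ugraph \<Rightarrow> 'v ugraph \<Rightarrow> (ennreal \<times> 'v config) list \<Rightarrow> real" where
  "pcf_fdd \<alpha> G \<Lambda> obs =
     chain_prob (pcf_generator \<alpha> G) initial_config 0
       (map (\<lambda>(t, \<xi>). (t, {x. restrict_config \<Lambda> x = \<xi>})) obs)"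

text \<open>
  The infinite volume process, characterised as the local limit of finite volume PCF.
  Configurations restricted to a finite \<open>\<Lambda>\<close> take finitely many values, so convergence in law of the
  restricted processes is convergence of the probabilities of all sequences of values
  at finitely many times in \<open>[0, \<infinity>]\<close>.
\<close>

definition infinite_volume_pcf ::
  "real \<Rightarrow> 'v ugraph \<Rightarrow> 'w measure \<Rightarrow> (ennreal \<Rightarrow> 'w \<Rightarrow> 'v config) \<Rightarrow> bool" where
  "infinite_volume_pcf \<alpha> T M \<eta> \<longleftrightarrow>
     prob_space M \<and>
     (\<forall>t. \<forall>\<omega>\<in>space M. config_on T (\<eta> t \<omega>)) \<and>
     (\<forall>t. \<forall>v\<in>verts T. {\<omega>\<in>space M. v \<in> frozen (\<eta> t \<omega>)} \<in> sets M) \<and>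
     (\<forall>t. \<forall>e\<in>edges T. {\<omega>\<in>space M. e \<in> opened (\<eta> t \<omega>)} \<in> sets M) \<and>
     (\<forall>\<Lambda> G obs. finite_subgraph \<Lambda> T \<longrightarrow> exhaustion T G \<longrightarrow> sorted_wrt (<) (map fst obs) \<longrightarrow>
        (\<lambda>n. pcf_fdd \<alpha> (G n) \<Lambda> obs) \<longlonglongrightarrow>
          measure M {\<omega>\<in>space M. \<forall>(t, \<xi>)\<in>set obs. restrict_config \<Lambda> (\<eta> t \<omega>) = \<xi>})"

text \<open>
  The law of the size of the cluster of \<open>v\<close> when it freezes. A frozen cluster does not change
  any more, so this is its size in the final configuration. The finiteness condition matters for
  \<open>k = 0\<close> only, as \<open>card\<close> is \<open>0\<close> on infinite sets.
\<close>

definition cluster_size_prob ::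
  "'w measure \<Rightarrow> (ennreal \<Rightarrow> 'w \<Rightarrow> 'v config) \<Rightarrow> 'v \<Rightarrow> nat \<Rightarrow> real" where
  "cluster_size_prob M \<eta> v k =
     measure M {\<omega>\<in>space M. finite (cluster (\<eta> \<infinity> \<omega>) v) \<and> card (cluster (\<eta> \<infinity> \<omega>) v) = k}"

end

theory Submission
  imports Defs "HOL-Library.Sublist" "HOL-Computational_Algebra.Formal_Power_Series"
    "HOL-Real_Asymp.Real_Asymp"
begin

text \<open>
  Let each cluster freeze when a rate \<open>\<alpha>\<close> clock at its vertex nearest to the root rings. Then, given that
  the root freezes at time \<open>s\<close>, its cluster is a Galton--Watson tree in which every vertex keeps each of
  its two children independently with probability \<open>p(s) = (1 - e\<^sup>-\<^sup>(\<^sup>1\<^sup>+\<^sup>\<alpha>\<^sup>)\<^sup>s) / (1 + \<alpha>)\<close>: the edge to a child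
  must open before the child freezes and before \<open>s\<close>. Hence the root cluster has size \<open>k\<close> with probability
  \<open>C\<^sub>k \<integral> \<alpha> e\<^sup>-\<^sup>\<alpha>\<^sup>s p\<^sup>k\<^sup>-\<^sup>1 (1 - p)\<^sup>k\<^sup>+\<^sup>1 ds\<close> with the Catalan number \<open>C\<^sub>k \<sim> c 4\<^sup>k k\<^sup>-\<^sup>3\<^sup>/\<^sup>2\<close>. The integrand peaks
  where \<open>p(s) = 1/2\<close>, which happens at a finite time for \<open>\<alpha> < 1\<close>, in the limit \<open>s \<rightarrow> \<infinity>\<close> for \<open>\<alpha> = 1\<close>
  and never for \<open>\<alpha> > 1\<close>.

  No clocks are needed to see this: the probabilities that a warm vertex sees a given pattern of edges
  below it solve a triangular system of linear ODEs, by the forward equation. Since clusters freeze at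
  a rate that does not depend on their size, the process restricted to a subtree containing the root is
  the process on that subtree, so the local limit is attained exactly. For \<open>\<alpha> < 1\<close>, a vertex cuts itself
  off from its parent and has an infinite cluster with probability bounded below given everything outside
  its subtree; disjoint subtrees give almost sure existence.
\<close>

subsection \<open>Jump chains without cycles\<close>

text \<open>The infinite process is known only through limits of finite-volume laws, so every
  probability has to come from the generator, without trajectories or independence. A warm top
  freezes at rate \<alpha>, and this fixes the pattern below it; hence the final law of a pattern is
  the time integral of \<alpha> times its law below a warm vertex. What happens outside a subtree
  enters as a weight multiplied to the pattern. For such products only a differential inequality is
  available, so all comparisons are lower bounds, with weights of either sign; the weights 1 and -1
  together give exact values.

  The exponents add the Catalan 3/2 and the decay of the integral. For \<alpha> < 1 the peak is
  quadratic in time, of width \<open>k powr (- 1 / 2)\<close>. For \<alpha> = 1, where 1 - 2 p(s) =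
  exp (- 2 s), the integrand is cut off before time (ln k) / 4, up to which the root stays warm with
  probability \<open>k powr (- 1 / 4)\<close>. For \<alpha> > 1, p stays below 1 / (1 + \<alpha>) <
  1/2, so 4 p (1 - p) stays below a constant less than 1.\<close>

lemma real_DERIV_nonneg_imp_le:
  fixes f :: "real \<Rightarrow> real"
  assumes "a \<le> b" "\<And>t. a \<le> t \<Longrightarrow> (f has_real_derivative f' t) (at t)" "\<And>t. a \<le> t \<Longrightarrow> 0 \<le> f' t"
  shows "f a \<le> f b"
  using assms by (intro DERIV_nonneg_imp_nondecreasing[of a b f]) auto

lemma linear_ode_nonneg:
  fixes u :: "real \<Rightarrow> real"
  assumes "\<And>t. 0 \<le> t \<Longrightarrow> (u has_real_derivative (g t - c * u t)) (at t)"
    and "\<And>t. 0 \<le> t \<Longrightarrow> 0 \<le> g t" and "0 \<le> u 0" and "0 \<le> t"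
  shows "0 \<le> u t"
proof -
  have "exp (c * 0) * u 0 \<le> exp (c * t) * u t"
  proof (rule real_DERIV_nonneg_imp_le[where f = "\<lambda>t. exp (c * t) * u t" and f' = "\<lambda>t. exp (c * t) * g t"])
    fix s :: real assume "0 \<le> s"
    show "((\<lambda>s. exp (c * s) * u s) has_real_derivative exp (c * s) * g s) (at s)"
      by (rule derivative_eq_intros assms(1)[OF \<open>0 \<le> s\<close>] refl)+ (simp add: algebra_simps)
  qed (use assms in auto)
  with assms(3) have "0 \<le> exp (c * t) * u t" by simp
  then show ?thesis by (simp add: zero_le_mult_iff)
qed

text \<open>Variation of constants without the integral: l'Hopital for
  \<open>exp (c * t) * u t\<close> over \<open>exp (c * t)\<close>, in the form in which only the
  denominator has to diverge.\<close>

lemma linear_ode_limit: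
  fixes u :: "real \<Rightarrow> real"
  assumes "\<And>t. 0 \<le> t \<Longrightarrow> (u has_real_derivative (g t - c * u t)) (at t)"
    and "c > 0" and "(g \<longlongrightarrow> l) at_top"
  shows "(u \<longlongrightarrow> l / c) at_top"
proof -
  have "((\<lambda>t. (exp (c * t) * u t) / exp (c * t)) \<longlongrightarrow> l / c) at_top"
  proof (rule lhospital_at_top_at_top)
    show "LIM t at_top. exp (c * t) :> at_top"
      using assms(2) by (intro filterlim_compose[OF exp_at_top] filterlim_tendsto_pos_mult_at_top[OF tendsto_const]) (auto intro: filterlim_ident)
    show "\<forall>\<^sub>F t in at_top. c * exp (c * t) \<noteq> 0"
      using assms(2) by simp
    show "\<forall>\<^sub>F t in at_top. ((\<lambda>t. exp (c * t) * u t) has_real_derivative exp (c * t) * g t) (at t)"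
      using eventually_ge_at_top[of 0]
    proof eventually_elim
      case (elim t)
      show ?case
        by (rule derivative_eq_intros assms(1)[OF elim] refl)+ (simp add: algebra_simps)
    qed
    show "\<forall>\<^sub>F t in at_top. ((\<lambda>t. exp (c * t)) has_real_derivative c * exp (c * t)) (at t)"
      by (intro always_eventually allI) (auto intro!: derivative_eq_intros)
    have "((\<lambda>t. g t / c) \<longlongrightarrow> l / c) at_top"
      using assms by (intro tendsto_divide) auto
    thus "((\<lambda>t. exp (c * t) * g t / (c * exp (c * t))) \<longlongrightarrow> l / c) at_top"
      by (simp add: mult.commute)
  qed
  thus ?thesis by simp
qed

text \<open>The generator is prescribed on \<open>S\<close> only, since \<open>pcf_generator\<close>
  also acts on configurations that never occur. Moves that do nothing are allowed because refreezing
  a frozen cluster is one; at all others the rank drops, which excludes cycles.\<close>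

locale jump_chain =
  fixes S :: "'s set" and J :: "'s \<Rightarrow> 'i set" and c :: "'i \<Rightarrow> real" and T :: "'i \<Rightarrow> 's \<Rightarrow> 's"
    and rk :: "'s \<Rightarrow> nat" and L :: "('s \<Rightarrow> real) \<Rightarrow> 's \<Rightarrow> real"
  assumes fin_S: "finite S" and fin_J: "x \<in> S \<Longrightarrow> finite (J x)"
    and T_S: "x \<in> S \<Longrightarrow> i \<in> J x \<Longrightarrow> T i x \<in> S"
    and c_pos: "x \<in> S \<Longrightarrow> i \<in> J x \<Longrightarrow> c i > 0"
    and L_eq: "x \<in> S \<Longrightarrow> L f x = (\<Sum>i\<in>J x. c i * (f (T i x) - f x))"
    and rk: "x \<in> S \<Longrightarrow> i \<in> J x \<Longrightarrow> T i x \<noteq> x \<Longrightarrow> rk (T i x) < rk x"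
begin

definition absorbing :: "'s \<Rightarrow> bool" where
  "absorbing x \<longleftrightarrow> (\<forall>i\<in>J x. T i x = x)"

abbreviation tf where "tf \<equiv> transition_fin L"

lemma L_cong: "(\<And>x. x \<in> S \<Longrightarrow> f x = g x) \<Longrightarrow> x \<in> S \<Longrightarrow> L f x = L g x"
  by (simp add: L_eq T_S cong: sum.cong)

lemma L_add: "x \<in> S \<Longrightarrow> L (\<lambda>x. f x + g x) x = L f x + L g x"
  by (simp add: L_eq algebra_simps sum.distrib sum_subtractf)

lemma L_cmult: "x \<in> S \<Longrightarrow> L (\<lambda>x. k * f x) x = k * L f x"
  by (simp add: L_eq sum_distrib_left algebra_simps)

lemma L_pow_add: "x \<in> S \<Longrightarrow> (L ^^ n) (\<lambda>x. f x + g x) x = (L ^^ n) f x + (L ^^ n) g x"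
proof (induction n arbitrary: x)
  case (Suc n)
  have "L ((L ^^ n) (\<lambda>x. f x + g x)) x = L (\<lambda>x. (L ^^ n) f x + (L ^^ n) g x) x"
    using Suc by (intro L_cong) auto
  with Suc.prems show ?case by (simp add: L_add)
qed auto

lemma L_pow_cmult: "x \<in> S \<Longrightarrow> (L ^^ n) (\<lambda>x. k * f x) x = k * (L ^^ n) f x"
proof (induction n arbitrary: x)
  case (Suc n)
  have "L ((L ^^ n) (\<lambda>x. k * f x)) x = L (\<lambda>x. k * (L ^^ n) f x) x"
    using Suc by (intro L_cong) auto
  with Suc.prems show ?case by (simp add: L_cmult)
qed auto

lemma L_pow_bound:
  obtains K where "K \<ge> 0" "\<And>f n x. x \<in> S \<Longrightarrow> \<bar>(L ^^ n) f x\<bar> \<le> K ^ n * (\<Sum>y\<in>S. \<bar>f y\<bar>)"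
proof
  define K where "K = (\<Sum>x\<in>S. \<Sum>i\<in>J x. 2 * c i)"
  define N where "N f = (\<Sum>y\<in>S. \<bar>f y :: real\<bar>)" for f
  have le_N: "\<bar>f x\<bar> \<le> N f" if "x \<in> S" for f x
    unfolding N_def using that fin_S by (intro member_le_sum) auto
  have N_pos: "N f \<ge> 0" for f unfolding N_def by (simp add: sum_nonneg)
  show "K \<ge> 0"
    unfolding K_def by (intro sum_nonneg) (use c_pos in force)
  have N_L: "N (L f) \<le> K * N f" for f
  proof -
    have "N (L f) \<le> (\<Sum>x\<in>S. \<Sum>i\<in>J x. 2 * c i * N f)"
      unfolding N_def[of "L f"]
    proof (rule sum_mono)
      fix x assume x: "x \<in> S"
      have "\<bar>L f x\<bar> \<le> (\<Sum>i\<in>J x. \<bar>c i * (f (T i x) - f x)\<bar>)"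
        using x by (simp add: L_eq)
      also have "\<dots> \<le> (\<Sum>i\<in>J x. 2 * c i * N f)"
      proof (rule sum_mono)
        fix i assume i: "i \<in> J x"
        have "\<bar>f (T i x) - f x\<bar> \<le> 2 * N f"
          using le_N[OF T_S[OF x i], where f = f] le_N[OF x, where f = f] by linarith
        then show "\<bar>c i * (f (T i x) - f x)\<bar> \<le> 2 * c i * N f"
          using c_pos[OF x i] by (simp add: abs_mult)
      qed
      finally show "\<bar>L f x\<bar> \<le> (\<Sum>i\<in>J x. 2 * c i * N f)" .
    qed
    also have "\<dots> = K * N f" by (simp add: K_def sum_distrib_right)
    finally show ?thesis .
  qed
  have "N ((L ^^ n) f) \<le> K ^ n * N f" for n f
  proof (induction n)
    case (Suc n)
    have "N ((L ^^ Suc n) f) \<le> K * N ((L ^^ n) f)" using N_L by simp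
    also have "\<dots> \<le> K * (K ^ n * N f)" using Suc \<open>K \<ge> 0\<close> by (intro mult_left_mono)
    finally show ?case by simp
  qed simp
  then show "\<bar>(L ^^ n) f x\<bar> \<le> K ^ n * (\<Sum>y\<in>S. \<bar>f y\<bar>)" if "x \<in> S" for f n x
    using le_N[OF that] order_trans unfolding N_def by blast
qed

lemma tf_summable:
  assumes "x \<in> S"
  shows "summable (\<lambda>n. t ^ n / fact n * (L ^^ n) f x)"
proof -
  obtain K where K: "K \<ge> 0" "\<And>f n x. x \<in> S \<Longrightarrow> \<bar>(L ^^ n) f x\<bar> \<le> K ^ n * (\<Sum>y\<in>S. \<bar>f y\<bar>)"
    using L_pow_bound by blast
  have "summable (\<lambda>n. (\<Sum>y\<in>S. \<bar>f y\<bar>) * (inverse (fact n) * (\<bar>t\<bar> * K) ^ n))"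
    by (intro summable_mult summable_exp)
  then show ?thesis
  proof (rule summable_comparison_test[rotated], intro exI allI impI)
    fix n
    have "norm (t ^ n / fact n * (L ^^ n) f x) = \<bar>t\<bar> ^ n / fact n * \<bar>(L ^^ n) f x\<bar>"
      by (simp add: abs_mult power_abs)
    also have "\<dots> \<le> \<bar>t\<bar> ^ n / fact n * (K ^ n * (\<Sum>y\<in>S. \<bar>f y\<bar>))"
      using K(2)[OF assms] by (intro mult_left_mono) auto
    also have "\<dots> = (\<Sum>y\<in>S. \<bar>f y\<bar>) * (inverse (fact n) * (\<bar>t\<bar> * K) ^ n)"
      by (simp add: field_simps power_mult_distrib)
    finally show "norm (t ^ n / fact n * (L ^^ n) f x) \<le> \<dots>" .
  qed
qed

lemma tf_add: "x \<in> S \<Longrightarrow> tf t (\<lambda>x. f x + g x) x = tf t f x + tf t g x"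
  unfolding transition_fin_def
  using suminf_add[OF tf_summable[of x t f] tf_summable[of x t g]] by (simp add: L_pow_add ring_distribs)

lemma tf_cmult: "x \<in> S \<Longrightarrow> tf t (\<lambda>x. k * f x) x = k * tf t f x"
  unfolding transition_fin_def
  using suminf_mult[OF tf_summable[of x t f], of k] by (simp add: L_pow_cmult mult.left_commute)

lemma tf_uminus: "x \<in> S \<Longrightarrow> tf t (\<lambda>x. - f x) x = - tf t f x"
  using tf_cmult[of x t "-1" f] by simp

lemma tf_diff: "x \<in> S \<Longrightarrow> tf t (\<lambda>x. f x - g x) x = tf t f x - tf t g x"
  using tf_add[of x t f "\<lambda>x. - g x"] by (simp add: tf_uminus)

lemma tf_zero: "x \<in> S \<Longrightarrow> tf t (\<lambda>_. 0) x = 0"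
  using tf_cmult[of x t 0 "\<lambda>_. 0"] by simp

lemma tf_sum: "x \<in> S \<Longrightarrow> tf t (\<lambda>x. \<Sum>i\<in>A. f i x) x = (\<Sum>i\<in>A. tf t (f i) x)"
proof (induction A rule: infinite_finite_induct)
  case (insert i A)
  then show ?case using tf_add[of x t "f i" "\<lambda>x. \<Sum>i\<in>A. f i x"] by simp
qed (simp_all add: tf_zero)

lemma tf_0: "tf 0 f x = f x"
  unfolding transition_fin_def
  using powser_zero[of "\<lambda>n. (L ^^ n) f x / fact n"] by (simp add: mult.commute)

lemma tf_deriv:
  assumes "x \<in> S"
  shows "((\<lambda>t. tf t f x) has_real_derivative tf t (L f) x) (at t)"
proof -
  define a where "a = (\<lambda>n. (L ^^ n) f x / fact n)"
  have "((\<lambda>t. \<Sum>n. a n * t ^ n) has_real_derivative (\<Sum>n. diffs a n * t ^ n)) (at t)"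
    by (rule termdiffs_strong_converges_everywhere)
      (use tf_summable[OF assms] in \<open>simp add: a_def mult.commute\<close>)
  moreover have "diffs a n = (L ^^ n) (L f) x / fact n" for n
    unfolding diffs_def a_def by (simp add: funpow_swap1 del: of_nat_Suc)
  ultimately show ?thesis
    unfolding transition_fin_def a_def by (simp add: mult.commute)
qed

text \<open>Backward equation, as opposed to the forward equation \<open>tf_deriv\<close>: powers of
  \<open>L\<close> commute with \<open>L\<close>, so \<open>L\<close> can be moved to the starting
  state, where it is the explicit sum over moves.\<close>

lemma tf_L:
  assumes "x \<in> S"
  shows "tf t (L f) x = (\<Sum>i\<in>J x. c i * (tf t f (T i x) - tf t f x))"
proof -
  have "(\<lambda>n. \<Sum>i\<in>J x. c i * (t ^ n / fact n * (L ^^ n) f (T i x) - t ^ n / fact n * (L ^^ n) f x))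
     sums (\<Sum>i\<in>J x. c i * (tf t f (T i x) - tf t f x))"
    unfolding transition_fin_def
    by (intro sums_sum sums_mult sums_diff summable_sums tf_summable assms T_S[OF assms])
  moreover have "(\<Sum>i\<in>J x. c i * (t ^ n / fact n * (L ^^ n) f (T i x) - t ^ n / fact n * (L ^^ n) f x))
     = t ^ n / fact n * (L ^^ n) (L f) x" for n
  proof -
    have "(L ^^ n) (L f) x = L ((L ^^ n) f) x" by (simp add: funpow_swap1)
    then show ?thesis
      using assms by (simp add: L_eq sum_distrib_left algebra_simps)
  qed
  ultimately show ?thesis
    unfolding transition_fin_def by (simp add: sums_iff)
qed

lemma tf_L_effective:
  assumes "x \<in> S"
  defines "J' \<equiv> {i\<in>J x. T i x \<noteq> x}"
  shows "tf t (L f) x = (\<Sum>i\<in>J'. c i * tf t f (T i x)) - (\<Sum>i\<in>J'. c i) * tf t f x"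
proof -
  have "tf t (L f) x = (\<Sum>i\<in>J'. c i * (tf t f (T i x) - tf t f x))"
    unfolding tf_L[OF assms(1)] J'_def
    using fin_J[OF assms(1)] by (intro sum.mono_neutral_right) auto
  also have "\<dots> = (\<Sum>i\<in>J'. c i * tf t f (T i x)) - (\<Sum>i\<in>J'. c i) * tf t f x"
    by (simp add: right_diff_distrib sum_subtractf sum_distrib_right)
  finally show ?thesis .
qed

text \<open>
  Every effective jump lowers the rank, so the backward equations form a triangular system of
  scalar linear ODEs; positivity and convergence follow by induction on the rank.
\<close>

lemma tf_nonneg:
  assumes "\<And>x. x \<in> S \<Longrightarrow> 0 \<le> f x" "x \<in> S" "0 \<le> t"
  shows "0 \<le> tf t f x"
  using assms(2,3)
proof (induction "rk x" arbitrary: x t rule: less_induct)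
  case (less x)
  define J' where "J' = {i\<in>J x. T i x \<noteq> x}"
  show ?case
  proof (rule linear_ode_nonneg[where c = "\<Sum>i\<in>J'. c i" and u = "\<lambda>t. tf t f x"])
    show "((\<lambda>t. tf t f x) has_real_derivative
        (\<Sum>i\<in>J'. c i * tf t f (T i x)) - (\<Sum>i\<in>J'. c i) * tf t f x) (at t)" for t
      using tf_deriv[OF less.prems(1)] tf_L_effective[OF less.prems(1)] by (simp add: J'_def)
    show "0 \<le> (\<Sum>i\<in>J'. c i * tf s f (T i x))" if "0 \<le> s" for s
      using that less.prems rk[OF less.prems(1)] c_pos[OF less.prems(1)]
      by (intro sum_nonneg mult_nonneg_nonneg less.hyps) (auto simp: J'_def T_S less_imp_le)
  qed (use assms less.prems in \<open>auto simp: tf_0\<close>)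
qed

lemma tf_mono:
  assumes "\<And>x. x \<in> S \<Longrightarrow> f x \<le> g x" "x \<in> S" "0 \<le> t"
  shows "tf t f x \<le> tf t g x"
  using tf_nonneg[of "\<lambda>x. g x - f x" x t] assms by (simp add: tf_diff)

section \<open>Limits as time tends to infinity\<close>

definition fin :: "('s \<Rightarrow> real) \<Rightarrow> 's \<Rightarrow> real" where
  "fin f x = Lim at_top (\<lambda>t. tf t f x)"

text \<open>Existence of the limit and its vanishing are proved in one induction. The second clause
  says that the limit law is carried by absorbing states, which is what lets \<open>fin_cong\<close>
  compare functions there only.\<close>

lemma fin_tendsto_aux:
  assumes "x \<in> S"
  shows "\<exists>l. ((\<lambda>t. tf t f x) \<longlongrightarrow> l) at_top \<and> ((\<forall>y\<in>S. absorbing y \<longrightarrow> f y = 0) \<longrightarrow> l = 0)"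
  using assms
proof (induction "rk x" arbitrary: x rule: less_induct)
  case (less x)
  define J' where "J' = {i\<in>J x. T i x \<noteq> x}"
  have J': "finite J'" "\<And>i. i \<in> J' \<Longrightarrow> c i > 0" "\<And>i. i \<in> J' \<Longrightarrow> T i x \<in> S \<and> rk (T i x) < rk x"
    using fin_J[OF less.prems] c_pos[OF less.prems] T_S[OF less.prems] rk[OF less.prems]
    by (auto simp: J'_def)
  have der: "((\<lambda>t. tf t f x) has_real_derivative
        (\<Sum>i\<in>J'. c i * tf t f (T i x)) - (\<Sum>i\<in>J'. c i) * tf t f x) (at t)" for t
      using tf_deriv[OF less.prems(1)] tf_L_effective[OF less.prems(1)] by (simp add: J'_def)
  show ?case
  proof (cases "J' = {}")
    case True
    then have "((\<lambda>t. tf t f x) has_real_derivative 0) (at t)" for t using der[of t] by simp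
    then have "tf t f x = tf 0 f x" for t by (rule DERIV_isconst_all[rule_format])
    then have "tf t f x = f x" for t by (simp add: tf_0)
    then have "((\<lambda>t. tf t f x) \<longlongrightarrow> f x) at_top" by simp
    moreover have "absorbing x" using True unfolding absorbing_def J'_def by blast
    ultimately show ?thesis using less.prems by blast
  next
    case False
    obtain l where l: "\<And>i. i \<in> J' \<Longrightarrow> ((\<lambda>t. tf t f (T i x)) \<longlongrightarrow> l i) at_top"
      "\<And>i. i \<in> J' \<Longrightarrow> (\<forall>y\<in>S. absorbing y \<longrightarrow> f y = 0) \<Longrightarrow> l i = 0"
    proof -
      have "\<forall>i\<in>J'. \<exists>l. ((\<lambda>t. tf t f (T i x)) \<longlongrightarrow> l) at_top
          \<and> ((\<forall>y\<in>S. absorbing y \<longrightarrow> f y = 0) \<longrightarrow> l = 0)"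
        using less.hyps J'(3) by blast
      from bchoice[OF this] show ?thesis using that by blast
    qed
    \<comment> \<open>The limit is the average of the limits at the successors, weighted by the jump
      rates.\<close>
    have "((\<lambda>t. tf t f x) \<longlongrightarrow> (\<Sum>i\<in>J'. c i * l i) / (\<Sum>i\<in>J'. c i)) at_top"
    proof (rule linear_ode_limit[OF der])
      show "(\<Sum>i\<in>J'. c i) > 0" using False J' by (intro sum_pos) auto
      show "((\<lambda>t. \<Sum>i\<in>J'. c i * tf t f (T i x)) \<longlongrightarrow> (\<Sum>i\<in>J'. c i * l i)) at_top"
        by (intro tendsto_sum tendsto_mult tendsto_const l(1))
    qed
    moreover have "(\<Sum>i\<in>J'. c i * l i) / (\<Sum>i\<in>J'. c i) = 0" if "\<forall>y\<in>S. absorbing y \<longrightarrow> f y = 0"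
      using l(2)[OF _ that] by simp
    ultimately show ?thesis by blast
  qed
qed

lemma fin_tendsto: "x \<in> S \<Longrightarrow> ((\<lambda>t. tf t f x) \<longlongrightarrow> fin f x) at_top"
  using fin_tendsto_aux[of x f] tendsto_Lim[OF trivial_limit_at_top_linorder, of "\<lambda>t. tf t f x"]
  unfolding fin_def by auto

lemma fin_eqI: "x \<in> S \<Longrightarrow> ((\<lambda>t. tf t f x) \<longlongrightarrow> l) at_top \<Longrightarrow> fin f x = l"
  using tendsto_unique[OF trivial_limit_at_top_linorder fin_tendsto] by simp

lemma fin_diff: "x \<in> S \<Longrightarrow> fin (\<lambda>x. f x - g x) x = fin f x - fin g x"
  by (rule fin_eqI) (auto simp: tf_diff intro!: tendsto_diff fin_tendsto)

lemma fin_sum: "x \<in> S \<Longrightarrow> fin (\<lambda>x. \<Sum>i\<in>A. f i x) x = (\<Sum>i\<in>A. fin (f i) x)"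
  by (rule fin_eqI) (auto simp: tf_sum intro!: tendsto_sum fin_tendsto)

lemma fin_absorbing_0:
  assumes "\<And>y. y \<in> S \<Longrightarrow> absorbing y \<Longrightarrow> f y = 0" "x \<in> S"
  shows "fin f x = 0"
  using fin_tendsto_aux[OF assms(2), of f] assms fin_eqI by blast

lemma fin_cong:
  assumes "\<And>y. y \<in> S \<Longrightarrow> absorbing y \<Longrightarrow> f y = g y" "x \<in> S"
  shows "fin f x = fin g x"
  using fin_absorbing_0[of "\<lambda>x. f x - g x" x] fin_diff[of x f g] assms by simp

lemma fin_mono:
  assumes "\<And>y. y \<in> S \<Longrightarrow> f y \<le> g y" "x \<in> S"
  shows "fin f x \<le> fin g x"
proof (rule tendsto_le[OF _ fin_tendsto fin_tendsto])
  show "\<forall>\<^sub>F t in at_top. tf t f x \<le> tf t g x"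
    using eventually_ge_at_top[of 0] by eventually_elim (use assms in \<open>auto intro: tf_mono\<close>)
qed (use assms in auto)

lemma L_const: "x \<in> S \<Longrightarrow> L (\<lambda>_. k) x = 0"
  by (simp add: L_eq)

lemma L_pow_absorbing:
  assumes "x \<in> S" "absorbing x"
  shows "(L ^^ n) f x = (if n = 0 then f x else 0)"
proof (cases n)
  case (Suc m)
  then show ?thesis using assms by (simp add: L_eq absorbing_def)
qed simp

lemma tf_absorbing: "x \<in> S \<Longrightarrow> absorbing x \<Longrightarrow> tf t f x = f x"
  unfolding transition_fin_def
  by (subst suminf_finite[of "{0}"]) (auto simp: L_pow_absorbing)

lemma fin_absorbing: "x \<in> S \<Longrightarrow> absorbing x \<Longrightarrow> fin f x = f x"
  by (rule fin_eqI) (auto simp: tf_absorbing)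

text \<open>The expectation of a terminal quantity is harmonic: \<open>L f\<close> vanishes at
  absorbing states, so its own limit is 0, while the backward equation identifies that limit with
  \<open>L (fin f)\<close>. In \<open>spectator_cut\<close> this makes the outside factor a
  martingale.\<close>

lemma L_fin:
  assumes "x \<in> S"
  shows "L (fin f) x = 0"
proof -
  have lim: "((\<lambda>t. tf t (L f) x) \<longlongrightarrow> L (fin f) x) at_top"
    unfolding tf_L[OF assms] L_eq[OF assms]
    by (intro tendsto_sum tendsto_mult tendsto_diff tendsto_const fin_tendsto assms T_S[OF assms])
  moreover have "fin (L f) x = 0"
    by (rule fin_absorbing_0[OF _ assms]) (simp add: L_eq absorbing_def)
  ultimately show ?thesis using fin_eqI[OF assms lim] by simp
qed

end

subsection \<open>Freezing percolation on finite subtrees\<close>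

definition linked :: "bool list config \<Rightarrow> bool list \<Rightarrow> bool" where
  "linked x v \<longleftrightarrow> v \<noteq> [] \<and> {tl v, v} \<in> opened x"

fun apex :: "bool list config \<Rightarrow> bool list \<Rightarrow> bool list" where
  "apex x [] = []"
| "apex x (b # v) = (if linked x (b # v) then apex x v else b # v)"

definition tree_on :: "bool list set \<Rightarrow> bool list ugraph" where
  "tree_on P = \<lparr>verts = P, edges = {{tl v, v} |v. v \<in> P \<and> v \<noteq> []}\<rparr>"

lemma parent_edge_eq_iff:
  assumes "v \<noteq> []" "w \<noteq> []"
  shows "{tl v, v} = {tl w, w} \<longleftrightarrow> v = w"
proof -
  have "length v \<noteq> length (tl w) \<or> length w \<noteq> length (tl v)" using assms by (cases v; cases w) auto
  then have "\<not> (v = tl w \<and> w = tl v)" by metis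
  then show ?thesis by (auto simp: doubleton_eq_iff)
qed

lemma not_op_Nil [simp]: "\<not> linked x []" by (simp add: linked_def)

lemma not_op_apex [simp]: "\<not> linked x (apex x v)"
  by (induction v) auto

lemma apex_eq_self [simp]: "\<not> linked x v \<Longrightarrow> apex x v = v"
  by (cases v) auto

lemma apex_op: "linked x v \<Longrightarrow> apex x v = apex x (tl v)"
  by (cases v) auto

lemma suffix_apex: "suffix (apex x v) v"
  by (induction v) (auto simp: suffix_Cons)

text \<open>An open edge joins a vertex to its parent and hence preserves the apex, and every vertex
  is connected to its apex by open parent edges. So the apex is a canonical name for the
  component.\<close>

lemma component_eq_apex:
  assumes "\<And>e. e \<in> opened x \<Longrightarrow> \<exists>v. v \<noteq> [] \<and> e = {tl v, v}"
  shows "component (opened x) v = {w. apex x w = apex x v}"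
proof -
  define R where "R = {(a, b). {a, b} \<in> opened x}"
  have same: "apex x a = apex x b" if ab: "(a, b) \<in> R" for a b
  proof -
    have ab': "{a, b} \<in> opened x" using ab by (simp add: R_def)
    then obtain u where u: "u \<noteq> []" "{a, b} = {tl u, u}" using assms by blast
    have "linked x u" using ab' unfolding u(2) linked_def using u(1) by blast
    then have "apex x u = apex x (tl u)" by (rule apex_op)
    moreover have "a = tl u \<and> b = u \<or> a = u \<and> b = tl u" using u(2) by (simp only: doubleton_eq_iff)
    ultimately show ?thesis by metis
  qed
  have "sym R" by (rule symI) (simp add: R_def insert_commute)
  then have sym: "sym (R\<^sup>*)" by (rule sym_rtrancl)
  have to_apex: "(v, apex x v) \<in> R\<^sup>*" for v
  proof (induction v)
    case (Cons b v)
    have "(b # v, v) \<in> R" if "linked x (b # v)"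
      using that by (simp add: R_def linked_def insert_commute[of v])
    then have "(b # v, apex x v) \<in> R\<^sup>*" if "linked x (b # v)"
      using that Cons converse_rtrancl_into_rtrancl by metis
    then show ?case by simp
  qed simp
  have "(v, w) \<in> R\<^sup>* \<longleftrightarrow> apex x w = apex x v" for w
  proof
    assume "(v, w) \<in> R\<^sup>*"
    then show "apex x w = apex x v" by induction (use same in force)+
  next
    assume "apex x w = apex x v"
    then show "(v, w) \<in> R\<^sup>*"
      using rtrancl_trans[OF to_apex[of v], of w] symD[OF sym to_apex[of w]] by simp
  qed
  then show ?thesis unfolding component_def R_def by blast
qed

text \<open>An edge is named by its lower end vertex, a cluster by its vertex nearest to the root.\<close>

datatype move = Open "bool list" | Freeze "bool list"

definition open_parent :: "bool list \<Rightarrow> bool list config \<Rightarrow> bool list config" where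
  "open_parent v x = x\<lparr>opened := insert {tl v, v} (opened x)\<rparr>"

definition freeze_at :: "bool list \<Rightarrow> bool list config \<Rightarrow> bool list config" where
  "freeze_at b x = x\<lparr>frozen := frozen x \<union> cluster x b\<rparr>"

fun apply_move :: "move \<Rightarrow> bool list config \<Rightarrow> bool list config" where
  "apply_move (Open v) = open_parent v"
| "apply_move (Freeze b) = freeze_at b"

fun rate :: "real \<Rightarrow> move \<Rightarrow> real" where
  "rate \<alpha> (Open v) = 1"
| "rate \<alpha> (Freeze b) = \<alpha>"

definition openable :: "bool list set \<Rightarrow> bool list config \<Rightarrow> bool list set" where
  "openable P x = {v\<in>P. v \<noteq> [] \<and> \<not> linked x v \<and> v \<notin> frozen x \<and> tl v \<notin> frozen x}"

definition apices :: "bool list set \<Rightarrow> bool list config \<Rightarrow> bool list set" where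
  "apices P x = {b\<in>P. \<not> linked x b}"

definition moves :: "bool list set \<Rightarrow> bool list config \<Rightarrow> move set" where
  "moves P x = Open ` openable P x \<union> Freeze ` apices P x"

text \<open>The second clause is the invariant that every cluster is wholly warm or wholly
  frozen.\<close>

definition valid :: "bool list set \<Rightarrow> bool list config set" where
  "valid P = {x. config_on (tree_on P) x \<and> (\<forall>v. linked x v \<longrightarrow> (v \<in> frozen x \<longleftrightarrow> tl v \<in> frozen x))}"

definition rank :: "bool list set \<Rightarrow> bool list config \<Rightarrow> nat" where
  "rank P x = card (P - frozen x) + card (edges (tree_on P) - opened x)"

lemma frozen_opn [simp]: "frozen (open_parent v x) = frozen x" by (simp add: open_parent_def)

lemma op_opn: "v \<noteq> [] \<Longrightarrow> linked (open_parent v x) w \<longleftrightarrow> w = v \<or> linked x w"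
  unfolding linked_def open_parent_def using parent_edge_eq_iff[of v w] by auto

lemma op_frz [simp]: "linked (freeze_at b x) w \<longleftrightarrow> linked x w" by (simp add: freeze_at_def linked_def)

lemma opened_frz [simp]: "opened (freeze_at b x) = opened x" by (simp add: freeze_at_def)

lemma valid_edges: "x \<in> valid P \<Longrightarrow> e \<in> opened x \<Longrightarrow> \<exists>v. v \<noteq> [] \<and> e = {tl v, v}"
  by (auto simp: valid_def config_on_def tree_on_def)

lemma valid_op_frozen: "x \<in> valid P \<Longrightarrow> linked x v \<Longrightarrow> v \<in> frozen x \<longleftrightarrow> tl v \<in> frozen x"
  by (simp add: valid_def)

lemma valid_op_in: "x \<in> valid P \<Longrightarrow> linked x v \<Longrightarrow> v \<in> P"
proof -
  assume x: "x \<in> valid P" and v: "linked x v"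
  then have "{tl v, v} \<in> edges (tree_on P)" unfolding valid_def config_on_def linked_def by blast
  then obtain w where "w \<in> P" "w \<noteq> []" "{tl v, v} = {tl w, w}" by (auto simp: tree_on_def)
  with v show "v \<in> P" using parent_edge_eq_iff[of v w] by (simp add: linked_def)
qed

lemma valid_frozen_in: "x \<in> valid P \<Longrightarrow> frozen x \<subseteq> P"
  by (simp add: valid_def config_on_def tree_on_def)

lemma cluster_eq_apex: "x \<in> valid P \<Longrightarrow> cluster x v = {w. apex x w = apex x v}"
  unfolding cluster_def by (intro component_eq_apex valid_edges)

lemma frozen_frz:
  assumes "x \<in> valid P" "\<not> linked x b"
  shows "w \<in> frozen (freeze_at b x) \<longleftrightarrow> w \<in> frozen x \<or> apex x w = b"
  using assms by (auto simp: freeze_at_def cluster_eq_apex)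

lemma initial_valid: "initial_config \<in> valid P"
  by (simp add: valid_def initial_config_def config_on_def linked_def)

lemma op_initial [simp]: "\<not> linked initial_config v"
  by (simp add: linked_def initial_config_def)

lemma config_eqI: "frozen x = frozen y \<Longrightarrow> opened x = opened y \<Longrightarrow> x = y"
  for x y :: "'v config"
  by (rule config.equality) auto

lemma finite_edges_tree_on: "finite P \<Longrightarrow> finite (edges (tree_on P))"
  by (auto simp: tree_on_def intro: finite_subset[of _ "(\<lambda>v. {tl v, v}) ` P"])

lemma finite_config_on:
  assumes "finite P"
  shows "finite {x. config_on (tree_on P) x}"
proof (rule finite_subset)
  show "{x. config_on (tree_on P) x}
      \<subseteq> (\<lambda>(A, B). \<lparr>frozen = A, opened = B\<rparr>) ` (Pow P \<times> Pow (edges (tree_on P)))"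
  proof
    fix x :: "bool list config" assume "x \<in> {x. config_on (tree_on P) x}"
    then have x: "frozen x \<in> Pow P" "opened x \<in> Pow (edges (tree_on P))"
      by (auto simp: config_on_def tree_on_def)
    show "x \<in> (\<lambda>(A, B). \<lparr>frozen = A, opened = B\<rparr>) ` (Pow P \<times> Pow (edges (tree_on P)))"
      by (rule image_eqI[of _ _ "(frozen x, opened x)"]) (use x in auto)
  qed
qed (use assms finite_edges_tree_on in auto)

locale tree_pcf =
  fixes \<alpha> :: real and P :: "bool list set"
  assumes alpha_pos: "\<alpha> > 0" and finite_P: "finite P" and Nil_in_P: "[] \<in> P"
    and tl_in_P: "v \<in> P \<Longrightarrow> tl v \<in> P"
begin

abbreviation "L \<equiv> pcf_generator \<alpha> (tree_on P)"

lemma apex_in_P: "v \<in> P \<Longrightarrow> apex x v \<in> P"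
  by (induction v) (use tl_in_P in force)+

lemma finite_moves: "finite (openable P x)" "finite (apices P x)"
  using finite_P by (auto simp: openable_def apices_def)

text \<open>Edges and clusters are traded for vertices: distinct vertices have distinct parent
  edges, and the cluster of a vertex of \<open>P\<close> contains exactly one vertex of
  \<open>P\<close> without an open parent edge, its apex. That the apex lies in \<open>P\<close> is
  where closure under parents enters.\<close>

lemma generator_eq:
  assumes x: "x \<in> valid P"
  shows "L f x = (\<Sum>v\<in>openable P x. f (open_parent v x) - f x) + (\<Sum>b\<in>apices P x. \<alpha> * (f (freeze_at b x) - f x))"
proof -
  let ?e = "\<lambda>v. {tl v, v}"
  have inj: "inj_on ?e (openable P x)"
    by (rule inj_onI) (auto simp: openable_def parent_edge_eq_iff)
  have "{e. e \<in> edges (tree_on P) \<and> e \<notin> opened x \<and> e \<inter> frozen x = {}} = ?e ` openable P x"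
    by (auto simp: openable_def tree_on_def linked_def)
  then have 1: "(\<Sum>e | e \<in> edges (tree_on P) \<and> e \<notin> opened x \<and> e \<inter> frozen x = {}.
        f (x\<lparr>opened := insert e (opened x)\<rparr>) - f x) = (\<Sum>v\<in>openable P x. f (open_parent v x) - f x)"
    by (simp add: sum.reindex[OF inj] open_parent_def)
  have inj': "inj_on (cluster x) (apices P x)"
  proof (rule inj_onI)
    fix b b' assume bb: "b \<in> apices P x" "b' \<in> apices P x" "cluster x b = cluster x b'"
    then have "apex x b = apex x b'" using cluster_eq_apex[OF x] by blast
    with bb show "b = b'" by (simp add: apices_def)
  qed
  have "clusters (tree_on P) x = cluster x ` apices P x"
  proof -
    have "cluster x v \<in> cluster x ` apices P x" if "v \<in> P" for v
      by (rule image_eqI[of _ _ "apex x v"])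
        (use that apex_in_P in \<open>auto simp: cluster_eq_apex[OF x] apices_def\<close>)
    then show ?thesis by (auto simp: clusters_def tree_on_def apices_def)
  qed
  then have 2: "(\<Sum>C\<in>clusters (tree_on P) x. \<alpha> * (f (x\<lparr>frozen := frozen x \<union> C\<rparr>) - f x))
      = (\<Sum>b\<in>apices P x. \<alpha> * (f (freeze_at b x) - f x))"
    by (simp add: sum.reindex[OF inj'] freeze_at_def)
  show ?thesis unfolding pcf_generator_def 1 2 ..
qed

lemma finite_valid: "finite (valid P)"
  by (rule finite_subset[OF _ finite_config_on[OF finite_P]]) (auto simp: valid_def)

lemma cluster_subset:
  assumes "x \<in> valid P" "b \<in> P" "\<not> linked x b"
  shows "cluster x b \<subseteq> P"
proof
  fix w assume "w \<in> cluster x b"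
  then have "apex x w = b" using assms by (simp add: cluster_eq_apex)
  moreover have "w \<in> P \<or> apex x w = w"
    using valid_op_in[OF assms(1), of w] apex_eq_self[of x w] by blast
  ultimately show "w \<in> P" using assms(2) by auto
qed

lemma valid_opn:
  assumes "x \<in> valid P" "v \<in> openable P x"
  shows "open_parent v x \<in> valid P"
proof -
  have "v \<noteq> []" using assms by (simp add: openable_def)
  note * = op_opn[OF this]
  have "opened (open_parent v x) \<subseteq> edges (tree_on P)"
    using assms by (auto simp: valid_def config_on_def open_parent_def tree_on_def openable_def)
  moreover have "w \<in> frozen x \<longleftrightarrow> tl w \<in> frozen x" if "linked (open_parent v x) w" for w
    using that assms(2) valid_op_frozen[OF assms(1), of w] unfolding * openable_def by blast
  ultimately show ?thesis
    using valid_frozen_in[OF assms(1)] unfolding valid_def config_on_def by (simp add: tree_on_def)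
qed

lemma valid_frz:
  assumes "x \<in> valid P" "b \<in> apices P x"
  shows "freeze_at b x \<in> valid P"
proof -
  have b: "b \<in> P" "\<not> linked x b" using assms by (auto simp: apices_def)
  have "frozen (freeze_at b x) \<subseteq> P"
    using cluster_subset[OF assms(1) b] valid_frozen_in[OF assms(1)] by (simp add: freeze_at_def)
  moreover have "opened x \<subseteq> edges (tree_on P)" using assms(1) by (simp add: valid_def config_on_def)
  moreover have "w \<in> frozen (freeze_at b x) \<longleftrightarrow> tl w \<in> frozen (freeze_at b x)" if "linked x w" for w
    using valid_op_frozen[OF assms(1) that] apex_op[OF that] by (simp add: frozen_frz[OF assms(1) b(2)])
  ultimately show ?thesis
    unfolding valid_def config_on_def by (simp add: tree_on_def)
qed

sublocale jump_chain "valid P" "moves P" "rate \<alpha>" apply_move "rank P" L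
proof
  show "finite (valid P)" by (rule finite_valid)
  fix x assume x: "x \<in> valid P"
  show "finite (moves P x)" using finite_moves by (simp add: moves_def)
  show "L f x = (\<Sum>i\<in>moves P x. rate \<alpha> i * (f (apply_move i x) - f x))" for f
    unfolding generator_eq[OF x] moves_def
    by (subst sum.union_disjoint) (auto simp: finite_moves sum.reindex inj_on_def)
  fix i assume i: "i \<in> moves P x"
  show "apply_move i x \<in> valid P" using i valid_opn[OF x] valid_frz[OF x] by (auto simp: moves_def)
  show "rate \<alpha> i > 0" using i alpha_pos by (auto simp: moves_def)
  assume ne: "apply_move i x \<noteq> x"
  have fe: "finite (edges (tree_on P))" by (rule finite_edges_tree_on[OF finite_P])
  from i consider v where "i = Open v" "v \<in> openable P x" | b where "i = Freeze b" "b \<in> apices P x"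
    by (auto simp: moves_def)
  then show "rank P (apply_move i x) < rank P x"
  proof cases
    case 1
    then have "{tl v, v} \<in> edges (tree_on P) - opened x" by (auto simp: openable_def linked_def tree_on_def)
    then have "card (edges (tree_on P) - opened (open_parent v x)) < card (edges (tree_on P) - opened x)"
      using fe by (intro psubset_card_mono) (auto simp: open_parent_def)
    with 1 show ?thesis by (simp add: rank_def)
  next
    case 2
    have "frozen (freeze_at b x) \<noteq> frozen x"
    proof
      assume "frozen (freeze_at b x) = frozen x"
      then have "freeze_at b x = x" by (intro config_eqI) simp_all
      with ne 2(1) show False by simp
    qed
    moreover have "frozen (freeze_at b x) \<subseteq> P"
      using valid_frozen_in[OF valid_frz[OF x 2(2)]] .
    ultimately have "card (P - frozen (freeze_at b x)) < card (P - frozen x)"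
      using finite_P by (intro psubset_card_mono) (auto simp: freeze_at_def)
    with 2 show ?thesis by (simp add: rank_def)
  qed
qed

lemma absorbing_iff:
  assumes x: "x \<in> valid P"
  shows "absorbing x \<longleftrightarrow> frozen x = P"
proof
  assume a: "absorbing x"
  have "v \<in> frozen x" if "v \<in> P" for v
  proof -
    have "apex x v \<in> apices P x" using that apex_in_P by (simp add: apices_def)
    then have "freeze_at (apex x v) x = x" using a by (force simp: absorbing_def moves_def)
    then have "v \<in> frozen (freeze_at (apex x v) x) \<longleftrightarrow> v \<in> frozen x" by simp
    then show ?thesis by (simp add: frozen_frz[OF x])
  qed
  then show "frozen x = P" using valid_frozen_in[OF x] by auto
next
  assume P: "frozen x = P"
  have "freeze_at b x = x" if "b \<in> apices P x" for b
    using cluster_subset[OF x] that P by (auto simp: freeze_at_def apices_def Un_absorb2)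
  moreover have "openable P x = {}" using P by (auto simp: openable_def)
  ultimately show "absorbing x" by (auto simp: absorbing_def moves_def)
qed

end

subsection \<open>Patterns below a warm vertex\<close>

datatype link = Linked | Warm | Frozen

text \<open>The status of a vertex is recorded only if its parent edge is closed; across an open
  edge it is that of the parent, by validity.\<close>

definition link_of :: "bool list config \<Rightarrow> bool list \<Rightarrow> link" where
  "link_of x v = (if linked x v then Linked else if v \<in> frozen x then Frozen else Warm)"

lemma st_opn: "v \<noteq> [] \<Longrightarrow> link_of (open_parent v x) w = (if w = v then Linked else link_of x w)"
  by (simp add: link_of_def op_opn)

lemma st_frz:
  assumes "x \<in> valid P" "\<not> linked x b"
  shows "link_of (freeze_at b x) w = (if w = b then Frozen else link_of x w)"
  using assms by (auto simp: link_of_def frozen_frz)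

text \<open>Words grow at the front, so ancestors are suffixes; \<open>tl v\<close> in place of
  \<open>v\<close> excludes \<open>a\<close> itself.\<close>

definition below :: "bool list \<Rightarrow> bool list \<Rightarrow> bool" where
  "below a v \<longleftrightarrow> v \<noteq> [] \<and> suffix a (tl v)"

lemma below_length: "below a v \<Longrightarrow> length a < length v"
  unfolding below_def using suffix_length_le[of a "tl v"] by (cases v) auto

lemma not_below_apex: "\<not> below a (apex x a)"
  using suffix_length_le[OF suffix_apex[of x a]] below_length[of a "apex x a"] by linarith

definition warm_pattern :: "bool list \<Rightarrow> bool list set \<Rightarrow> (bool list \<Rightarrow> link) \<Rightarrow> bool list config \<Rightarrow> real" where
  "warm_pattern a D lab x = of_bool (a \<notin> frozen x \<and> (\<forall>v\<in>D. link_of x v = lab v))"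

text \<open>Every observed vertex hangs from \<open>a\<close> through observed vertices that are not
  \<open>Frozen\<close>. While \<open>a\<close> is warm, the parents of observed vertices are then
  warm too (\<open>pat_not_frozen\<close>), so every \<open>Warm\<close> link is free to open and
  the links evolve without outside influence.\<close>

definition admissible :: "bool list \<Rightarrow> bool list set \<Rightarrow> (bool list \<Rightarrow> link) \<Rightarrow> bool" where
  "admissible a D lab \<longleftrightarrow> (\<forall>v\<in>D. below a v \<and> (tl v = a \<or> tl v \<in> D \<and> lab (tl v) \<noteq> Frozen))"

lemma adm_upd_Wa: "admissible a D lab \<Longrightarrow> admissible a D (lab(v := Warm))"
  by (auto simp: admissible_def)

lemma tl_length_less: "v \<noteq> [] \<Longrightarrow> length (tl v) < length v"
  by (cases v) auto

text \<open>Going up from \<open>v\<close>, an open edge passes on the status of the parent. The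
  ascent stops at the warm vertex \<open>a\<close> or at a closed edge, whose label must be
  \<open>Warm\<close> because \<open>Frozen\<close> is excluded.\<close>

lemma pat_not_frozen:
  assumes x: "x \<in> valid P" and admissible: "admissible a D lab" and a: "a \<notin> frozen x"
    and link_of: "\<And>w. w \<in> D \<Longrightarrow> length w \<le> length v \<Longrightarrow> link_of x w = lab w"
    and v: "v = a \<or> v \<in> D \<and> lab v \<noteq> Frozen"
  shows "v \<notin> frozen x"
  using v link_of
proof (induction "length v" arbitrary: v rule: less_induct)
  case less
  show ?case
  proof (cases "v = a")
    case False
    then have v: "v \<in> D" "lab v \<noteq> Frozen" using less.prems(1) by auto
    have ne: "v \<noteq> []" using admissible v(1) by (auto simp: admissible_def below_def)
    have stv: "link_of x v = lab v" using less.prems(2) v(1) by simp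
    show ?thesis
    proof (cases "linked x v")
      case True
      have "tl v \<notin> frozen x"
      proof (rule less.hyps)
        show "length (tl v) < length v" using ne by (rule tl_length_less)
        then show "link_of x w = lab w" if "w \<in> D" "length w \<le> length (tl v)" for w
          using that by (intro less.prems(2)) auto
        show "tl v = a \<or> tl v \<in> D \<and> lab (tl v) \<noteq> Frozen" using admissible v(1) by (auto simp: admissible_def)
      qed
      then show ?thesis using valid_op_frozen[OF x True] by simp
    next
      case False
      then show ?thesis using stv v(2) by (auto simp: link_of_def split: if_splits)
    qed
  qed (use a in simp)
qed

lemma pat_split:
  assumes "v \<in> D"
  shows "warm_pattern a D lab x = of_bool (a \<notin> frozen x \<and> link_of x v = lab v \<and> (\<forall>w\<in>D-{v}. link_of x w = lab w))"
  unfolding warm_pattern_def using assms by (intro arg_cong[of _ _ of_bool]) auto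

lemma pat_upd_split:
  assumes "v \<in> D"
  shows "warm_pattern a D (lab(v := l)) x = of_bool (a \<notin> frozen x \<and> link_of x v = l \<and> (\<forall>w\<in>D-{v}. link_of x w = lab w))"
  unfolding pat_split[OF assms] by (intro arg_cong[of _ _ of_bool]) auto

text \<open>The product rule for a difference operator has an extra term with both increments; it
  vanishes because no move changes both factors.\<close>

lemma (in jump_chain) L_mult:
  assumes "x \<in> S" "\<And>i. i \<in> J x \<Longrightarrow> f (T i x) = f x \<or> g (T i x) = g x"
  shows "L (\<lambda>x. f x * g x) x = L f x * g x + f x * L g x"
proof -
  have "L (\<lambda>x. f x * g x) x = (\<Sum>i\<in>J x. c i * (f (T i x) - f x) * g x + f x * (c i * (g (T i x) - g x)))"
    unfolding L_eq[OF assms(1)]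
  proof (rule sum.cong)
    fix i assume "i \<in> J x"
    from assms(2)[OF this] show "c i * (f (T i x) * g (T i x) - f x * g x) =
        c i * (f (T i x) - f x) * g x + f x * (c i * (g (T i x) - g x))"
      by (elim disjE) (simp_all add: algebra_simps)
  qed simp
  then show ?thesis by (simp add: L_eq[OF assms(1)] sum.distrib sum_distrib_left sum_distrib_right)
qed

context tree_pcf
begin

lemma openable_ne: "v \<in> openable P x \<Longrightarrow> v \<noteq> []"
  by (simp add: openable_def)

lemma pat_openable:
  assumes x: "x \<in> valid P" and admissible: "admissible a D lab" and "D \<subseteq> P" "v \<in> D" "lab v = Warm" "warm_pattern a D lab x \<noteq> 0"
  shows "v \<in> openable P x"
proof -
  have p: "a \<notin> frozen x" "\<And>w. w \<in> D \<Longrightarrow> link_of x w = lab w" using assms(6) by (auto simp: warm_pattern_def)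
  have "tl v \<notin> frozen x"
    using admissible assms(4) by (intro pat_not_frozen[OF x admissible p]) (auto simp: admissible_def)
  moreover have "link_of x v = Warm" "v \<noteq> []" using p(2) assms admissible by (auto simp: admissible_def below_def)
  ultimately show ?thesis using assms by (auto simp: openable_def link_of_def split: if_splits)
qed

lemma pat_opn_eq:
  assumes "v \<noteq> []" "v \<notin> D"
  shows "warm_pattern a D lab (open_parent v x) = warm_pattern a D lab x"
  using assms by (auto simp: warm_pattern_def st_opn)

lemma pat_frz_eq:
  assumes "x \<in> valid P" "\<not> linked x b" "b \<noteq> apex x a" "b \<notin> D"
  shows "warm_pattern a D lab (freeze_at b x) = warm_pattern a D lab x"
proof -
  have "link_of (freeze_at b x) w = link_of x w" if "w \<in> D" for w
    using assms(4) that by (auto simp: st_frz[OF assms(1,2)])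
  then show ?thesis using assms(3) by (simp add: warm_pattern_def frozen_frz[OF assms(1,2)])
qed

lemma pat_frz_apex:
  assumes "x \<in> valid P"
  shows "warm_pattern a D lab (freeze_at (apex x a) x) = 0"
  using assms by (simp add: warm_pattern_def frozen_frz)

text \<open>Inflow minus outflow: a pattern arises from one in which a single link was still
  \<open>Warm\<close>, by opening at rate 1 or freezing at rate \<alpha>; it is lost at rate 1 +
  \<alpha> for each \<open>Warm\<close> link and at rate \<alpha> through the freezing of the
  cluster of \<open>a\<close>. Inflow only turns labels into \<open>Warm\<close>, so the system is
  triangular.\<close>

lemma L_pat:
  assumes x: "x \<in> valid P" and admissible: "admissible a D lab" and D: "D \<subseteq> P" and a: "a \<in> P"
  shows "L (warm_pattern a D lab) x = - \<alpha> * warm_pattern a D lab x +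
    (\<Sum>v\<in>D. case lab v of Linked \<Rightarrow> warm_pattern a D (lab(v := Warm)) x | Warm \<Rightarrow> - (1 + \<alpha>) * warm_pattern a D lab x
            | Frozen \<Rightarrow> \<alpha> * warm_pattern a D (lab(v := Warm)) x)"
proof -
  have fin_D: "finite D" using D finite_P finite_subset by blast
  \<comment> \<open>\<open>h1\<close> collects the openings and \<open>h2\<close> the freezings of
    observed links; \<open>h3\<close> adds the freezing of the cluster of \<open>a\<close>, which
    destroys the pattern.\<close>
  define h1 where "h1 v = (case lab v of Linked \<Rightarrow> warm_pattern a D (lab(v := Warm)) x | Warm \<Rightarrow> - warm_pattern a D lab x | Frozen \<Rightarrow> 0)" for v
  define h2 where "h2 v = (case lab v of Linked \<Rightarrow> 0 | Warm \<Rightarrow> - \<alpha> * warm_pattern a D lab x | Frozen \<Rightarrow> \<alpha> * warm_pattern a D (lab(v := Warm)) x)" for v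
  define h3 where "h3 v = (if v = apex x a then - \<alpha> * warm_pattern a D lab x else h2 v)" for v
  have open_part: "(\<Sum>v\<in>openable P x. warm_pattern a D lab (open_parent v x) - warm_pattern a D lab x) = (\<Sum>v\<in>D. h1 v)"
  proof (rule sum.mono_neutral_cong)
    show "finite D" "finite (openable P x)" by (fact fin_D, fact finite_moves)
    fix v
    show "h1 v = 0" if "v \<in> D - openable P x"
    proof (cases "lab v")
      case Linked
      then show ?thesis
        using that pat_openable[OF x adm_upd_Wa[OF admissible], of v v] D by (auto simp: h1_def)
    next
      case Warm
      then show ?thesis using that pat_openable[OF x admissible, of v] D by (auto simp: h1_def)
    qed (simp add: h1_def)
    show "warm_pattern a D lab (open_parent v x) - warm_pattern a D lab x = 0" if "v \<in> openable P x - D"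
      using that pat_opn_eq[OF openable_ne, of v x D] by simp
    show "warm_pattern a D lab (open_parent v x) - warm_pattern a D lab x = h1 v" if "v \<in> openable P x \<inter> D"
    proof -
      have v: "v \<in> D" "v \<noteq> []" "link_of x v = Warm" using that by (auto simp: openable_def link_of_def)
      have "warm_pattern a D lab (open_parent v x) = of_bool (a \<notin> frozen x \<and> lab v = Linked \<and> (\<forall>w\<in>D-{v}. link_of x w = lab w))"
        unfolding pat_split[OF v(1)] by (intro arg_cong[of _ _ of_bool]) (auto simp: st_opn[OF v(2)])
      then show ?thesis using v(3) unfolding h1_def pat_upd_split[OF v(1)] pat_split[OF v(1), of a lab]
        by (cases "lab v") auto
    qed
  qed
  \<comment> \<open>The apex of \<open>a\<close> is \<open>a\<close> or an ancestor, while observed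
    vertices are strictly below, so the two kinds of freezing do not overlap.\<close>
  have apex: "apex x a \<notin> D" using admissible not_below_apex by (auto simp: admissible_def)
  have freeze_part: "(\<Sum>b\<in>apices P x. \<alpha> * (warm_pattern a D lab (freeze_at b x) - warm_pattern a D lab x)) = (\<Sum>v\<in>insert (apex x a) D. h3 v)"
  proof (rule sum.mono_neutral_cong)
    show "finite (insert (apex x a) D)" "finite (apices P x)" using fin_D finite_moves by auto
    fix b
    show "h3 b = 0" if "b \<in> insert (apex x a) D - apices P x"
    proof -
      have "linked x b" "b \<in> D" "b \<noteq> apex x a" using that a D apex_in_P by (auto simp: apices_def)
      then show ?thesis
        by (cases "lab b") (auto simp: h3_def h2_def pat_upd_split pat_split[of b] link_of_def)
    qed
    show "\<alpha> * (warm_pattern a D lab (freeze_at b x) - warm_pattern a D lab x) = 0" if "b \<in> apices P x - insert (apex x a) D"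
      using that pat_frz_eq[OF x, of b] by (simp add: apices_def)
    show "\<alpha> * (warm_pattern a D lab (freeze_at b x) - warm_pattern a D lab x) = h3 b" if "b \<in> apices P x \<inter> insert (apex x a) D"
    proof (cases "b = apex x a")
      case True
      then show ?thesis using pat_frz_apex[OF x] by (simp add: h3_def)
    next
      case False
      then have b: "b \<in> D" "\<not> linked x b" using that by (auto simp: apices_def)
      have link_of: "link_of x b = Warm \<or> link_of x b = Frozen" using b(2) by (simp add: link_of_def)
      have "warm_pattern a D lab (freeze_at b x) = of_bool (a \<notin> frozen x \<and> lab b = Frozen \<and> (\<forall>w\<in>D-{b}. link_of x w = lab w))"
        unfolding pat_split[OF b(1)] using False
        by (intro arg_cong[of _ _ of_bool]) (auto simp: st_frz[OF x b(2)] frozen_frz[OF x b(2)])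
      then show ?thesis using False link_of unfolding h3_def h2_def pat_upd_split[OF b(1)] pat_split[OF b(1), of a lab]
        by (cases "lab b") auto
    qed
  qed
  have "(\<Sum>v\<in>insert (apex x a) D. h3 v) = - \<alpha> * warm_pattern a D lab x + (\<Sum>v\<in>D. h2 v)"
  proof -
    have "(\<Sum>v\<in>D. h3 v) = (\<Sum>v\<in>D. h2 v)" using apex by (intro sum.cong) (auto simp: h3_def)
    then show ?thesis using apex fin_D by (simp add: h3_def)
  qed
  moreover have "h1 v + h2 v = (case lab v of Linked \<Rightarrow> warm_pattern a D (lab(v := Warm)) x | Warm \<Rightarrow> - (1 + \<alpha>) * warm_pattern a D lab x
            | Frozen \<Rightarrow> \<alpha> * warm_pattern a D (lab(v := Warm)) x)" for v
    by (cases "lab v") (simp_all add: h1_def h2_def algebra_simps)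
  ultimately show ?thesis
    unfolding generator_eq[OF x] open_part freeze_part by (simp add: sum.distrib[symmetric] flip: sum.distrib)
qed

text \<open>
  A spectator weight \<open>Y\<close> carries information about the part of the tree that is not below \<open>a\<close>; the
  patterns at \<open>a\<close> evolve autonomously, up to an additional killing at a rate of at most \<open>\<kappa>\<close>.
\<close>

definition spectator :: "bool list \<Rightarrow> real \<Rightarrow> (bool list config \<Rightarrow> real) \<Rightarrow> bool" where
  "spectator a \<kappa> Y \<longleftrightarrow> (\<forall>x\<in>valid P.
     (\<forall>v\<in>openable P x. below a v \<longrightarrow> Y (open_parent v x) = Y x) \<and>
     (\<forall>b\<in>apices P x. below a b \<or> b = apex x a \<longrightarrow> Y (freeze_at b x) = Y x) \<and>
     (a \<notin> frozen x \<longrightarrow> L Y x \<ge> - \<kappa> * Y x) \<and> (a \<in> frozen x \<longrightarrow> L Y x \<ge> 0))"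

lemma spectator_const: "spectator a 0 (\<lambda>_. c)"
  by (simp add: spectator_def L_const)

text \<open>Each move changes at most one of the pattern and \<open>Y\<close>, so
  \<open>L_mult\<close> applies. Where the pattern is nonzero, \<open>a\<close> is warm and the
  bound on \<open>L Y\<close> is available. \<open>Y\<close> may be negative, since that bound is
  multiplied by the indicator only.\<close>

lemma L_pat_spectator:
  assumes x: "x \<in> valid P" and admissible: "admissible a D lab" and D: "D \<subseteq> P" and a: "a \<in> P" and Y: "spectator a \<kappa> Y"
  shows "L (\<lambda>x. warm_pattern a D lab x * Y x) x \<ge> - (\<alpha> + \<kappa>) * (warm_pattern a D lab x * Y x) +
    (\<Sum>v\<in>D. case lab v of Linked \<Rightarrow> warm_pattern a D (lab(v := Warm)) x * Y x | Warm \<Rightarrow> - (1 + \<alpha>) * (warm_pattern a D lab x * Y x)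
            | Frozen \<Rightarrow> \<alpha> * (warm_pattern a D (lab(v := Warm)) x * Y x))"
proof -
  have "warm_pattern a D lab (apply_move i x) = warm_pattern a D lab x \<or> Y (apply_move i x) = Y x" if "i \<in> moves P x" for i
  proof (cases i)
    case (Open v)
    then have v: "v \<in> openable P x" using that by (auto simp: moves_def)
    have "warm_pattern a D lab (open_parent v x) = warm_pattern a D lab x" if "\<not> below a v"
      using that admissible by (intro pat_opn_eq openable_ne[OF v]) (auto simp: admissible_def)
    moreover have "Y (open_parent v x) = Y x" if "below a v" using that v Y x by (simp add: spectator_def)
    ultimately show ?thesis using Open by auto
  next
    case (Freeze b)
    then have b: "b \<in> apices P x" using that by (auto simp: moves_def)
    have "warm_pattern a D lab (freeze_at b x) = warm_pattern a D lab x" if "\<not> below a b" "b \<noteq> apex x a"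
      using that b admissible by (intro pat_frz_eq[OF x]) (auto simp: admissible_def apices_def)
    moreover have "Y (freeze_at b x) = Y x" if "below a b \<or> b = apex x a"
      using that b Y x unfolding spectator_def by blast
    ultimately show ?thesis using Freeze by auto
  qed
  then have "L (\<lambda>x. warm_pattern a D lab x * Y x) x = L (warm_pattern a D lab) x * Y x + warm_pattern a D lab x * L Y x"
    by (intro L_mult x)
  moreover have "warm_pattern a D lab x * L Y x \<ge> warm_pattern a D lab x * (- \<kappa> * Y x)"
    using Y x unfolding spectator_def warm_pattern_def by (auto intro!: mult_left_mono)
  moreover have "L (warm_pattern a D lab) x * Y x = - \<alpha> * (warm_pattern a D lab x * Y x) +
    (\<Sum>v\<in>D. case lab v of Linked \<Rightarrow> warm_pattern a D (lab(v := Warm)) x * Y x | Warm \<Rightarrow> - (1 + \<alpha>) * (warm_pattern a D lab x * Y x)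
            | Frozen \<Rightarrow> \<alpha> * (warm_pattern a D (lab(v := Warm)) x * Y x))"
    unfolding L_pat[OF x admissible D a] distrib_right sum_distrib_right
    by (intro arg_cong2[of _ _ _ _ "(+)"] sum.cong) (auto split: link.split)
  ultimately show ?thesis by (simp add: algebra_simps)
qed

end

section \<open>Law of the links below a warm vertex\<close>

definition keep_prob :: "real \<Rightarrow> real \<Rightarrow> real" where
  "keep_prob \<alpha> t = exp (- (1 + \<alpha>) * t)"

text \<open>Increases to 1 / (1 + \<alpha>), the chance that a rate 1 clock rings before a rate
  \<alpha> clock; this supremum exceeds 1/2 exactly for \<alpha> < 1.\<close>

definition join_prob :: "real \<Rightarrow> real \<Rightarrow> real" where
  "join_prob \<alpha> t = (1 - keep_prob \<alpha> t) / (1 + \<alpha>)"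

text \<open>
  As long as \<open>a\<close> is warm, the links below it behave as independent three-state chains that leave
  \<open>Warm\<close> at rate \<open>1\<close> to \<open>Linked\<close> and at rate \<open>\<alpha>\<close> to \<open>Frozen\<close>.
\<close>

fun link_prob :: "real \<Rightarrow> real \<Rightarrow> link \<Rightarrow> real" where
  "link_prob \<alpha> t Linked = join_prob \<alpha> t"
| "link_prob \<alpha> t Warm = keep_prob \<alpha> t"
| "link_prob \<alpha> t Frozen = \<alpha> * join_prob \<alpha> t"

lemma keep_prob_deriv: "(keep_prob \<alpha> has_real_derivative - (1 + \<alpha>) * keep_prob \<alpha> t) (at t)"
  unfolding keep_prob_def[abs_def] by (auto intro!: derivative_eq_intros)

lemma join_prob_deriv:
  assumes "\<alpha> > 0"
  shows "(join_prob \<alpha> has_real_derivative keep_prob \<alpha> t) (at t)"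
proof -
  have "((\<lambda>t. (1 - keep_prob \<alpha> t) / (1 + \<alpha>)) has_real_derivative (0 - - (1 + \<alpha>) * keep_prob \<alpha> t) / (1 + \<alpha>)) (at t)"
    by (intro DERIV_cdivide DERIV_diff DERIV_const keep_prob_deriv)
  moreover have "(0 - - (1 + \<alpha>) * keep_prob \<alpha> t) / (1 + \<alpha>) = keep_prob \<alpha> t"
    using assms by (simp add: divide_eq_eq algebra_simps)
  ultimately show ?thesis unfolding join_prob_def[abs_def] by metis
qed

lemma link_prob_deriv:
  assumes "\<alpha> > 0"
  shows "((\<lambda>t. link_prob \<alpha> t l) has_real_derivative
    (case l of Linked \<Rightarrow> keep_prob \<alpha> t | Warm \<Rightarrow> - (1 + \<alpha>) * keep_prob \<alpha> t | Frozen \<Rightarrow> \<alpha> * keep_prob \<alpha> t)) (at t)"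
  using keep_prob_deriv[of \<alpha> t] join_prob_deriv[OF assms, of t]
  by (cases l) (auto intro!: DERIV_cmult)

lemma link_prob_sum: "\<alpha> > 0 \<Longrightarrow> link_prob \<alpha> t Warm + link_prob \<alpha> t Frozen = 1 - join_prob \<alpha> t"
  by (simp add: join_prob_def field_simps)

lemma link_prob_0: "link_prob \<alpha> 0 l = of_bool (Warm = l)"
  by (cases l) (simp_all add: join_prob_def keep_prob_def)

lemma join_prob_bounds:
  assumes "\<alpha> > 0" "t \<ge> 0"
  shows "0 \<le> join_prob \<alpha> t" "join_prob \<alpha> t < 1 / (1 + \<alpha>)" "join_prob \<alpha> t < 1"
proof -
  have k: "0 < keep_prob \<alpha> t" "keep_prob \<alpha> t \<le> 1" using assms by (auto simp: keep_prob_def mult_le_0_iff)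
  then show "0 \<le> join_prob \<alpha> t" "join_prob \<alpha> t < 1 / (1 + \<alpha>)"
    using assms by (auto simp: join_prob_def divide_simps)
  moreover have "1 / (1 + \<alpha>) < 1" using assms by simp
  ultimately show "join_prob \<alpha> t < 1" by linarith
qed

lemma continuous_join_prob [continuous_intros]: "continuous_on A (join_prob \<alpha>)"
  unfolding join_prob_def[abs_def] keep_prob_def divide_inverse by (intro continuous_intros)

context tree_pcf
begin

text \<open>Comparison of two triangular systems: by the forward equation and
  \<open>L_pat_spectator\<close>, the true values satisfy as an inequality the system that the
  product formula solves exactly. The induction is on the number of labels other than
  \<open>Warm\<close>, as inflow comes from patterns with one fewer.\<close>

lemma pat_lower:
  assumes Y: "spectator a \<kappa> Y" and a: "a \<in> P" and D: "D \<subseteq> P"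
    and "admissible a D lab" "t \<ge> 0"
  shows "exp (- (\<alpha> + \<kappa>) * t) * (\<Prod>v\<in>D. link_prob \<alpha> t (lab v)) * Y initial_config
      \<le> tf t (\<lambda>x. warm_pattern a D lab x * Y x) initial_config"
  using assms(4,5)
proof (induction "card {v\<in>D. lab v \<noteq> Warm}" arbitrary: lab t rule: less_induct)
  case (less lab t)
  have fin_D: "finite D" using D finite_P finite_subset by blast
  have init: "initial_config \<in> valid P" by (rule initial_valid)
  define m where "m lab t = tf t (\<lambda>x. warm_pattern a D lab x * Y x) initial_config" for lab t
  define w where "w lab t = exp (- (\<alpha> + \<kappa>) * t) * (\<Prod>v\<in>D. link_prob \<alpha> t (lab v)) * Y initial_config" for lab t
  define rhs where "rhs u lab t = - (\<alpha> + \<kappa>) * u lab t + (\<Sum>v\<in>D. case lab v of Linked \<Rightarrow> u (lab(v := Warm)) t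
      | Warm \<Rightarrow> - (1 + \<alpha>) * u lab t | Frozen \<Rightarrow> \<alpha> * u (lab(v := Warm)) t)"
    for u :: "(bool list \<Rightarrow> link) \<Rightarrow> real \<Rightarrow> real" and lab t
  define W where "W = {v\<in>D. lab v = Warm}"
  \<comment> \<open>The total rate at which the pattern is lost, including the killing by the
    spectator. Isolating it leaves an inflow with nonnegative coefficients.\<close>
  define C where "C = \<alpha> + \<kappa> + (1 + \<alpha>) * card W"
  have rhs_eq: "rhs u lab t = - C * u lab t + (\<Sum>v\<in>D - W. (case lab v of Linked \<Rightarrow> 1 | _ \<Rightarrow> \<alpha>) * u (lab(v := Warm)) t)" for u t
  proof -
    have "(\<Sum>v\<in>D. case lab v of Linked \<Rightarrow> u (lab(v := Warm)) t
      | Warm \<Rightarrow> - (1 + \<alpha>) * u lab t | Frozen \<Rightarrow> \<alpha> * u (lab(v := Warm)) t)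
      = (\<Sum>v\<in>D - W. (case lab v of Linked \<Rightarrow> 1 | _ \<Rightarrow> \<alpha>) * u (lab(v := Warm)) t) + (\<Sum>v\<in>W. - (1 + \<alpha>) * u lab t)"
      using fin_D
      by (subst sum.subset_diff[of W D]) (auto simp: W_def split: link.splits intro!: arg_cong2[of _ _ _ _ "(+)"] sum.cong)
    then show ?thesis by (simp add: rhs_def C_def algebra_simps)
  qed
  have m_deriv: "(m lab has_real_derivative tf t (L (\<lambda>x. warm_pattern a D lab x * Y x)) initial_config) (at t)" for t
    unfolding m_def[abs_def] by (rule tf_deriv[OF init])
  have m_ge: "tf t (L (\<lambda>x. warm_pattern a D lab x * Y x)) initial_config \<ge> rhs m lab t" if "t \<ge> 0" for t
  proof -
    have "tf t (\<lambda>x. - (\<alpha> + \<kappa>) * (warm_pattern a D lab x * Y x) +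
      (\<Sum>v\<in>D. case lab v of Linked \<Rightarrow> warm_pattern a D (lab(v := Warm)) x * Y x | Warm \<Rightarrow> - (1 + \<alpha>) * (warm_pattern a D lab x * Y x)
            | Frozen \<Rightarrow> \<alpha> * (warm_pattern a D (lab(v := Warm)) x * Y x))) initial_config
      \<le> tf t (L (\<lambda>x. warm_pattern a D lab x * Y x)) initial_config"
      by (intro tf_mono L_pat_spectator less.prems(1) D a Y init that)
    moreover have "tf t (\<lambda>x. case lab v of Linked \<Rightarrow> warm_pattern a D (lab(v := Warm)) x * Y x | Warm \<Rightarrow> - (1 + \<alpha>) * (warm_pattern a D lab x * Y x)
            | Frozen \<Rightarrow> \<alpha> * (warm_pattern a D (lab(v := Warm)) x * Y x)) initial_config
       = (case lab v of Linked \<Rightarrow> m (lab(v := Warm)) t | Warm \<Rightarrow> - (1 + \<alpha>) * m lab t | Frozen \<Rightarrow> \<alpha> * m (lab(v := Warm)) t)" for v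
      by (cases "lab v") (simp_all only: link.case m_def tf_cmult[OF init])
    ultimately show ?thesis
      by (simp only: rhs_def tf_add[OF init] tf_sum[OF init] tf_cmult[OF init] m_def)
  qed
  have w_deriv: "(w lab has_real_derivative rhs w lab t) (at t)" for t
  proof -
    let ?d = "\<lambda>l. case l of Linked \<Rightarrow> keep_prob \<alpha> t | Warm \<Rightarrow> - (1 + \<alpha>) * keep_prob \<alpha> t | Frozen \<Rightarrow> \<alpha> * keep_prob \<alpha> t"
    let ?S = "\<Sum>v\<in>D. ?d (lab v) * (\<Prod>u\<in>D-{v}. link_prob \<alpha> t (lab u))"
    have "(w lab has_real_derivative (- (\<alpha> + \<kappa>) * exp (- (\<alpha> + \<kappa>) * t) * (\<Prod>v\<in>D. link_prob \<alpha> t (lab v))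
        + exp (- (\<alpha> + \<kappa>) * t) * ?S) * Y initial_config) (at t)"
      unfolding w_def[abs_def]
      by (rule derivative_eq_intros has_field_derivative_prod link_prob_deriv alpha_pos refl)+ simp
    moreover have "exp (- (\<alpha> + \<kappa>) * t) * (?d (lab v) * (\<Prod>u\<in>D-{v}. link_prob \<alpha> t (lab u))) * Y initial_config
      = (case lab v of Linked \<Rightarrow> w (lab(v := Warm)) t | Warm \<Rightarrow> - (1 + \<alpha>) * w lab t | Frozen \<Rightarrow> \<alpha> * w (lab(v := Warm)) t)"
      if "v \<in> D" for v
    proof -
      have "w (lab(v := Warm)) t = exp (- (\<alpha> + \<kappa>) * t) * (keep_prob \<alpha> t * (\<Prod>u\<in>D-{v}. link_prob \<alpha> t (lab u))) * Y initial_config"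
        unfolding w_def using that fin_D by (simp add: prod.remove[of D v])
      moreover have "w lab t = exp (- (\<alpha> + \<kappa>) * t) * (link_prob \<alpha> t (lab v) * (\<Prod>u\<in>D-{v}. link_prob \<alpha> t (lab u))) * Y initial_config"
        unfolding w_def using that fin_D by (simp add: prod.remove[of D v])
      ultimately show ?thesis by (cases "lab v") simp_all
    qed
    then have "exp (- (\<alpha> + \<kappa>) * t) * ?S * Y initial_config = (\<Sum>v\<in>D. case lab v of Linked \<Rightarrow> w (lab(v := Warm)) t
      | Warm \<Rightarrow> - (1 + \<alpha>) * w lab t | Frozen \<Rightarrow> \<alpha> * w (lab(v := Warm)) t)"
      by (simp add: sum_distrib_left sum_distrib_right cong: sum.cong)
    ultimately show ?thesis
      by (simp add: rhs_def distrib_right w_def[of lab t] mult.assoc)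
  qed
  have "0 \<le> m lab t - w lab t"
  proof (rule linear_ode_nonneg[where c = C and u = "\<lambda>t. m lab t - w lab t"])
    \<comment> \<open>\<open>?g\<close> is chosen so that the equation for the difference holds
      identically. The content is its sign, which combines \<open>m_ge\<close> with the induction
      hypothesis for the inflow.\<close>
    let ?g = "\<lambda>t. tf t (L (\<lambda>x. warm_pattern a D lab x * Y x)) initial_config - rhs w lab t + C * (m lab t - w lab t)"
    show "((\<lambda>t. m lab t - w lab t) has_real_derivative ?g t - C * (m lab t - w lab t)) (at t)" for t
      using DERIV_diff[OF m_deriv w_deriv] by simp
    fix t :: real assume t: "0 \<le> t"
    have "w (lab(v := Warm)) t \<le> m (lab(v := Warm)) t" if "v \<in> D - W" for v
      unfolding w_def m_def
    proof (rule less.hyps)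
      have "{u\<in>D. (lab(v := Warm)) u \<noteq> Warm} \<subset> {u\<in>D. lab u \<noteq> Warm}" using that by (auto simp: W_def)
      then show "card {u\<in>D. (lab(v := Warm)) u \<noteq> Warm} < card {u\<in>D. lab u \<noteq> Warm}"
        using fin_D by (intro psubset_card_mono) auto
      show "admissible a D (lab(v := Warm))" by (intro adm_upd_Wa less.prems(1))
    qed (rule t)
    then have "(\<Sum>v\<in>D - W. (case lab v of Linked \<Rightarrow> 1 | _ \<Rightarrow> \<alpha>) * w (lab(v := Warm)) t)
      \<le> (\<Sum>v\<in>D - W. (case lab v of Linked \<Rightarrow> 1 | _ \<Rightarrow> \<alpha>) * m (lab(v := Warm)) t)"
      using alpha_pos by (intro sum_mono mult_left_mono) (auto split: link.split)
    then have "rhs m lab t - rhs w lab t + C * (m lab t - w lab t) \<ge> 0"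
      unfolding rhs_eq by (simp add: algebra_simps)
    with m_ge[OF t] show "0 \<le> ?g t" by linarith
  next
    have "(\<Prod>v\<in>D. link_prob \<alpha> 0 (lab v)) = of_bool (\<forall>v\<in>D. Warm = lab v)"
    proof (cases "\<forall>v\<in>D. Warm = lab v")
      case False
      then obtain v where "v \<in> D" "Warm \<noteq> lab v" by blast
      then have "v \<in> D" "link_prob \<alpha> 0 (lab v) = 0" by (auto simp: link_prob_0)
      then have "(\<Prod>v\<in>D. link_prob \<alpha> 0 (lab v)) = 0" using fin_D by (intro prod_zero) auto
      then show ?thesis using False by simp
    next
      case True
      then have "(\<Prod>v\<in>D. link_prob \<alpha> 0 (lab v)) = (\<Prod>v\<in>D. 1)"
        by (intro prod.cong) (auto simp: link_prob_0 keep_prob_def)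
      with True show ?thesis by simp
    qed
    moreover have "warm_pattern a D lab initial_config = of_bool (\<forall>v\<in>D. Warm = lab v)"
    proof -
      have "link_of initial_config v = Warm" for v by (simp add: link_of_def) (simp add: initial_config_def)
      moreover have "a \<notin> frozen initial_config" by (simp add: initial_config_def)
      ultimately show ?thesis by (simp add: warm_pattern_def)
    qed
    ultimately show "0 \<le> m lab 0 - w lab 0"
      by (simp add: m_def w_def tf_0)
  qed (rule less.prems)
  then show ?case by (simp add: m_def w_def)
qed

definition link_pat ::
  "bool list \<Rightarrow> bool list set \<Rightarrow> (bool list \<Rightarrow> link) \<Rightarrow> bool list set \<Rightarrow> bool list config \<Rightarrow> real" where
  "link_pat a D lab N x = of_bool (a \<notin> frozen x \<and> (\<forall>v\<in>D. link_of x v = lab v) \<and> (\<forall>v\<in>N. \<not> linked x v))"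

text \<open>A link that is not open is \<open>Warm\<close> or \<open>Frozen\<close>, two exclusive
  labels with total probability \<open>1 - join_prob \<alpha> t\<close>; the vertices of
  \<open>N\<close> are labelled one by one.\<close>

lemma link_pat_lower:
  assumes Y: "spectator a \<kappa> Y" and a: "a \<in> P" and t: "t \<ge> 0" and "finite N"
    and "D \<subseteq> P" "N \<subseteq> P" "D \<inter> N = {}" "admissible a D lab"
    and "\<And>v. v \<in> N \<Longrightarrow> below a v \<and> (tl v = a \<or> tl v \<in> D \<and> lab (tl v) \<noteq> Frozen)"
  shows "exp (- (\<alpha> + \<kappa>) * t) * ((\<Prod>v\<in>D. link_prob \<alpha> t (lab v)) * (1 - join_prob \<alpha> t) ^ card N) * Y initial_config
      \<le> tf t (\<lambda>x. link_pat a D lab N x * Y x) initial_config"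
  using assms(4-)
proof (induction N arbitrary: D lab rule: finite_induct)
  case empty
  then show ?case using pat_lower[OF Y a _ _ t] by (simp add: link_pat_def warm_pattern_def)
next
  case (insert n N)
  have init: "initial_config \<in> valid P" by (rule initial_valid)
  have n: "n \<notin> D" "n \<in> P" and fin_D: "finite D" using insert.prems finite_P finite_subset by auto
  let ?D = "insert n D" and ?l = "\<lambda>l. lab(n := l)"
  have *: "exp (- (\<alpha> + \<kappa>) * t) * (link_prob \<alpha> t l * (\<Prod>v\<in>D. link_prob \<alpha> t (lab v)) * (1 - join_prob \<alpha> t) ^ card N) * Y initial_config
      \<le> tf t (\<lambda>x. link_pat a ?D (?l l) N x * Y x) initial_config" for l
  proof -
    \<comment> \<open>Nothing observed is a child of \<open>n\<close>, because parents of observed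
      vertices lie in \<open>D\<close> or equal \<open>a\<close>. Hence labelling \<open>n\<close>
      as \<open>Frozen\<close> keeps the pattern admissible.\<close>
    have ne: "tl v \<noteq> n" if "v \<in> D \<or> v \<in> N \<or> v = n" for v
    proof
      assume "tl v = n"
      with that insert.prems n insert.hyps have "n = a"
        using insert.prems(5)[of v] by (auto simp: admissible_def)
      with insert.prems(5)[of n] show False by (auto dest: below_length)
    qed
    have "(\<Prod>v\<in>?D. link_prob \<alpha> t (?l l v)) = link_prob \<alpha> t l * (\<Prod>v\<in>D. link_prob \<alpha> t (lab v))"
      using n fin_D by (auto intro!: prod.cong arg_cong2[of _ _ _ _ "(*)"])
    moreover have "exp (- (\<alpha> + \<kappa>) * t) * ((\<Prod>v\<in>?D. link_prob \<alpha> t (?l l v)) * (1 - join_prob \<alpha> t) ^ card N) * Y initial_config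
      \<le> tf t (\<lambda>x. link_pat a ?D (?l l) N x * Y x) initial_config"
    proof (rule insert.IH)
      show "admissible a ?D (?l l)"
        using insert.prems(4) insert.prems(5)[of n] ne n unfolding admissible_def by auto
      show "below a v \<and> (tl v = a \<or> tl v \<in> ?D \<and> (?l l) (tl v) \<noteq> Frozen)" if "v \<in> N" for v
        using insert.prems(5)[of v] ne[of v] that by auto
    qed (use insert.prems insert.hyps n in auto)
    ultimately show ?thesis by simp
  qed
  have split: "link_pat a D lab (insert n N) x * Y x
      = link_pat a ?D (?l Warm) N x * Y x + link_pat a ?D (?l Frozen) N x * Y x" for x
  proof -
    have "(\<forall>v\<in>?D. link_of x v = ?l l v) \<longleftrightarrow> link_of x n = l \<and> (\<forall>v\<in>D. link_of x v = lab v)" for l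
      using n by auto
    moreover have "\<not> linked x n \<longleftrightarrow> link_of x n = Warm \<or> link_of x n = Frozen" by (simp add: link_of_def)
    ultimately show ?thesis by (auto simp: link_pat_def)
  qed
  have "exp (- (\<alpha> + \<kappa>) * t) * ((\<Prod>v\<in>D. link_prob \<alpha> t (lab v)) * (1 - join_prob \<alpha> t) ^ card (insert n N)) * Y initial_config
     = (\<Sum>l\<in>{Warm, Frozen}. exp (- (\<alpha> + \<kappa>) * t) * (link_prob \<alpha> t l * (\<Prod>v\<in>D. link_prob \<alpha> t (lab v)) * (1 - join_prob \<alpha> t) ^ card N) * Y initial_config)"
    using insert.hyps unfolding link_prob_sum[OF alpha_pos, of t, symmetric] by (simp add: algebra_simps)
  also have "\<dots> \<le> (\<Sum>l\<in>{Warm, Frozen}. tf t (\<lambda>x. link_pat a ?D (?l l) N x * Y x) initial_config)"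
    by (intro sum_mono *)
  also have "\<dots> = tf t (\<lambda>x. link_pat a D lab (insert n N) x * Y x) initial_config"
    unfolding split tf_add[OF init] by simp
  finally show ?case .
qed

end

text \<open>\<open>A\<close> lists links to be open, which form with \<open>a\<close> a connected
  piece of tree, and \<open>N\<close> links to be closed on its border. Border links outside
  \<open>N\<close> are left open to either case, so a frame may describe a cluster
  partially.\<close>

definition frame :: "bool list \<Rightarrow> bool list set \<Rightarrow> bool list set \<Rightarrow> bool" where
  "frame a A N \<longleftrightarrow> (\<forall>v\<in>A \<union> N. below a v \<and> tl v \<in> insert a A) \<and> A \<inter> N = {}"

definition matches :: "bool list set \<Rightarrow> bool list set \<Rightarrow> bool list config \<Rightarrow> bool" where
  "matches A N x \<longleftrightarrow> (\<forall>v\<in>A. linked x v) \<and> (\<forall>v\<in>N. \<not> linked x v)"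

text \<open>The conditional probability of a frame with \<open>i\<close> open and \<open>j\<close>
  closed links, given that its top freezes at time \<open>s\<close>.\<close>

definition shape_density :: "real \<Rightarrow> nat \<Rightarrow> nat \<Rightarrow> real \<Rightarrow> real" where
  "shape_density \<alpha> i j s = join_prob \<alpha> s ^ i * (1 - join_prob \<alpha> s) ^ j"

text \<open>The status of \<open>a\<close> is handed down along \<open>A\<close>. Asking only for
  links no deeper than \<open>v\<close> lets \<open>frozen_shape_opn\<close> apply this just before
  a deeper link opens.\<close>

lemma frame_frozen:
  assumes x: "x \<in> valid P" and fr: "frame a A N"
    and "\<And>w. w \<in> A \<Longrightarrow> length w \<le> length v \<Longrightarrow> linked x w" "v \<in> insert a A"
  shows "v \<in> frozen x \<longleftrightarrow> a \<in> frozen x"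
  using assms(3,4)
proof (induction "length v" arbitrary: v rule: less_induct)
  case less
  show ?case
  proof (cases "v = a")
    case False
    then have v: "v \<in> A" "linked x v" "v \<noteq> []" "tl v \<in> insert a A"
      using less.prems fr by (auto simp: frame_def below_def)
    have l: "length (tl v) < length v" using v(3) by (rule tl_length_less)
    then have "tl v \<in> frozen x \<longleftrightarrow> a \<in> frozen x"
      using less.prems(1) v(4) by (intro less.hyps) auto
    then show ?thesis using valid_op_frozen[OF x v(2)] by simp
  qed simp
qed

context tree_pcf
begin

definition warm_shape :: "bool list \<Rightarrow> bool list set \<Rightarrow> bool list set \<Rightarrow> bool list config \<Rightarrow> real" where
  "warm_shape a A N x = of_bool (a \<notin> frozen x \<and> matches A N x)"

definition frozen_shape :: "bool list \<Rightarrow> bool list set \<Rightarrow> bool list set \<Rightarrow> bool list config \<Rightarrow> real" where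
  "frozen_shape a A N x = of_bool (a \<in> frozen x \<and> matches A N x)"

lemma warm_shape_lower:
  assumes Y: "spectator a \<kappa> Y" and a: "a \<in> P" and t: "t \<ge> 0"
    and P: "A \<subseteq> P" "N \<subseteq> P" and fr: "frame a A N"
  shows "exp (- (\<alpha> + \<kappa>) * t) * shape_density \<alpha> (card A) (card N) t * Y initial_config
      \<le> tf t (\<lambda>x. warm_shape a A N x * Y x) initial_config"
proof -
  have "finite N" using P finite_P finite_subset by blast
  then have "exp (- (\<alpha> + \<kappa>) * t) * ((\<Prod>v\<in>A. link_prob \<alpha> t Linked) * (1 - join_prob \<alpha> t) ^ card N) * Y initial_config
      \<le> tf t (\<lambda>x. link_pat a A (\<lambda>_. Linked) N x * Y x) initial_config"
    using fr P by (intro link_pat_lower[OF Y a t]) (auto simp: frame_def admissible_def)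
  moreover have "link_pat a A (\<lambda>_. Linked) N = warm_shape a A N"
    by (auto simp: link_pat_def warm_shape_def matches_def link_of_def fun_eq_iff)
  ultimately show ?thesis by (simp add: shape_density_def)
qed

lemma frozen_shape_opn:
  assumes x: "x \<in> valid P" and fr: "frame a A N" and v: "v \<in> openable P x"
  shows "frozen_shape a A N (open_parent v x) = frozen_shape a A N x"
proof (cases "v \<in> A \<union> N")
  case True
  have ne: "v \<noteq> []" using v by (rule openable_ne)
  have "frozen_shape a A N y = 0" if "y = x \<or> y = open_parent v x" for y
  proof (rule ccontr)
    assume "frozen_shape a A N y \<noteq> 0"
    then have y: "a \<in> frozen x" "\<And>w. w \<in> A \<Longrightarrow> linked y w" using that by (auto simp: frozen_shape_def matches_def)
    have l: "length (tl v) < length v" using ne by (rule tl_length_less)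
    have "tl v \<in> frozen x \<longleftrightarrow> a \<in> frozen x"
    proof (rule frame_frozen[OF x fr])
      show "tl v \<in> insert a A" using True fr by (auto simp: frame_def)
      show "linked x w" if "w \<in> A" "length w \<le> length (tl v)" for w
        using y(2)[OF that(1)] \<open>y = x \<or> y = open_parent v x\<close> that(2) l by (auto simp: op_opn[OF ne])
    qed
    with y(1) v show False by (simp add: openable_def)
  qed
  then show ?thesis by simp
next
  case False
  then show ?thesis using openable_ne[OF v] by (auto simp: frozen_shape_def matches_def op_opn)
qed

text \<open>Only the freezing of the cluster of \<open>a\<close> contributes, and it converts
  \<open>warm_shape\<close> into \<open>frozen_shape\<close> at rate \<alpha>. Integrated over time,
  this is the mixture over freezing times.\<close>

lemma L_frozen_shape:
  assumes x: "x \<in> valid P" and a: "a \<in> P" and fr: "frame a A N"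
  shows "L (frozen_shape a A N) x = \<alpha> * warm_shape a A N x"
proof -
  have "(\<Sum>b\<in>apices P x. \<alpha> * (frozen_shape a A N (freeze_at b x) - frozen_shape a A N x))
    = (\<Sum>b\<in>apices P x. if b = apex x a then \<alpha> * warm_shape a A N x else 0)"
  proof (rule sum.cong)
    fix b assume "b \<in> apices P x"
    then have "\<not> linked x b" by (simp add: apices_def)
    then show "\<alpha> * (frozen_shape a A N (freeze_at b x) - frozen_shape a A N x) = (if b = apex x a then \<alpha> * warm_shape a A N x else 0)"
      by (auto simp: frozen_shape_def warm_shape_def matches_def frozen_frz[OF x])
  qed simp
  also have "\<dots> = \<alpha> * warm_shape a A N x"
    using a apex_in_P finite_moves by (simp add: apices_def)
  finally show ?thesis
    unfolding generator_eq[OF x] using frozen_shape_opn[OF x fr] by simp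
qed

lemma L_frozen_shape_spectator:
  assumes x: "x \<in> valid P" and a: "a \<in> P" and fr: "frame a A N" and Y: "spectator a \<kappa> Y"
  shows "L (\<lambda>x. frozen_shape a A N x * Y x) x \<ge> \<alpha> * (warm_shape a A N x * Y x)"
proof -
  have "frozen_shape a A N (apply_move i x) = frozen_shape a A N x \<or> Y (apply_move i x) = Y x" if "i \<in> moves P x" for i
  proof (cases i)
    case (Open v)
    then show ?thesis using that frozen_shape_opn[OF x fr] by (auto simp: moves_def)
  next
    case (Freeze b)
    then have b: "b \<in> apices P x" using that by (auto simp: moves_def)
    have "frozen_shape a A N (freeze_at b x) = frozen_shape a A N x" if "b \<noteq> apex x a"
      using that b frozen_frz[OF x, of b a] by (simp add: frozen_shape_def matches_def apices_def)
    moreover have "Y (freeze_at b x) = Y x" if "b = apex x a" using that b Y x by (simp add: spectator_def)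
    ultimately show ?thesis using Freeze by auto
  qed
  then have "L (\<lambda>x. frozen_shape a A N x * Y x) x = L (frozen_shape a A N) x * Y x + frozen_shape a A N x * L Y x"
    by (intro L_mult x)
  moreover have "frozen_shape a A N x * L Y x \<ge> 0"
    using Y x unfolding spectator_def frozen_shape_def by (auto intro!: mult_left_mono)
  ultimately show ?thesis using L_frozen_shape[OF x a fr] by simp
qed

lemma final_shape_lower_aux:
  assumes Y: "spectator a \<kappa> Y" and a: "a \<in> P" and t: "t \<ge> 0"
    and P: "A \<subseteq> P" "N \<subseteq> P" and fr: "frame a A N"
  shows "integral {0..t} (\<lambda>s. \<alpha> * exp (- (\<alpha> + \<kappa>) * s) * shape_density \<alpha> (card A) (card N) s) * Y initial_config
      \<le> tf t (\<lambda>x. frozen_shape a A N x * Y x) initial_config"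
proof -
  have init: "initial_config \<in> valid P" by (rule initial_valid)
  let ?f = "\<lambda>s. \<alpha> * exp (- (\<alpha> + \<kappa>) * s) * shape_density \<alpha> (card A) (card N) s"
  let ?g = "\<lambda>t. tf t (\<lambda>x. frozen_shape a A N x * Y x) initial_config"
  let ?g' = "\<lambda>t. tf t (L (\<lambda>x. frozen_shape a A N x * Y x)) initial_config"
  have "(?g' has_integral (?g t - ?g 0)) {0..t}"
    using t by (intro fundamental_theorem_of_calculus has_real_derivative_iff_has_vector_derivative[THEN iffD1]
      has_field_derivative_at_within[OF tf_deriv[OF init]])
  moreover have "?g 0 = 0" by (simp add: tf_0 frozen_shape_def initial_config_def)
  ultimately have g: "(?g' has_integral ?g t) {0..t}" by simp
  have "continuous_on {0..t} (\<lambda>s. ?f s * Y initial_config)"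
    unfolding shape_density_def by (intro continuous_intros)
  then have int: "(\<lambda>s. ?f s * Y initial_config) integrable_on {0..t}" by (rule integrable_continuous_real)
  have "integral {0..t} (\<lambda>s. ?f s * Y initial_config) \<le> integral {0..t} ?g'"
  proof (rule integral_le[OF int])
    show "?g' integrable_on {0..t}" using g by blast
    fix s assume s: "s \<in> {0..t}"
    have "?f s * Y initial_config = \<alpha> * (exp (- (\<alpha> + \<kappa>) * s) * shape_density \<alpha> (card A) (card N) s * Y initial_config)"
      by simp
    also have "\<dots> \<le> \<alpha> * tf s (\<lambda>x. warm_shape a A N x * Y x) initial_config"
      using s alpha_pos by (intro mult_left_mono warm_shape_lower Y a P fr) auto
    also have "\<dots> = tf s (\<lambda>x. \<alpha> * (warm_shape a A N x * Y x)) initial_config"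
      by (rule tf_cmult[OF init, symmetric])
    also have "\<dots> \<le> ?g' s"
      using s by (intro tf_mono L_frozen_shape_spectator[OF _ a fr Y] init) auto
    finally show "?f s * Y initial_config \<le> ?g' s" .
  qed
  then show ?thesis by (simp add: integral_unique[OF g])
qed

end

text \<open>For \<open>\<kappa> = 0\<close> the mixture over an exponential freezing time of rate
  \<alpha>; a positive \<kappa> also demands that an independent clock of rate \<kappa> has not rung
  by then.\<close>

definition shape_integral :: "real \<Rightarrow> real \<Rightarrow> nat \<Rightarrow> nat \<Rightarrow> real" where
  "shape_integral \<alpha> \<kappa> i j = (LINT s:{0..}|lborel. \<alpha> * exp (- (\<alpha> + \<kappa>) * s) * shape_density \<alpha> i j s)"

lemma set_integrable_exp_mult:
  fixes f :: "real \<Rightarrow> real"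
  assumes "c > 0" "f \<in> borel_measurable borel" "\<And>s. s \<ge> 0 \<Longrightarrow> \<bar>f s\<bar> \<le> B"
  shows "set_integrable lborel {0..} (\<lambda>s. exp (- c * s) * f s)"
proof -
  have B: "B \<ge> 0" using assms(3)[of 0] by simp
  have "set_integrable lborel {0<..} (\<lambda>s. exp (- c * s))"
    using integrable_I0i_exp_mscale[OF assms(1)] by (simp add: mult.commute)
  moreover have "set_integrable lborel {0..0} (\<lambda>s. exp (- c * s))"
    by (intro borel_integrable_atLeastAtMost' continuous_intros)
  ultimately have "set_integrable lborel ({0..0} \<union> {0<..}) (\<lambda>s. exp (- c * s))"
    by (intro set_integrable_Un) auto
  moreover have "{0..0} \<union> {0<..} = {0::real..}" by auto
  ultimately have "set_integrable lborel {0..} (\<lambda>s. exp (- c * s))" by simp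
  then have "set_integrable lborel {0..} (\<lambda>s. B * exp (- c * s))" by (intro set_integrable_mult_right) simp
  then show ?thesis
  proof (rule set_integrable_bound)
    show "set_borel_measurable lborel {0..} (\<lambda>s. exp (- c * s) * f s)"
      unfolding set_borel_measurable_def using assms(2) by measurable
    show "AE s in lborel. s \<in> {0..} \<longrightarrow> norm (exp (- c * s) * f s) \<le> norm (B * exp (- c * s))"
      using assms(3) B by (auto simp: abs_mult)
  qed
qed

lemma shape_density_bounds:
  assumes "\<alpha> > 0" "s \<ge> 0"
  shows "0 \<le> shape_density \<alpha> i j s" "shape_density \<alpha> i j s \<le> 1"
proof -
  have "0 \<le> join_prob \<alpha> s" "join_prob \<alpha> s \<le> 1" using join_prob_bounds[OF assms] by auto
  then show "0 \<le> shape_density \<alpha> i j s" "shape_density \<alpha> i j s \<le> 1"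
    unfolding shape_density_def by (auto intro!: mult_le_one power_le_one)
qed

lemma continuous_shape_density: "continuous_on A (shape_density \<alpha> i j)"
  unfolding shape_density_def[abs_def] by (intro continuous_intros)

lemma shape_integrable:
  assumes "\<alpha> > 0" "\<kappa> \<ge> 0"
  shows "set_integrable lborel {0..} (\<lambda>s. \<alpha> * exp (- (\<alpha> + \<kappa>) * s) * shape_density \<alpha> i j s)"
proof -
  have "set_integrable lborel {0..} (\<lambda>s. exp (- (\<alpha> + \<kappa>) * s) * shape_density \<alpha> i j s)"
  proof (rule set_integrable_exp_mult)
    show "shape_density \<alpha> i j \<in> borel_measurable borel"
      using continuous_shape_density by (intro borel_measurable_continuous_onI)
    show "\<bar>shape_density \<alpha> i j s\<bar> \<le> 1" if "s \<ge> 0" for s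
      using shape_density_bounds[OF assms(1) that] by simp
    show "0 < \<alpha> + \<kappa>" using assms by simp
  qed
  then have "set_integrable lborel {0..} (\<lambda>s. \<alpha> * (exp (- (\<alpha> + \<kappa>) * s) * shape_density \<alpha> i j s))"
    by (rule set_integrable_mult_right)
  then show ?thesis by (simp add: mult.assoc)
qed

lemma shape_integral_tendsto:
  assumes "\<alpha> > 0" "\<kappa> \<ge> 0"
  shows "((\<lambda>t. integral {0..t} (\<lambda>s. \<alpha> * exp (- (\<alpha> + \<kappa>) * s) * shape_density \<alpha> i j s))
    \<longlongrightarrow> shape_integral \<alpha> \<kappa> i j) at_top"
proof -
  let ?f = "\<lambda>s. \<alpha> * exp (- (\<alpha> + \<kappa>) * s) * shape_density \<alpha> i j s"
  have "((\<lambda>t. LINT s:{0..t}|lborel. ?f s) \<longlongrightarrow> (LINT s:{0..}|lborel. ?f s)) at_top"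
    by (intro tendsto_set_lebesgue_integral_at_top shape_integrable assms) simp
  moreover have "(LINT s:{0..t}|lborel. ?f s) = integral {0..t} ?f" for t
    by (intro set_borel_integral_eq_integral(2) set_integrable_subset[OF shape_integrable[OF assms]]) auto
  ultimately show ?thesis by (simp add: shape_integral_def)
qed

context tree_pcf
begin

lemma final_shape_lower:
  assumes Y: "spectator a \<kappa> Y" and a: "a \<in> P" and \<kappa>: "\<kappa> \<ge> 0"
    and P: "A \<subseteq> P" "N \<subseteq> P" and fr: "frame a A N"
  shows "shape_integral \<alpha> \<kappa> (card A) (card N) * Y initial_config
      \<le> fin (\<lambda>x. of_bool (matches A N x) * Y x) initial_config"
proof -
  have init: "initial_config \<in> valid P" by (rule initial_valid)
  have "shape_integral \<alpha> \<kappa> (card A) (card N) * Y initial_config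
      \<le> fin (\<lambda>x. frozen_shape a A N x * Y x) initial_config"
  proof (rule tendsto_le[OF _ fin_tendsto[OF init] tendsto_mult_right[OF shape_integral_tendsto[OF alpha_pos \<kappa>]]])
    show "\<forall>\<^sub>F t in at_top. integral {0..t} (\<lambda>s. \<alpha> * exp (- (\<alpha> + \<kappa>) * s) * shape_density \<alpha> (card A) (card N) s) * Y initial_config
      \<le> tf t (\<lambda>x. frozen_shape a A N x * Y x) initial_config"
      using eventually_ge_at_top[of 0] by eventually_elim (intro final_shape_lower_aux Y a P fr)
  qed simp
  also have "\<dots> = fin (\<lambda>x. of_bool (matches A N x) * Y x) initial_config"
    using a by (intro fin_cong init) (simp add: absorbing_iff frozen_shape_def)
  finally show ?thesis .
qed

text \<open>The constants 1 and -1 are both spectators without killing, so the lower bound, applied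
  to each, gives equality.\<close>

lemma final_shape:
  assumes a: "a \<in> P" and P: "A \<subseteq> P" "N \<subseteq> P" and fr: "frame a A N"
  shows "fin (\<lambda>x. of_bool (matches A N x)) initial_config = shape_integral \<alpha> 0 (card A) (card N)"
proof -
  have init: "initial_config \<in> valid P" by (rule initial_valid)
  have "shape_integral \<alpha> 0 (card A) (card N) * 1 \<le> fin (\<lambda>x. of_bool (matches A N x) * 1) initial_config"
    by (rule final_shape_lower[OF spectator_const a _ P fr]) simp
  moreover have "shape_integral \<alpha> 0 (card A) (card N) * (- 1) \<le> fin (\<lambda>x. of_bool (matches A N x) * (- 1)) initial_config"
    by (rule final_shape_lower[OF spectator_const a _ P fr]) simp
  moreover have "fin (\<lambda>x. of_bool (matches A N x) * (- 1)) initial_config = - fin (\<lambda>x. of_bool (matches A N x)) initial_config"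
    using fin_diff[OF init, of "\<lambda>_. 0" "\<lambda>x. of_bool (matches A N x)"] fin_absorbing_0[OF _ init, of "\<lambda>_. 0"] by simp
  ultimately show ?thesis by simp
qed

end

subsection \<open>Restriction to subtrees and the local limit\<close>

lemma op_restrict: "linked (restrict_config (tree_on Q) x) v \<longleftrightarrow> linked x v \<and> v \<in> Q"
  unfolding linked_def restrict_config_def tree_on_def using parent_edge_eq_iff[of v] by auto

lemma frozen_restrict: "frozen (restrict_config (tree_on Q) x) = frozen x \<inter> Q"
  by (simp add: restrict_config_def tree_on_def)

locale tree_pcf_sub = big: tree_pcf \<alpha> P + small: tree_pcf \<alpha> Q for \<alpha> P Q +
  assumes sub: "Q \<subseteq> P"
begin

abbreviation "res \<equiv> restrict_config (tree_on Q)"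

lemma res_valid:
  assumes "x \<in> valid P"
  shows "res x \<in> valid Q"
proof -
  have "config_on (tree_on Q) (res x)" by (auto simp: config_on_def restrict_config_def)
  moreover have "v \<in> frozen (res x) \<longleftrightarrow> tl v \<in> frozen (res x)" if "linked (res x) v" for v
    using that valid_op_frozen[OF assms, of v] small.tl_in_P[of v] by (simp add: op_restrict frozen_restrict)
  ultimately show ?thesis by (simp add: valid_def)
qed

lemma apex_res: "v \<in> Q \<Longrightarrow> apex (res x) v = apex x v"
proof (induction v)
  case (Cons b v)
  then show ?case using small.tl_in_P[of "b # v"] by (simp add: op_restrict)
qed simp

lemma res_opn:
  assumes "v \<noteq> []"
  shows "res (open_parent v x) = (if v \<in> Q then open_parent v (res x) else res x)"
  by (rule config_eqI)
    (use assms in \<open>auto simp: restrict_config_def open_parent_def tree_on_def parent_edge_eq_iff\<close>)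

text \<open>Since \<open>Q\<close> contains the parents of its vertices, a cluster with apex outside
  \<open>Q\<close> does not meet \<open>Q\<close>, and one with apex in \<open>Q\<close> meets it in
  the cluster of the restricted configuration with the same apex. So each cluster of the restriction
  is frozen by exactly one cluster, at the same rate.\<close>

lemma res_frz:
  assumes x: "x \<in> valid P" and b: "b \<in> P" "\<not> linked x b"
  shows "res (freeze_at b x) = (if b \<in> Q then freeze_at b (res x) else res x)"
proof (rule config_eqI)
  have "w \<in> frozen (res (freeze_at b x)) \<longleftrightarrow> w \<in> frozen (if b \<in> Q then freeze_at b (res x) else res x)" for w
  proof (cases "b \<in> Q")
    case True
    have ap: "apex (res x) w = b \<longleftrightarrow> apex x w = b \<and> w \<in> Q"
    proof (cases "w \<in> Q")
      case False
      then have "apex (res x) w = w" by (simp add: op_restrict)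
      then show ?thesis using False True by auto
    qed (simp add: apex_res)
    have nb: "\<not> linked (res x) b" using b by (simp add: op_restrict)
    show ?thesis
      using True unfolding frozen_restrict Int_iff frozen_frz[OF x b(2)]
      by (auto simp: frozen_frz[OF res_valid[OF x] nb] ap frozen_restrict)
  next
    case False
    then have "apex x w \<noteq> b" if "w \<in> Q" using small.apex_in_P[OF that] by metis
    then show ?thesis using False by (auto simp: frozen_restrict frozen_frz[OF x b(2)])
  qed
  then show "frozen (res (freeze_at b x)) = frozen (if b \<in> Q then freeze_at b (res x) else res x)" by blast
  show "opened (res (freeze_at b x)) = opened (if b \<in> Q then freeze_at b (res x) else res x)"
    by (simp add: restrict_config_def)
qed

lemma L_res:
  assumes x: "x \<in> valid P"
  shows "big.L (\<lambda>x. h (res x)) x = small.L h (res x)"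
proof -
  have "(\<Sum>v\<in>openable P x. h (res (open_parent v x)) - h (res x)) = (\<Sum>v\<in>openable Q (res x). h (open_parent v (res x)) - h (res x))"
  proof (rule sum.mono_neutral_cong)
    fix v
    show "h (res (open_parent v x)) - h (res x) = 0" if "v \<in> openable P x - openable Q (res x)"
    proof -
      have "v \<notin> Q" using that by (auto simp: openable_def op_restrict frozen_restrict)
      then show ?thesis using that big.openable_ne[of v x] by (simp add: res_opn)
    qed
    show "h (open_parent v (res x)) - h (res x) = 0" if "v \<in> openable Q (res x) - openable P x"
    proof -
      have "v \<in> openable P x"
        using that sub small.tl_in_P[of v] unfolding openable_def op_restrict frozen_restrict by blast
      with that show ?thesis by simp
    qed
    show "h (res (open_parent v x)) - h (res x) = h (open_parent v (res x)) - h (res x)" if "v \<in> openable P x \<inter> openable Q (res x)"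
      using that big.openable_ne[of v x] by (simp add: res_opn openable_def)
  qed (auto intro: big.finite_moves small.finite_moves)
  moreover have "(\<Sum>b\<in>apices P x. \<alpha> * (h (res (freeze_at b x)) - h (res x))) = (\<Sum>b\<in>apices Q (res x). \<alpha> * (h (freeze_at b (res x)) - h (res x)))"
    by (rule sum.mono_neutral_cong[OF small.finite_moves(2) big.finite_moves(2)])
      (use sub in \<open>auto simp: apices_def op_restrict res_frz[OF x]\<close>)
  ultimately show ?thesis
    unfolding big.generator_eq[OF x] small.generator_eq[OF res_valid[OF x]] by simp
qed

lemma L_pow_res: "x \<in> valid P \<Longrightarrow> (big.L ^^ n) (\<lambda>x. h (res x)) x = (small.L ^^ n) h (res x)"
proof (induction n arbitrary: x)
  case (Suc n)
  have "big.L ((big.L ^^ n) (\<lambda>x. h (res x))) x = big.L (\<lambda>x. ((small.L ^^ n) h) (res x)) x"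
    using Suc by (intro big.L_cong) auto
  with L_res[OF Suc.prems, of "(small.L ^^ n) h"] show ?case by simp
qed simp

lemma fin_res:
  assumes "x \<in> valid P"
  shows "big.fin (\<lambda>x. h (res x)) x = small.fin h (res x)"
  unfolding big.fin_def small.fin_def transition_fin_def L_pow_res[OF assms] ..

lemma res_initial: "res initial_config = initial_config"
  by (simp add: restrict_config_def initial_config_def)

end

context tree_pcf
begin

lemma tree_pcf_cut:
  assumes "a \<noteq> []"
  shows "tree_pcf_sub \<alpha> P {v\<in>P. \<not> suffix a v}"
proof -
  have "\<not> suffix a (tl v)" if "\<not> suffix a v" for v
    using that by (cases v) (auto simp: suffix_Cons)
  then show ?thesis
    using assms alpha_pos finite_P Nil_in_P tl_in_P by unfold_locales auto
qed

text \<open>The weight is the indicator that the parent edge of \<open>a\<close> is still closed,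
  times the conditional expectation of the terminal quantity \<open>f\<close>, given the present
  configuration outside the subtree of \<open>a\<close>. The second factor is harmonic
  (\<open>L_fin\<close>); the first dies at rate 1 while \<open>a\<close> and its parent are warm.
  Freezing the cluster of \<open>a\<close> leaves the weight alone: if \<open>a\<close> is linked
  the weight is 0, otherwise that cluster lies in the subtree.\<close>

lemma spectator_cut:
  assumes a: "a \<noteq> []" "a \<in> P" and f: "\<And>y. 0 \<le> f y"
  defines "Q \<equiv> {v\<in>P. \<not> suffix a v}"
  shows "spectator a 1 (\<lambda>x. of_bool (\<not> linked x a) * jump_chain.fin (pcf_generator \<alpha> (tree_on Q)) f (restrict_config (tree_on Q) x))"
proof -
  interpret sub: tree_pcf_sub \<alpha> P Q unfolding Q_def by (rule tree_pcf_cut[OF a(1)])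
  define f1 where "f1 x = (of_bool (\<not> linked x a) :: real)" for x
  define f2 where "f2 x = sub.small.fin f (sub.res x)" for x
  have f2_pos: "f2 x \<ge> 0" if "x \<in> valid P" for x
    unfolding f2_def
    by (rule tendsto_lowerbound[OF sub.small.fin_tendsto[OF sub.res_valid[OF that]]])
      (auto intro!: eventually_mono[OF eventually_ge_at_top[of 0]] sub.small.tf_nonneg f sub.res_valid[OF that])
  have aQ: "v \<notin> Q" if "suffix a v" for v using that by (simp add: Q_def)
  have below_aQ: "v \<notin> Q" "v \<noteq> a" if "below a v" for v
    using that below_length[OF that] aQ[of v] by (auto simp: below_def suffix_def) (metis append_Cons list.collapse)
  have f2_opn: "f2 (open_parent v x) = f2 x" if "v \<noteq> []" "v \<notin> Q" for v x
    using that by (simp add: f2_def sub.res_opn)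
  have f2_frz: "f2 (freeze_at b x) = f2 x" if "x \<in> valid P" "b \<in> apices P x" "b \<notin> Q" for b x
    using that by (simp add: f2_def sub.res_frz apices_def)
  have f1_opn: "f1 (open_parent v x) = (if v = a then 0 else f1 x)" if "v \<noteq> []" for v x
    using that by (auto simp: f1_def op_opn)
  have f1_frz: "f1 (freeze_at b x) = f1 x" for b x by (simp add: f1_def)
  have "spectator a 1 (\<lambda>x. f1 x * f2 x)"
    unfolding spectator_def
  proof (intro ballI conjI impI)
    fix x assume x: "x \<in> valid P"
    show "f1 (open_parent v x) * f2 (open_parent v x) = f1 x * f2 x" if "v \<in> openable P x" "below a v" for v
      using that below_aQ[of v] openable_ne by (simp add: f1_opn f2_opn)
    show "f1 (freeze_at b x) * f2 (freeze_at b x) = f1 x * f2 x" if "b \<in> apices P x" "below a b \<or> b = apex x a" for b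
    proof (cases "linked x a")
      case True
      then show ?thesis by (simp add: f1_def)
    next
      case False
      then have "b \<notin> Q" using that(2) below_aQ[of b] aQ[of a] by auto
      then show ?thesis using f2_frz[OF x that(1)] by (simp add: f1_frz)
    qed
    \<comment> \<open>Only the opening of the parent edge of \<open>a\<close> changes
      \<open>f1\<close>, and the restriction to \<open>Q\<close> does not see that edge.\<close>
    have "f1 (apply_move i x) = f1 x \<or> f2 (apply_move i x) = f2 x" if "i \<in> moves P x" for i
      using that aQ[of a] a(1) openable_ne by (cases i) (auto simp: moves_def f1_opn f1_frz f2_opn)
    then have "L (\<lambda>x. f1 x * f2 x) x = L f1 x * f2 x + f1 x * L f2 x"
      by (intro L_mult x)
    moreover have "L f2 x = 0"
      unfolding f2_def sub.L_res[OF x] by (rule sub.small.L_fin[OF sub.res_valid[OF x]])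
    moreover have "L f1 x = (if a \<in> openable P x then - f1 x else 0)"
    proof -
      have "L f1 x = (\<Sum>v\<in>openable P x. if v = a then - f1 x else 0)"
        unfolding generator_eq[OF x] f1_frz
        using openable_ne[of _ x] by (auto simp: f1_opn intro!: sum.cong)
      then show ?thesis using finite_moves by simp
    qed
    ultimately have LY: "L (\<lambda>x. f1 x * f2 x) x = (if a \<in> openable P x then - (f1 x * f2 x) else 0)" by simp
    have pos: "f1 x * f2 x \<ge> 0" using f2_pos[OF x] by (simp add: f1_def)
    show "- 1 * (f1 x * f2 x) \<le> L (\<lambda>x. f1 x * f2 x) x" using pos by (simp add: LY)
    show "0 \<le> L (\<lambda>x. f1 x * f2 x) x" if "a \<in> frozen x" using that by (simp add: LY openable_def)
  qed
  then show ?thesis by (simp add: f1_def f2_def)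
qed

text \<open>
  The killing rate \<open>1\<close> is the rate of the parent edge of \<open>a\<close>; the inequality is strict only because
  the killing stops when the parent freezes.
\<close>

lemma final_shape_lower_cut:
  assumes a: "a \<noteq> []" "a \<in> P" and f: "\<And>y. 0 \<le> f y"
    and P: "A \<subseteq> P" "N \<subseteq> P" and fr: "frame a A N"
  defines "Q \<equiv> {v\<in>P. \<not> suffix a v}"
  shows "shape_integral \<alpha> 1 (card A) (card N) * fin (\<lambda>x. f (restrict_config (tree_on Q) x)) initial_config
      \<le> fin (\<lambda>x. of_bool (matches A N x \<and> \<not> linked x a) * f (restrict_config (tree_on Q) x)) initial_config"
proof -
  interpret sub: tree_pcf_sub \<alpha> P Q unfolding Q_def by (rule tree_pcf_cut[OF a(1)])
  have init: "initial_config \<in> valid P" by (rule initial_valid)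
  let ?Y = "\<lambda>x. of_bool (\<not> linked x a) * sub.small.fin f (sub.res x)"
  have "shape_integral \<alpha> 1 (card A) (card N) * ?Y initial_config
      \<le> fin (\<lambda>x. of_bool (matches A N x) * ?Y x) initial_config"
    by (rule final_shape_lower[OF spectator_cut[OF a f, folded Q_def] a(2) _ P fr]) simp
  moreover have "?Y initial_config = fin (\<lambda>x. f (sub.res x)) initial_config"
    by (simp add: sub.fin_res[OF init] sub.res_initial)
  moreover have "fin (\<lambda>x. of_bool (matches A N x) * ?Y x) initial_config
     = fin (\<lambda>x. of_bool (matches A N x \<and> \<not> linked x a) * f (sub.res x)) initial_config"
  \<comment> \<open>At the end the outside configuration is absorbed as well, so the conditional
    expectation in the weight has become \<open>f\<close> itself.\<close>
  proof (rule fin_cong[OF _ init])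
    fix y assume y: "y \<in> valid P" "absorbing y"
    then have "frozen (sub.res y) = Q" using sub.sub by (auto simp: absorbing_iff frozen_restrict)
    then have "sub.small.absorbing (sub.res y)"
      using sub.small.absorbing_iff[OF sub.res_valid[OF y(1)]] by simp
    then have "sub.small.fin f (sub.res y) = f (sub.res y)"
      by (intro sub.small.fin_absorbing sub.res_valid y)
    then show "of_bool (matches A N y) * ?Y y = of_bool (matches A N y \<and> \<not> linked y a) * f (sub.res y)" by simp
  qed
  ultimately show ?thesis by simp
qed

end

section \<open>Balls around the root and the local limit\<close>

definition ball_at :: "nat \<Rightarrow> bool list set" where
  "ball_at n = {v. length v \<le> n}"

lemma finite_ball_at: "finite (ball_at n)"
  unfolding ball_at_def using finite_lists_length_le[of "UNIV :: bool set" n] by simp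

lemma tree_pcf_ball: "\<alpha> > 0 \<Longrightarrow> tree_pcf \<alpha> (ball_at n)"
  by unfold_locales (auto simp: finite_ball_at, auto simp: ball_at_def)

lemma subgraph_tree_on: "P \<subseteq> Q \<Longrightarrow> (\<And>v. v \<in> P \<Longrightarrow> tl v \<in> P) \<Longrightarrow> subgraph (tree_on P) (tree_on Q)"
  by (auto simp: subgraph_def tree_on_def)

lemma binary_tree_eq: "binary_tree = tree_on UNIV"
proof -
  have "{{v, b # v} |v b. True} = {{tl v, v} |v. v \<in> UNIV \<and> v \<noteq> []}"
  proof (intro subset_antisym subsetI)
    fix e assume "e \<in> {{v, b # v} |v b. True}"
    then obtain v b where "e = {tl (b # v), b # v}" by auto
    then show "e \<in> {{tl v, v} |v. v \<in> UNIV \<and> v \<noteq> []}" by blast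
  next
    fix e :: "'a list set" assume "e \<in> {{tl v, v} |v. v \<in> UNIV \<and> v \<noteq> []}"
    then obtain v where "v \<noteq> []" "e = {tl v, v}" by blast
    then show "e \<in> {{v, b # v} |v b. True}" by (cases v) auto
  qed
  then show ?thesis by (simp add: binary_tree_def tree_on_def)
qed

lemma connected_ball: "connected_graph (tree_on (ball_at n))"
proof -
  let ?R = "{(a, b). {a, b} \<in> edges (tree_on (ball_at n))}"
  have to_root: "(v, []) \<in> ?R\<^sup>*" if "v \<in> ball_at n" for v
    using that
  proof (induction v)
    case (Cons b v)
    have "{v, b # v} = {tl (b # v), b # v}" by simp
    then have "(b # v, v) \<in> ?R" using Cons.prems unfolding tree_on_def by (auto simp: insert_commute[of v])
    moreover have "(v, []) \<in> ?R\<^sup>*" using Cons by (simp add: ball_at_def)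
    ultimately show ?case by (rule converse_rtrancl_into_rtrancl)
  qed simp
  have "sym ?R" by (rule symI) (simp add: insert_commute)
  then have "sym (?R\<^sup>*)" by (rule sym_rtrancl)
  then have "(v, w) \<in> ?R\<^sup>*" if "v \<in> ball_at n" "w \<in> ball_at n" for v w
    using rtrancl_trans[OF to_root[OF that(1)], of w] symD[of "?R\<^sup>*", OF _ to_root[OF that(2)]] by simp
  moreover have "verts (tree_on (ball_at n)) = ball_at n" "[] \<in> ball_at n"
    by (auto simp: tree_on_def ball_at_def)
  ultimately show ?thesis unfolding connected_graph_def component_def by auto
qed

lemma finite_subgraph_ball: "finite_subgraph (tree_on (ball_at n)) binary_tree"
  unfolding finite_subgraph_def binary_tree_eq
proof (intro conjI)
  show "subgraph (tree_on (ball_at n)) (tree_on UNIV)" by (rule subgraph_tree_on) (auto simp: ball_at_def)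
  show "finite (verts (tree_on (ball_at n)))" using finite_ball_at by (simp add: tree_on_def)
qed (rule finite_edges_tree_on[OF finite_ball_at])

lemma exhaustion_balls: "exhaustion binary_tree (\<lambda>n. tree_on (ball_at n))"
  unfolding exhaustion_def
proof (intro conjI allI finite_subgraph_ball connected_ball)
  show "subgraph (tree_on (ball_at n)) (tree_on (ball_at (Suc n)))" for n
    by (rule subgraph_tree_on) (auto simp: ball_at_def)
  show "(\<Union>n. verts (tree_on (ball_at n))) = verts binary_tree"
    by (auto simp: binary_tree_eq tree_on_def ball_at_def)
  show "(\<Union>n. edges (tree_on (ball_at n))) = edges binary_tree"
    by (auto simp: binary_tree_eq tree_on_def ball_at_def)
qed

text \<open>Observing the single time \<infinity> is enough. Along the exhaustion by balls the
  finite-volume probabilities are constant from radius \<open>n\<close> on, by consistency under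
  restriction, so the limit in \<open>infinite_volume_pcf\<close> is that constant.\<close>

lemma infinite_volume_restrict_prob:
  fixes n :: nat
  assumes \<alpha>: "\<alpha> > 0" and inf: "infinite_volume_pcf \<alpha> binary_tree M \<eta>"
  defines "R \<equiv> restrict_config (tree_on (ball_at n))"
  shows "{\<omega>\<in>space M. R (\<eta> \<infinity> \<omega>) \<in> A} \<in> sets M"
    and "measure M {\<omega>\<in>space M. R (\<eta> \<infinity> \<omega>) \<in> A}
      = jump_chain.fin (pcf_generator \<alpha> (tree_on (ball_at n))) (\<lambda>x. of_bool (x \<in> A)) initial_config"
proof -
  interpret prob_space M using inf by (simp add: infinite_volume_pcf_def)
  interpret small: tree_pcf \<alpha> "ball_at n" by (rule tree_pcf_ball[OF \<alpha>])
  let ?\<Lambda> = "tree_on (ball_at n)"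
  have init: "initial_config \<in> valid (ball_at n)" by (rule initial_valid)
  define C where "C = {x. config_on ?\<Lambda> x}"
  have fin_C: "finite C" unfolding C_def by (rule finite_config_on[OF finite_ball_at])
  have R_C: "R x \<in> C" for x by (auto simp: C_def R_def config_on_def restrict_config_def)
  define E where "E \<xi> = {\<omega>\<in>space M. R (\<eta> \<infinity> \<omega>) = \<xi>}" for \<xi>
  have E_meas: "E \<xi> \<in> sets M" for \<xi>
  proof -
    have v: "{\<omega>\<in>space M. v \<in> frozen (\<eta> \<infinity> \<omega>)} \<in> sets M" for v
      using inf by (simp add: infinite_volume_pcf_def binary_tree_def)
    have e: "{\<omega>\<in>space M. e \<in> opened (\<eta> \<infinity> \<omega>)} \<in> sets M" if "e \<in> edges ?\<Lambda>" for e
      using inf that finite_subgraph_ball[of n]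
      unfolding infinite_volume_pcf_def finite_subgraph_def subgraph_def by blast
    have "R x = \<xi> \<longleftrightarrow> \<xi> \<in> C \<and> (\<forall>v\<in>ball_at n. v \<in> frozen x \<longleftrightarrow> v \<in> frozen \<xi>) \<and>
       (\<forall>e\<in>edges ?\<Lambda>. e \<in> opened x \<longleftrightarrow> e \<in> opened \<xi>)" for x
    proof
      assume "R x = \<xi>"
      then show "\<xi> \<in> C \<and> (\<forall>v\<in>ball_at n. v \<in> frozen x \<longleftrightarrow> v \<in> frozen \<xi>) \<and>
       (\<forall>e\<in>edges ?\<Lambda>. e \<in> opened x \<longleftrightarrow> e \<in> opened \<xi>)"
        using R_C[of x] by (auto simp: R_def restrict_config_def) (auto simp: tree_on_def)
    next
      assume *: "\<xi> \<in> C \<and> (\<forall>v\<in>ball_at n. v \<in> frozen x \<longleftrightarrow> v \<in> frozen \<xi>) \<and>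
       (\<forall>e\<in>edges ?\<Lambda>. e \<in> opened x \<longleftrightarrow> e \<in> opened \<xi>)"
      have "verts ?\<Lambda> = ball_at n" by (simp add: tree_on_def)
      with * show "R x = \<xi>"
        by (intro config_eqI) (auto simp: R_def restrict_config_def C_def config_on_def)
    qed
    then have "E \<xi> = {\<omega>\<in>space M. \<xi> \<in> C \<and> (\<forall>v\<in>ball_at n. v \<in> frozen (\<eta> \<infinity> \<omega>) \<longleftrightarrow> v \<in> frozen \<xi>) \<and>
       (\<forall>e\<in>edges ?\<Lambda>. e \<in> opened (\<eta> \<infinity> \<omega>) \<longleftrightarrow> e \<in> opened \<xi>)}"
      unfolding E_def by simp
    also have "\<dots> \<in> sets M"
    proof (intro sets.sets_Collect_conj sets.sets_Collect_finite_All sets.sets_Collect_const)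
      show "{\<omega>\<in>space M. v \<in> frozen (\<eta> \<infinity> \<omega>) \<longleftrightarrow> v \<in> frozen \<xi>} \<in> sets M" for v
        using v[of v] sets.sets_Collect_neg[OF v[of v]] by (cases "v \<in> frozen \<xi>") auto
      show "{\<omega>\<in>space M. e \<in> opened (\<eta> \<infinity> \<omega>) \<longleftrightarrow> e \<in> opened \<xi>} \<in> sets M" if "e \<in> edges ?\<Lambda>" for e
        using e[OF that] sets.sets_Collect_neg[OF e[OF that]] by (cases "e \<in> opened \<xi>") auto
    qed (use finite_ball_at finite_edges_tree_on in auto)
    finally show ?thesis .
  qed
  have E_prob: "prob (E \<xi>) = small.fin (\<lambda>x. of_bool (x = \<xi>)) initial_config" for \<xi>
  proof -
    have "pcf_fdd \<alpha> (tree_on (ball_at m)) ?\<Lambda> [(\<infinity>, \<xi>)] = small.fin (\<lambda>x. of_bool (x = \<xi>)) initial_config"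
      if "m \<ge> n" for m
    proof -
      interpret big: tree_pcf \<alpha> "ball_at m" by (rule tree_pcf_ball[OF \<alpha>])
      interpret tree_pcf_sub \<alpha> "ball_at m" "ball_at n"
        by unfold_locales (use that in \<open>auto simp: ball_at_def\<close>)
      have "pcf_fdd \<alpha> (tree_on (ball_at m)) ?\<Lambda> [(\<infinity>, \<xi>)]
          = big.fin (\<lambda>x. indicator {x. R x = \<xi>} x * 1) initial_config"
        unfolding pcf_fdd_def by (simp add: transition_def big.fin_def R_def)
      also have "(\<lambda>x. indicator {x. R x = \<xi>} x * 1 :: real) = (\<lambda>x. of_bool (R x = \<xi>))"
        by (auto simp: fun_eq_iff)
      also have "big.fin \<dots> initial_config = small.fin (\<lambda>x. of_bool (x = \<xi>)) (res initial_config)"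
        unfolding R_def by (rule fin_res[OF initial_valid])
      finally show ?thesis by (simp add: res_initial)
    qed
    then have "(\<lambda>m. pcf_fdd \<alpha> (tree_on (ball_at m)) ?\<Lambda> [(\<infinity>, \<xi>)]) \<longlonglongrightarrow> small.fin (\<lambda>x. of_bool (x = \<xi>)) initial_config"
      by (intro tendsto_eventually eventually_sequentiallyI)
    moreover have "(\<lambda>m. pcf_fdd \<alpha> (tree_on (ball_at m)) ?\<Lambda> [(\<infinity>, \<xi>)]) \<longlonglongrightarrow>
        measure M {\<omega>\<in>space M. \<forall>(t, \<xi>)\<in>set [(\<infinity>, \<xi>)]. restrict_config ?\<Lambda> (\<eta> t \<omega>) = \<xi>}"
    proof -
      have "sorted_wrt (<) (map fst [(\<infinity> :: ennreal, \<xi>)])" by simp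
      then show ?thesis
        using inf finite_subgraph_ball exhaustion_balls unfolding infinite_volume_pcf_def by blast
    qed
    ultimately show ?thesis
      using LIMSEQ_unique by (fastforce simp: E_def R_def)
  qed
  have split: "{\<omega>\<in>space M. R (\<eta> \<infinity> \<omega>) \<in> A} = (\<Union>\<xi>\<in>A \<inter> C. E \<xi>)"
    using R_C by (auto simp: E_def)
  show "{\<omega>\<in>space M. R (\<eta> \<infinity> \<omega>) \<in> A} \<in> sets M"
    unfolding split using fin_C by (intro sets.finite_UN E_meas) auto
  have "prob (\<Union>\<xi>\<in>A \<inter> C. E \<xi>) = (\<Sum>\<xi>\<in>A \<inter> C. prob (E \<xi>))"
    using fin_C E_meas by (intro finite_measure_finite_Union) (auto simp: disjoint_family_on_def E_def)
  also have "\<dots> = small.fin (\<lambda>x. \<Sum>\<xi>\<in>A \<inter> C. of_bool (x = \<xi>)) initial_config"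
    unfolding E_prob by (rule small.fin_sum[OF init, symmetric])
  also have "\<dots> = small.fin (\<lambda>x. of_bool (x \<in> A)) initial_config"
  proof (rule small.fin_cong[OF _ init])
    fix y assume "y \<in> valid (ball_at n)"
    then have "y \<in> C" by (simp add: valid_def C_def)
    then show "(\<Sum>\<xi>\<in>A \<inter> C. of_bool (y = \<xi>)) = (of_bool (y \<in> A) :: real)"
      using fin_C by (simp add: of_bool_def)
  qed
  finally show "prob {\<omega>\<in>space M. R (\<eta> \<infinity> \<omega>) \<in> A} = small.fin (\<lambda>x. of_bool (x \<in> A)) initial_config"
    unfolding split .
qed

subsection \<open>Shapes of clusters\<close>

text \<open>\<open>Cut\<close> stands for an open parent edge below which nothing is observed.\<close>

datatype shape = Stop | Cut | Br shape shape

fun joined :: "bool list \<Rightarrow> shape \<Rightarrow> bool list set" where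
  "joined v Stop = {}"
| "joined v Cut = {v}"
| "joined v (Br l r) = insert v (joined (False # v) l \<union> joined (True # v) r)"

fun stopped :: "bool list \<Rightarrow> shape \<Rightarrow> bool list set" where
  "stopped v Stop = {v}"
| "stopped v Cut = {}"
| "stopped v (Br l r) = stopped (False # v) l \<union> stopped (True # v) r"

fun num_joined :: "shape \<Rightarrow> nat" where
  "num_joined Stop = 0"
| "num_joined Cut = 1"
| "num_joined (Br l r) = Suc (num_joined l + num_joined r)"

fun num_stopped :: "shape \<Rightarrow> nat" where
  "num_stopped Stop = 1"
| "num_stopped Cut = 0"
| "num_stopped (Br l r) = num_stopped l + num_stopped r"

fun whole :: "shape \<Rightarrow> bool" where
  "whole Stop = True"
| "whole Cut = False"
| "whole (Br l r) = (whole l \<and> whole r)"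

fun height :: "shape \<Rightarrow> nat" where
  "height Stop = 0"
| "height Cut = 0"
| "height (Br l r) = Suc (max (height l) (height r))"

fun has_shape :: "bool list config \<Rightarrow> bool list \<Rightarrow> shape \<Rightarrow> bool" where
  "has_shape x v Stop = (\<not> linked x v)"
| "has_shape x v Cut = linked x v"
| "has_shape x v (Br l r) = (linked x v \<and> has_shape x (False # v) l \<and> has_shape x (True # v) r)"

text \<open>Complete exploration to depth \<open>m\<close>, with \<open>Cut\<close> only at the last
  level: exactly one element matches a given configuration (\<open>ex_shape\<close>,
  \<open>shape_unique\<close>), and it is whole if the branch has died out by then.\<close>

fun shapes :: "nat \<Rightarrow> shape set" where
  "shapes 0 = {Stop, Cut}"
| "shapes (Suc m) = insert Stop (case_prod Br ` (shapes m \<times> shapes m))"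

text \<open>The Galton--Watson recursion started from a potential link and not from a vertex: either
  the link is closed, or both branches beneath it die out one level earlier.\<close>

fun extinct :: "real \<Rightarrow> nat \<Rightarrow> real" where
  "extinct p 0 = 1 - p"
| "extinct p (Suc m) = (1 - p) + p * (extinct p m)\<^sup>2"

definition weight :: "real \<Rightarrow> shape \<Rightarrow> real" where
  "weight p s = p ^ num_joined s * (1 - p) ^ num_stopped s"

lemma suffix_of_shape: "w \<in> joined v s \<union> stopped v s \<Longrightarrow> suffix v w"
proof (induction s arbitrary: v)
  case (Br l r)
  have "suffix v w" if "suffix (b # v) w" for b
    using that by (meson suffix_ConsD)
  with Br show ?case by auto
qed auto

lemma suffix_Cons_disjoint: "suffix (False # v) w \<Longrightarrow> suffix (True # v) w \<Longrightarrow> False"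
  by (auto simp: suffix_def)

lemma children_disjoint:
  "(joined (False # v) l \<union> stopped (False # v) l) \<inter> (joined (True # v) r \<union> stopped (True # v) r) = {}"
  using suffix_of_shape suffix_Cons_disjoint by blast

lemma not_in_children: "v \<notin> joined (b # v) s \<union> stopped (b # v) s"
  using suffix_of_shape[of v "b # v" s] suffix_length_le[of "b # v" v] by auto

lemma joined_stopped_disjoint: "joined v s \<inter> stopped v s = {}"
proof (induction s arbitrary: v)
  case (Br l r)
  then show ?case using children_disjoint[of v l r] not_in_children[of v] by fastforce
qed auto

lemma parent_in_shape: "w \<in> joined v s \<union> stopped v s \<Longrightarrow> w = v \<or> tl w \<in> joined v s"
proof (induction s arbitrary: v)
  case (Br l r)
  then consider "w = v" | b c where "w \<in> joined (b # v) c \<union> stopped (b # v) c" "(b, c) = (False, l) \<or> (b, c) = (True, r)"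
    by auto
  then show ?case
  proof cases
    case (2 b c)
    then have "w = b # v \<or> tl w \<in> joined (b # v) c" using Br.IH by auto
    with 2 show ?thesis by auto
  qed simp
qed auto

lemma finite_joined: "finite (joined v s)" and finite_stopped: "finite (stopped v s)"
  by (induction s arbitrary: v) auto

lemma card_joined: "card (joined v s) = num_joined s"
proof (induction s arbitrary: v)
  case (Br l r)
  have "card (joined (False # v) l \<union> joined (True # v) r) = num_joined l + num_joined r"
    using Br children_disjoint[of v l r] by (subst card_Un_disjoint) (auto simp: finite_joined)
  then show ?case using not_in_children[of v] by (simp add: finite_joined)
qed auto

lemma card_stopped: "card (stopped v s) = num_stopped s"
proof (induction s arbitrary: v)
  case (Br l r)
  show ?case
    using Br children_disjoint[of v l r] by (simp, subst card_Un_disjoint) (auto simp: finite_stopped)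
qed auto

lemma length_shape: "w \<in> joined v s \<union> stopped v s \<Longrightarrow> length w \<le> length v + height s"
  by (induction s arbitrary: v) fastforce+

lemma has_shape_iff: "has_shape x v s \<longleftrightarrow> matches (joined v s) (stopped v s) x"
  by (induction s arbitrary: v) (auto simp: matches_def)

text \<open>What a cluster looks like below its top \<open>a\<close> is a pair of shapes, one for
  each child; the link of \<open>a\<close> itself is kept apart.\<close>

definition pair_joined :: "bool list \<Rightarrow> shape \<times> shape \<Rightarrow> bool list set" where
  "pair_joined a q = joined (False # a) (fst q) \<union> joined (True # a) (snd q)"

definition pair_stopped :: "bool list \<Rightarrow> shape \<times> shape \<Rightarrow> bool list set" where
  "pair_stopped a q = stopped (False # a) (fst q) \<union> stopped (True # a) (snd q)"

definition has_pair :: "bool list config \<Rightarrow> bool list \<Rightarrow> shape \<times> shape \<Rightarrow> bool" where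
  "has_pair x a q \<longleftrightarrow> has_shape x (False # a) (fst q) \<and> has_shape x (True # a) (snd q)"

lemma has_pair_iff: "has_pair x a q \<longleftrightarrow> matches (pair_joined a q) (pair_stopped a q) x"
  by (auto simp: has_pair_def has_shape_iff matches_def pair_joined_def pair_stopped_def)

lemma card_pair:
  "card (pair_joined a q) = num_joined (fst q) + num_joined (snd q)"
  "card (pair_stopped a q) = num_stopped (fst q) + num_stopped (snd q)"
  unfolding pair_joined_def pair_stopped_def
  using children_disjoint[of a "fst q" "snd q"]
  by (subst card_Un_disjoint, auto simp: finite_joined finite_stopped card_joined card_stopped)+

lemma below_children: "suffix (b # a) w \<Longrightarrow> below a w"
  by (auto simp: below_def suffix_def tl_append split: list.split)

lemma frame_pair: "frame a (pair_joined a q) (pair_stopped a q)"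
proof -
  have "below a w \<and> tl w \<in> insert a (pair_joined a q)" if "w \<in> joined (b # a) s \<union> stopped (b # a) s"
    "(b, s) = (False, fst q) \<or> (b, s) = (True, snd q)" for w b s
    using below_children[OF suffix_of_shape[OF that(1)]] parent_in_shape[OF that(1)] that(2)
    by (auto simp: pair_joined_def)
  then have "below a w \<and> tl w \<in> insert a (pair_joined a q)" if "w \<in> pair_joined a q \<union> pair_stopped a q" for w
    using that unfolding pair_joined_def pair_stopped_def by blast
  moreover have "pair_joined a q \<inter> pair_stopped a q = {}"
    using children_disjoint[of a "fst q" "snd q"] joined_stopped_disjoint[of "False # a" "fst q"]
      joined_stopped_disjoint[of "True # a" "snd q"]
    unfolding pair_joined_def pair_stopped_def by blast
  ultimately show ?thesis unfolding frame_def by blast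
qed

lemma length_pair:
  assumes "w \<in> pair_joined a q \<union> pair_stopped a q"
  shows "length w \<le> Suc (length a + max (height (fst q)) (height (snd q)))"
  using assms length_shape[of w "False # a" "fst q"] length_shape[of w "True # a" "snd q"]
  unfolding pair_joined_def pair_stopped_def by auto

lemma finite_shapes: "finite (shapes m)"
  by (induction m) auto

lemma shapes_height: "s \<in> shapes m \<Longrightarrow> height s \<le> m"
  by (induction m arbitrary: s) (auto simp: max_def)

lemma whole_in_shapes: "whole s \<Longrightarrow> height s \<le> m \<Longrightarrow> s \<in> shapes m"
proof (induction m arbitrary: s)
  case 0
  then show ?case by (cases s) auto
next
  case (Suc m)
  then show ?case by (cases s) (auto intro!: image_eqI[of _ _ "(_, _)"])
qed

lemma height_le_num_joined: "height s \<le> num_joined s"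
  by (induction s) auto

lemma num_stopped_whole: "whole s \<Longrightarrow> num_stopped s = Suc (num_joined s)"
  by (induction s) auto

lemma ex_shape: "\<exists>s\<in>shapes m. has_shape x v s"
proof (induction m arbitrary: v)
  case (Suc m)
  obtain l r where "l \<in> shapes m" "has_shape x (False # v) l" "r \<in> shapes m" "has_shape x (True # v) r"
    using Suc[of "False # v"] Suc[of "True # v"] by blast
  then have "(if linked x v then Br l r else Stop) \<in> shapes (Suc m)" "has_shape x v (if linked x v then Br l r else Stop)"
    by (auto intro!: image_eqI[of _ _ "(l, r)"])
  then show ?case by blast
qed auto

lemma shape_unique: "s \<in> shapes m \<Longrightarrow> s' \<in> shapes m \<Longrightarrow> has_shape x v s \<Longrightarrow> has_shape x v s' \<Longrightarrow> s = s'"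
proof (induction m arbitrary: v s s')
  case (Suc m)
  then show ?case by auto
qed auto

lemma shapes_weight: "(\<Sum>s\<in>shapes m. weight p s) = 1"
  and shapes_whole_weight: "(\<Sum>s\<in>{s\<in>shapes m. whole s}. weight p s) = extinct p m"
proof -
  have inj: "inj_on (case_prod Br) A" for A by (auto simp: inj_on_def)
  have Br: "(\<Sum>s\<in>case_prod Br ` (A \<times> B). weight p s) = p * ((\<Sum>s\<in>A. weight p s) * (\<Sum>s\<in>B. weight p s))" for A B
  proof -
    have "weight p (Br l r) = p * (weight p l * weight p r)" for l r
      by (simp add: weight_def power_add)
    then have "(\<Sum>s\<in>case_prod Br ` (A \<times> B). weight p s) = (\<Sum>(l, r)\<in>A \<times> B. p * (weight p l * weight p r))"
      by (subst sum.reindex[OF inj]) (simp add: split_def)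
    also have "\<dots> = p * (\<Sum>l\<in>A. \<Sum>r\<in>B. weight p l * weight p r)"
      by (simp only: sum.cartesian_product[symmetric] sum_distrib_left)
    also have "\<dots> = p * ((\<Sum>s\<in>A. weight p s) * (\<Sum>s\<in>B. weight p s))"
      by (simp only: sum_product)
    finally show ?thesis .
  qed
  show "(\<Sum>s\<in>shapes m. weight p s) = 1"
  proof (induction m)
    case (Suc m)
    have "Stop \<notin> case_prod Br ` (shapes m \<times> shapes m)" by auto
    then show ?case using Suc by (simp add: finite_shapes Br) (simp add: weight_def)
  qed (simp add: weight_def)
  show "(\<Sum>s\<in>{s\<in>shapes m. whole s}. weight p s) = extinct p m"
  proof (induction m)
    case 0
    have "{s\<in>shapes 0. whole s} = {Stop}" by auto
    then show ?case by (simp add: weight_def)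
  next
    case (Suc m)
    let ?W = "{s\<in>shapes m. whole s}"
    have "{s\<in>shapes (Suc m). whole s} = insert Stop (case_prod Br ` (?W \<times> ?W))" by auto
    moreover have "Stop \<notin> case_prod Br ` (?W \<times> ?W)" by auto
    ultimately show ?case
      using Suc by (simp add: finite_shapes Br power2_eq_square) (simp add: weight_def)
  qed
qed

section \<open>Downward clusters and the shapes that describe them\<close>

inductive_set reach :: "bool list config \<Rightarrow> bool list \<Rightarrow> bool list set" for x a where
  "a \<in> reach x a"
| "w \<in> reach x a \<Longrightarrow> linked x (b # w) \<Longrightarrow> b # w \<in> reach x a"

definition branch :: "bool list config \<Rightarrow> bool list \<Rightarrow> bool list set" where
  "branch x v = (if linked x v then reach x v else {})"

lemma reach_suffix: "w \<in> reach x a \<Longrightarrow> suffix a w"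
  by (induction rule: reach.induct) (auto intro: suffix_ConsI)

lemma reach_eq: "reach x a = insert a (branch x (False # a) \<union> branch x (True # a))"
proof
  show "reach x a \<subseteq> insert a (branch x (False # a) \<union> branch x (True # a))"
  proof
    fix w assume "w \<in> reach x a"
    then show "w \<in> insert a (branch x (False # a) \<union> branch x (True # a))"
    proof induction
      case (2 w b)
      then show ?case
        by (cases b) (auto simp: branch_def intro: reach.intros split: if_splits)
    qed simp
  qed
  have "w \<in> reach x a" if "w \<in> reach x (b # a)" "linked x (b # a)" for w b
    using that by (induction rule: reach.induct) (auto intro: reach.intros)
  then show "insert a (branch x (False # a) \<union> branch x (True # a)) \<subseteq> reach x a"
    by (auto simp: branch_def intro: reach.intros split: if_splits)
qed

lemma branch_suffix: "w \<in> branch x v \<Longrightarrow> suffix v w"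
  using reach_suffix by (auto simp: branch_def split: if_splits)

lemma card_reach:
  assumes "finite (reach x a)"
  shows "card (reach x a) = Suc (card (branch x (False # a)) + card (branch x (True # a)))"
    and "finite (branch x (False # a))" "finite (branch x (True # a))"
proof -
  show fin: "finite (branch x (False # a))" "finite (branch x (True # a))" using assms by (simp_all add: reach_eq)
  have "branch x (False # a) \<inter> branch x (True # a) = {}"
    using branch_suffix suffix_Cons_disjoint by blast
  moreover have "a \<notin> branch x (b # a)" for b
    using branch_suffix[of a x "b # a"] suffix_length_le[of "b # a" a] by auto
  ultimately show "card (reach x a) = Suc (card (branch x (False # a)) + card (branch x (True # a)))"
    using fin by (simp add: reach_eq card_Un_disjoint)
qed

lemma branch_of_shape: "whole s \<Longrightarrow> has_shape x v s \<Longrightarrow> branch x v = joined v s"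
proof (induction s arbitrary: v)
  case (Br l r)
  then have "branch x v = insert v (branch x (False # v) \<union> branch x (True # v))"
    using reach_eq[of x v] by (simp add: branch_def[of x v])
  with Br show ?case by simp
qed (auto simp: branch_def)

lemma shape_of_branch: "finite (branch x v) \<Longrightarrow> \<exists>s. whole s \<and> has_shape x v s"
proof (induction "card (branch x v)" arbitrary: v rule: less_induct)
  case less
  show ?case
  proof (cases "linked x v")
    case True
    then have b: "branch x v = reach x v" by (simp add: branch_def)
    then have fin: "finite (reach x v)" using less.prems by simp
    note c = card_reach[OF fin]
    have "\<exists>s. whole s \<and> has_shape x (False # v) s" "\<exists>s. whole s \<and> has_shape x (True # v) s"
      using less.hyps[OF _ c(2)] less.hyps[OF _ c(3)] c(1) b by auto
    then obtain l r where "whole (Br l r)" "has_shape x v (Br l r)" using True by auto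
    then show ?thesis by blast
  next
    case False
    then have "whole Stop \<and> has_shape x v Stop" by simp
    then show ?thesis by blast
  qed
qed

lemma whole_shape_unique: "whole s \<Longrightarrow> whole s' \<Longrightarrow> has_shape x v s \<Longrightarrow> has_shape x v s' \<Longrightarrow> s = s'"
proof (induction s arbitrary: s' v)
  case Stop
  then show ?case by (cases s') auto
next
  case (Br l r)
  then show ?case by (cases s') auto
qed auto

definition whole_pairs :: "nat \<Rightarrow> (shape \<times> shape) set" where
  "whole_pairs m = {s\<in>shapes m. whole s} \<times> {s\<in>shapes m. whole s}"

text \<open>At least one \<open>Cut\<close> occurs, and it lies \<open>m + 1\<close> levels below
  \<open>a\<close>; these are the explorations that reach that depth.\<close>

abbreviation reaching_pairs :: "nat \<Rightarrow> (shape \<times> shape) set" where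
  "reaching_pairs m \<equiv> shapes m \<times> shapes m - whole_pairs m"

text \<open>Turns finiteness into a countable union of events, each depending on finitely many
  links.\<close>

lemma finite_reach_iff: "finite (reach x a) \<longleftrightarrow> (\<exists>m. \<exists>q\<in>whole_pairs m. has_pair x a q)"
proof
  assume "finite (reach x a)"
  then obtain l r where "whole l" "has_shape x (False # a) l" "whole r" "has_shape x (True # a) r"
    using card_reach(2,3)[of x a] shape_of_branch[of x "False # a"] shape_of_branch[of x "True # a"] by blast
  then have "(l, r) \<in> whole_pairs (max (height l) (height r))" "has_pair x a (l, r)"
    by (auto simp: whole_pairs_def has_pair_def intro!: whole_in_shapes)
  then show "\<exists>m. \<exists>q\<in>whole_pairs m. has_pair x a q" by blast
next
  assume "\<exists>m. \<exists>q\<in>whole_pairs m. has_pair x a q"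
  then obtain m q where "q \<in> whole_pairs m" "has_pair x a q" by blast
  then have "branch x (False # a) = joined (False # a) (fst q)" "branch x (True # a) = joined (True # a) (snd q)"
    by (auto simp: whole_pairs_def has_pair_def intro!: branch_of_shape)
  then show "finite (reach x a)" by (simp add: reach_eq finite_joined)
qed

lemma whole_pairs_mono: "m \<le> n \<Longrightarrow> whole_pairs m \<subseteq> whole_pairs n"
  using shapes_height whole_in_shapes unfolding whole_pairs_def
  by (force intro: order_trans)

definition sized_pairs :: "nat \<Rightarrow> (shape \<times> shape) set" where
  "sized_pairs k = {(l, r). whole l \<and> whole r \<and> num_joined l + num_joined r = k}"

lemma reach_size_iff:
  "finite (reach x a) \<and> card (reach x a) = Suc k \<longleftrightarrow> (\<exists>q\<in>sized_pairs k. has_pair x a q)"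
proof
  assume *: "finite (reach x a) \<and> card (reach x a) = Suc k"
  then obtain l r where lr: "whole l" "has_shape x (False # a) l" "whole r" "has_shape x (True # a) r"
    using card_reach(2,3)[of x a] shape_of_branch[of x "False # a"] shape_of_branch[of x "True # a"] by blast
  then have "num_joined l + num_joined r = k"
    using * card_reach(1)[of x a] branch_of_shape[OF lr(1,2)] branch_of_shape[OF lr(3,4)] by (simp add: card_joined)
  with lr show "\<exists>q\<in>sized_pairs k. has_pair x a q"
    by (intro bexI[of _ "(l, r)"]) (auto simp: sized_pairs_def has_pair_def)
next
  assume "\<exists>q\<in>sized_pairs k. has_pair x a q"
  then obtain l r where lr: "whole l" "has_shape x (False # a) l" "whole r" "has_shape x (True # a) r"
    "num_joined l + num_joined r = k"
    by (auto simp: sized_pairs_def has_pair_def)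
  then have b: "branch x (False # a) = joined (False # a) l" "branch x (True # a) = joined (True # a) r"
    by (auto intro!: branch_of_shape)
  then have fin: "finite (reach x a)" by (simp add: reach_eq finite_joined)
  with card_reach(1)[OF fin] lr(5) b show "finite (reach x a) \<and> card (reach x a) = Suc k" by (simp add: card_joined)
qed

section \<open>Counting shapes by size\<close>

definition catalan :: "nat \<Rightarrow> nat" where
  "catalan k = card {s. whole s \<and> num_joined s = k}"

lemma finite_sized: "finite {s. whole s \<and> num_joined s = k}"
  by (rule finite_subset[OF _ finite_shapes[of k]])
    (use whole_in_shapes height_le_num_joined in auto)

lemma catalan_0: "catalan 0 = 1"
proof -
  have "{s. whole s \<and> num_joined s = 0} = {Stop}"
  proof -
    have "s = Stop" if "whole s" "num_joined s = 0" for s using that by (cases s) auto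
    then show ?thesis by auto
  qed
  then show ?thesis by (simp add: catalan_def)
qed

lemma finite_sized_pairs: "finite (sized_pairs k)"
  by (rule finite_subset[of _ "(\<Union>i\<le>k. {s. whole s \<and> num_joined s = i}) \<times> (\<Union>i\<le>k. {s. whole s \<and> num_joined s = i})"])
    (auto simp: sized_pairs_def intro: finite_cartesian_product finite_sized)

text \<open>Putting a vertex on top of a pair with \<open>k\<close> joined vertices gives a binary
  tree with \<open>k + 1\<close> nodes, which explains the shift of the index.\<close>

lemma card_sized_pairs: "card (sized_pairs k) = catalan (Suc k)"
proof -
  have "{s. whole s \<and> num_joined s = Suc k} = case_prod Br ` sized_pairs k"
  proof -
    have "s \<in> case_prod Br ` sized_pairs k" if "whole s" "num_joined s = Suc k" for s
      using that by (cases s) (auto simp: sized_pairs_def intro!: image_eqI[of _ _ "(_, _)"])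
    then show ?thesis by (auto simp: sized_pairs_def)
  qed
  moreover have "inj_on (case_prod Br) A" for A by (auto simp: inj_on_def)
  ultimately show ?thesis by (simp add: catalan_def card_image)
qed

lemma catalan_Suc: "catalan (Suc k) = (\<Sum>i\<le>k. catalan i * catalan (k - i))"
proof -
  let ?W = "\<lambda>k. {s. whole s \<and> num_joined s = k}"
  have "sized_pairs k = (\<Union>i\<le>k. ?W i \<times> ?W (k - i))" by (auto simp: sized_pairs_def)
  then have "card (sized_pairs k) = (\<Sum>i\<le>k. card (?W i \<times> ?W (k - i)))"
    by (simp, subst card_UN_disjoint) (auto intro: finite_cartesian_product finite_sized)
  then show ?thesis by (simp add: card_sized_pairs card_cartesian_product catalan_def)
qed

subsection \<open>Catalan numbers\<close>

text \<open>
  The generating function \<open>C\<close> satisfies \<open>C = 1 + X C\<^sup>2\<close>, so \<open>(1 - 2 X C)\<^sup>2 = 1 - 4 X\<close>.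
\<close>

lemma catalan_recurrence_closed:
  fixes c :: "nat \<Rightarrow> nat"
  assumes "c 0 = 1" "\<And>k. c (Suc k) = (\<Sum>i\<le>k. c i * c (k - i))"
  shows "real (c k) = - (1 / 2) * (1 / 2 gchoose Suc k) * (- 4) ^ Suc k"
proof -
  define C :: "real fps" where "C = Abs_fps (\<lambda>n. real (c n))"
  have C: "C = 1 + fps_X * C\<^sup>2"
  proof (rule fps_ext)
    fix n
    show "fps_nth C n = fps_nth (1 + fps_X * C\<^sup>2) n"
    proof (cases n)
      case 0
      then show ?thesis by (simp add: C_def assms(1))
    next
      case (Suc k)
      have "fps_nth (C\<^sup>2) k = real (c (Suc k))"
        by (simp add: C_def assms(2) power2_eq_square fps_mult_nth atLeast0AtMost)
      moreover have "fps_nth (1 + fps_X * C\<^sup>2) (Suc k) = fps_nth (C\<^sup>2) k" by simp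
      moreover have "fps_nth C (Suc k) = real (c (Suc k))" by (simp add: C_def)
      ultimately show ?thesis unfolding Suc by (simp only:)
    qed
  qed
  \<comment> \<open>The square root of \<open>1 - 4 X\<close> given by the binomial series.\<close>
  define B :: "real fps" where "B = fps_compose (fps_binomial (1/2)) (fps_const (-4) * fps_X)"
  have B_nth: "fps_nth B n = (1 / 2 gchoose n) * (- 4) ^ n" for n
    by (simp add: B_def fps_compose_linear)
  have "B ^ 2 = fps_compose ((fps_binomial (1/2)) ^ 2) (fps_const (-4) * fps_X)"
    unfolding B_def by (rule fps_compose_power) simp
  also have "(fps_binomial (1/2) :: real fps) ^ 2 = 1 + fps_X"
    by (simp add: power2_eq_square fps_binomial_add_mult[symmetric] fps_binomial_1)
  also have "fps_compose (1 + fps_X) (fps_const (-4) * fps_X) = 1 - fps_const 4 * (fps_X :: real fps)"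
    by (simp add: fps_compose_add_distrib)
  finally have "B ^ 2 = 1 - fps_const 4 * fps_X" .
  moreover have "(1 - fps_const 2 * fps_X * C) ^ 2 = 1 - fps_const 4 * fps_X"
  proof -
    have "(1 - fps_const 2 * fps_X * C) ^ 2 = 1 - 4 * fps_X * (C - fps_X * C\<^sup>2)"
      by (simp add: power2_eq_square algebra_simps flip: numeral_fps_const)
    also have "C - fps_X * C\<^sup>2 = 1" 
      using arg_cong[OF C, of "\<lambda>z. z - fps_X * C\<^sup>2"] by (simp only: add_diff_cancel_right')
    finally show ?thesis by (simp flip: numeral_fps_const)
  qed
  ultimately have "B = 1 - fps_const 2 * fps_X * C \<or> B = - (1 - fps_const 2 * fps_X * C)"
    using power2_eq_iff[of B "1 - fps_const 2 * fps_X * C"] by simp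
  \<comment> \<open>The constant terms are 1 and -1, which selects the sign of the root.\<close>
  moreover have "fps_nth B 0 \<noteq> fps_nth (- (1 - fps_const 2 * fps_X * C)) 0"
    by (simp add: B_nth mult.assoc)
  ultimately have "B = 1 - fps_const 2 * fps_X * C" by auto
  then have "fps_nth B (Suc k) = - 2 * real (c k)"
    by (simp add: mult.assoc) (simp add: C_def)
  then show ?thesis by (simp add: B_nth)
qed

text \<open>The asymptotics of \<open>1 / 2 gchoose n\<close> involve
  \<open>1 / Gamma (- (1 / 2))\<close>. Since \<open>Gamma (- (1 / 2))\<close> is negative, the
  factor -2 from the closed form makes the limit positive.\<close>

lemma catalan_recurrence_asymp:
  fixes c :: "nat \<Rightarrow> nat"
  assumes "c 0 = 1" "\<And>k. c (Suc k) = (\<Sum>i\<le>k. c i * c (k - i))"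
  obtains d where "d > 0" "(\<lambda>k. real (c k) / (4 ^ k * real k powr (- 3 / 2))) \<longlonglongrightarrow> d"
proof
  define g where "g n = (1 / 2 gchoose n :: real) / ((- 1) ^ n / exp ((1 / 2 + 1) * ln (real n)))" for n
  define l :: real where "l = inverse (Gamma (- (1 / 2)))"
  have g: "g \<longlonglongrightarrow> l"
    unfolding g_def l_def using gbinomial_asymptotic[of "1 / 2 :: real"] by simp
  have "Gamma (- (1 / 2) + 1 :: real) = - (1 / 2) * Gamma (- (1 / 2))"
  proof (rule Gamma_plus1)
    show "- (1 / 2 :: real) \<notin> \<int>\<^sub>\<le>\<^sub>0"
    proof
      assume "- (1 / 2 :: real) \<in> \<int>\<^sub>\<le>\<^sub>0"
      then obtain n :: int where "- (1 / 2 :: real) = of_int n" "n \<le> 0" by (rule nonpos_Ints_cases)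
      then have "real_of_int (- 1) = real_of_int (2 * n)" by linarith
      then have "- 1 = 2 * n" by (rule of_int_eq_iff[THEN iffD1])
      then show False by presburger
    qed
  qed
  moreover have "Gamma (1 / 2 :: real) > 0" by (rule Gamma_real_pos) simp
  ultimately have "Gamma (- (1 / 2) :: real) < 0" by simp
  then show "- 2 * l > 0" by (simp add: l_def)
  have "(\<lambda>k. g (Suc k)) \<longlonglongrightarrow> l" using g by (rule LIMSEQ_Suc)
  moreover have "(\<lambda>k. (real k / real (Suc k)) powr (3 / 2)) \<longlonglongrightarrow> 1" by real_asymp
  ultimately have "(\<lambda>k. - 2 * g (Suc k) * (real k / real (Suc k)) powr (3 / 2)) \<longlonglongrightarrow> - 2 * l * 1"
    by (intro tendsto_intros)
  then have "(\<lambda>k. - 2 * g (Suc k) * (real k / real (Suc k)) powr (3 / 2)) \<longlonglongrightarrow> - 2 * l" by simp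
  then show "(\<lambda>k. real (c k) / (4 ^ k * real k powr (- 3 / 2))) \<longlonglongrightarrow> - 2 * l"
  proof (rule Lim_transform_eventually)
    show "\<forall>\<^sub>F k in sequentially. - 2 * g (Suc k) * (real k / real (Suc k)) powr (3 / 2)
        = real (c k) / (4 ^ k * real k powr (- 3 / 2))"
      using eventually_gt_at_top[of 0]
    proof eventually_elim
      case (elim k)
      have "exp ((1 / 2 + 1) * ln (real (Suc k))) = real (Suc k) powr (3 / 2)" by (simp add: powr_def)
      then have g: "g (Suc k) = (1 / 2 gchoose Suc k) * (- 1) ^ Suc k * real (Suc k) powr (3 / 2)"
        unfolding g_def by (simp add: field_simps del: of_nat_Suc)
      have "real (c k) = - (1 / 2) * (1 / 2 gchoose Suc k) * (- 4) ^ Suc k"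
        by (rule catalan_recurrence_closed[OF assms])
      also have "(- 4 :: real) ^ Suc k = (- 1) ^ Suc k * (4 * 4 ^ k)"
        by (simp add: power_mult_distrib[symmetric] del: power_mult_distrib)
      finally have c: "real (c k) / 4 ^ k = - 2 * ((1 / 2 gchoose Suc k) * (- 1) ^ Suc k)" by simp
      have "real (c k) / (4 ^ k * real k powr (- 3 / 2)) = real (c k) / 4 ^ k * real k powr (3 / 2)"
        by (simp add: powr_minus field_simps)
      also have "\<dots> = - 2 * g (Suc k) * (real k powr (3 / 2) / real (Suc k) powr (3 / 2))"
        unfolding c g by simp
      also have "real k powr (3 / 2) / real (Suc k) powr (3 / 2) = (real k / real (Suc k)) powr (3 / 2)"
        by (simp add: powr_divide)
      finally show ?case by simp
    qed
  qed
qed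

subsection \<open>Asymptotics of the mixture over freezing times\<close>

lemma integrable_inverse_1_plus_sq: "integrable lborel (\<lambda>z :: real. K / (1 + z\<^sup>2))"
proof -
  have "einterval (-\<infinity>) \<infinity> = UNIV" by (auto simp: einterval_def)
  then have "integrable lborel (\<lambda>z :: real. inverse (1 + z\<^sup>2))"
    using integrable_inverse_1_plus_square by (simp add: set_integrable_def)
  then show ?thesis by (simp add: divide_inverse)
qed

lemma dominated_tendsto_pos:
  fixes f :: "nat \<Rightarrow> real \<Rightarrow> real"
  assumes [measurable]: "\<And>n. f n \<in> borel_measurable lborel" "g \<in> borel_measurable lborel"
    and lim: "\<And>z. (\<lambda>n. f n z) \<longlonglongrightarrow> g z"
    and bound: "\<And>n z. \<bar>f n z\<bar> \<le> K / (1 + z\<^sup>2)" and pos: "\<And>z. g z > 0"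
  shows "(\<lambda>n. integral\<^sup>L lborel (f n)) \<longlonglongrightarrow> integral\<^sup>L lborel g" "integral\<^sup>L lborel g > 0"
proof -
  have int: "integrable lborel g"
    by (rule integrable_dominated_convergence[where s = f and w = "\<lambda>z. K / (1 + z\<^sup>2)"])
      (use lim bound integrable_inverse_1_plus_sq in auto)
  show "(\<lambda>n. integral\<^sup>L lborel (f n)) \<longlonglongrightarrow> integral\<^sup>L lborel g"
    by (rule integral_dominated_convergence[where w = "\<lambda>z. K / (1 + z\<^sup>2)"])
      (use lim bound integrable_inverse_1_plus_sq in auto)
  have "integral\<^sup>L lborel g \<noteq> 0"
  proof
    assume "integral\<^sup>L lborel g = 0"
    then have "AE z in lborel. g z = 0"
      using integral_nonneg_eq_0_iff_AE[OF int] pos by (simp add: less_imp_le)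
    then have "AE z in (lborel :: real measure). False"
      by eventually_elim (metis pos less_irrefl)
    then have "emeasure (lborel :: real measure) UNIV = 0" by (simp add: AE_iff_measurable[OF _ refl])
    then show False by simp
  qed
  moreover have "integral\<^sup>L lborel g \<ge> 0" using pos by (simp add: less_imp_le)
  ultimately show "integral\<^sup>L lborel g > 0" by linarith
qed

lemma set_integral_rescale:
  fixes G :: "real \<Rightarrow> real"
  assumes "c > 0"
  shows "(LINT s:{0..}|lborel. G s) = c * (LINT z|lborel. indicator {0..} (s0 + c * z) * G (s0 + c * z))"
  unfolding set_lebesgue_integral_def
  using assms by (subst lborel_integral_real_affine[of c _ s0]) auto

lemma exp_minus_le: "exp (- a) \<le> 1 / (1 + a)" if "a \<ge> 0" for a :: real
  using exp_ge_add_one_self[of a] that by (simp add: exp_minus field_simps)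

lemma exp_minus_le_sq: "exp (- a) \<le> 2 / a\<^sup>2" if "a > 0" for a :: real
proof -
  have "a\<^sup>2 / 2 \<le> exp a" using exp_lower_Taylor_quadratic[of a] that by simp
  then show ?thesis using that by (simp add: exp_minus field_simps)
qed

lemma one_minus_power_le_exp: "(1 - a) ^ n \<le> exp (- (real n * a))" if "a \<le> 1" for a :: real
proof -
  have "(1 - a) ^ n \<le> exp (- a) ^ n"
    using that exp_ge_add_one_self[of "- a"] by (intro power_mono) auto
  then show ?thesis by (simp add: exp_of_nat_mult[symmetric])
qed

text \<open>\<open>x\<close> measures the distance from criticality:
  \<open>4 * p * (1 - p) = 1 - x\<^sup>2\<close> for \<open>p = join_prob \<alpha> s\<close>. The
  power of 4 is the growth of the Catalan numbers, and the two surplus factors \<open>1 - p\<close>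
  give \<open>(1 + x)\<^sup>2 / 4\<close>.\<close>

lemma join_prob_sq:
  fixes \<alpha> :: real
  defines "x \<equiv> \<lambda>s. 1 - 2 * join_prob \<alpha> s"
  shows "4 ^ Suc n * shape_density \<alpha> n (n + 2) s = (1 + x s)\<^sup>2 * (1 - (x s)\<^sup>2) ^ n"
proof -
  let ?p = "join_prob \<alpha> s"
  have "(1 - (x s)\<^sup>2) = 4 * (?p * (1 - ?p))" by (simp add: x_def power2_eq_square algebra_simps)
  moreover have "(1 + x s)\<^sup>2 = 4 * (1 - ?p)\<^sup>2" by (simp add: x_def power2_eq_square algebra_simps)
  ultimately show ?thesis by (simp add: shape_density_def power_mult_distrib power_add power2_eq_square)
qed

lemma shape_integral_rescale:
  fixes \<alpha> c :: real
  assumes "c > 0"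
  defines "x \<equiv> \<lambda>s. 1 - 2 * join_prob \<alpha> s"
  shows "4 ^ Suc n * shape_integral \<alpha> 0 n (n + 2) = c * (LINT z|lborel. indicator {0..} (s0 + c * z) *
    (\<alpha> * exp (- \<alpha> * (s0 + c * z)) * (1 + x (s0 + c * z))\<^sup>2 * (1 - (x (s0 + c * z))\<^sup>2) ^ n))"
proof -
  have "4 ^ Suc n * shape_integral \<alpha> 0 n (n + 2)
      = (LINT s:{0..}|lborel. \<alpha> * exp (- \<alpha> * s) * (1 + x s)\<^sup>2 * (1 - (x s)\<^sup>2) ^ n)"
  proof -
    have "4 ^ Suc n * (\<alpha> * exp (- (\<alpha> + 0) * s) * shape_density \<alpha> n (n + 2) s)
        = \<alpha> * exp (- \<alpha> * s) * (1 + x s)\<^sup>2 * (1 - (x s)\<^sup>2) ^ n" for s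
      using join_prob_sq[of n \<alpha> s] unfolding x_def by (simp only: mult_ac add_0_right)
    then show ?thesis
      unfolding shape_integral_def set_integral_mult_right[symmetric] by (simp only:)
  qed
  also have "\<dots> = c * (LINT z|lborel. indicator {0..} (s0 + c * z) *
    (\<alpha> * exp (- \<alpha> * (s0 + c * z)) * (1 + x (s0 + c * z))\<^sup>2 * (1 - (x (s0 + c * z))\<^sup>2) ^ n))"
    by (rule set_integral_rescale[OF assms(1)])
  finally show ?thesis .
qed

lemma join_prob_measurable [measurable]: "join_prob \<alpha> \<in> borel_measurable borel"
  by (intro borel_measurable_continuous_onI continuous_join_prob)

text \<open>
  Laplace's method at the time \<open>s\<^sub>0\<close> at which the branching process is critical.
\<close>

lemma supercritical_integral_asymp:
  assumes "0 < \<alpha>" "\<alpha> < 1"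
  obtains C where "C > 0" "(\<lambda>n. sqrt (real n) * (4 ^ Suc n * shape_integral \<alpha> 0 n (n + 2))) \<longlonglongrightarrow> C"
proof -
  define \<beta> where "\<beta> = 1 + \<alpha>"
  \<comment> \<open>\<open>r\<close> is the value of \<open>keep_prob\<close> at which
    \<open>join_prob\<close> equals 1/2, attained at \<open>s0\<close>; \<open>A\<close> is the
    amplitude in \<open>x_shift\<close> and \<open>c\<close> the constant in
    \<open>x_lower\<close>.\<close>
  define r where "r = (1 - \<alpha>) / 2"
  define s0 where "s0 = - ln r / \<beta>"
  define A where "A = (1 - \<alpha>) / (1 + \<alpha>)"
  define c where "c = A * (\<beta> / (1 + \<beta>))"
  define x where "x s = 1 - 2 * join_prob \<alpha> s" for s
  have pos: "\<beta> > 0" "r > 0" "r < 1" "A > 0" "c > 0"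
    using assms by (auto simp: \<beta>_def r_def A_def c_def)
  have s0: "s0 > 0" using pos by (auto simp: s0_def divide_neg_pos)
  have x_shift: "x (s0 + u) = A * (exp (- \<beta> * u) - 1)" for u
  proof -
    have "keep_prob \<alpha> (s0 + u) = exp (- \<beta> * s0) * exp (- \<beta> * u)"
      by (simp add: keep_prob_def \<beta>_def exp_add[symmetric] algebra_simps)
    also have "exp (- \<beta> * s0) = r" using pos by (simp add: s0_def)
    finally show ?thesis using assms by (simp add: x_def join_prob_def A_def r_def field_simps)
  qed
  have x_bound: "\<bar>x s\<bar> \<le> 1" if "s \<ge> 0" for s
    using join_prob_bounds(1,3)[OF assms(1) that] by (simp add: x_def abs_le_iff)
  \<comment> \<open>\<open>x\<close> is linear in \<open>u\<close> near the peak but bounded for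
    large \<open>u\<close>, hence the truncation \<open>min u 1\<close>. Negative \<open>u\<close>
    uses \<open>exp y \<ge> 1 + y\<close>, positive \<open>u\<close> uses
    \<open>exp (- y) \<le> 1 / (1 + y)\<close>.\<close>
  have x_lower: "x (s0 + u) ^ 2 \<ge> c ^ 2 * (min u 1) ^ 2" for u
  proof -
    have "\<beta> / (1 + \<beta>) * \<bar>min u 1\<bar> \<le> \<bar>exp (- \<beta> * u) - 1\<bar>"
    proof (cases "u < 0")
      case True
      have "\<beta> / (1 + \<beta>) * \<bar>min u 1\<bar> \<le> \<beta> * \<bar>u\<bar>"
        using pos True by (intro mult_mono) (auto simp: field_simps)
      also have "\<dots> \<le> exp (- \<beta> * u) - 1"
        using exp_ge_add_one_self[of "- \<beta> * u"] True by simp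
      finally show ?thesis by simp
    next
      case False
      then have u: "u \<ge> 0" by simp
      have "\<beta> / (1 + \<beta>) * min u 1 \<le> \<beta> * u / (1 + \<beta> * u)"
      proof (cases "u \<le> 1")
        case True
        have "\<beta> * u / (1 + \<beta>) \<le> \<beta> * u / (1 + \<beta> * u)"
          using pos u True by (intro divide_left_mono) (auto intro!: mult_pos_pos add_pos_nonneg)
        then show ?thesis using True by simp
      next
        case False
        then have "1 + \<beta> * u > 0" using pos by (intro add_pos_pos mult_pos_pos) auto
        then show ?thesis using pos False by (simp add: divide_simps) (simp add: algebra_simps)
      qed
      also have "\<dots> = 1 - 1 / (1 + \<beta> * u)" using pos u by (simp add: field_simps add_nonneg_eq_0_iff)
      also have "\<dots> \<le> 1 - exp (- (\<beta> * u))" using exp_minus_le[of "\<beta> * u"] pos u by simp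
      finally show ?thesis using u by simp
    qed
    then have "c * \<bar>min u 1\<bar> \<le> \<bar>x (s0 + u)\<bar>"
      using mult_left_mono[of "\<beta> / (1 + \<beta>) * \<bar>min u 1\<bar>" "\<bar>exp (- \<beta> * u) - 1\<bar>" A] pos
      by (simp add: x_shift c_def abs_mult mult.assoc)
    then have "(c * \<bar>min u 1\<bar>)\<^sup>2 \<le> \<bar>x (s0 + u)\<bar>\<^sup>2" using pos by (intro power_mono) auto
    then show ?thesis by (simp add: power_mult_distrib)
  qed
  \<comment> \<open>Time is rescaled by the width of the peak. \<open>Suc n\<close> avoids a
    division by zero at 0; \<open>LIMSEQ_imp_Suc\<close> shifts the index back.\<close>
  define f where "f n z = indicator {0..} (s0 + 1 / sqrt (real (Suc n)) * z) *
    (\<alpha> * exp (- \<alpha> * (s0 + 1 / sqrt (real (Suc n)) * z)) * (1 + x (s0 + 1 / sqrt (real (Suc n)) * z))\<^sup>2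
      * (1 - (x (s0 + 1 / sqrt (real (Suc n)) * z))\<^sup>2) ^ Suc n)" for n and z :: real
  define g where "g z = \<alpha> * exp (- \<alpha> * s0) * exp (- (A * \<beta> * z)\<^sup>2)" for z
  \<comment> \<open>The first summand serves \<open>u \<le> 1\<close>, where the power is dominated
    by a Gaussian in \<open>z\<close>; the second serves \<open>u > 1\<close>, far from the
    peak.\<close>
  define K where "K = 4 * \<alpha> * (1 + 1 / c\<^sup>2) + 16 * \<alpha> / (c\<^sup>2 * \<alpha>\<^sup>2)"
  have bound: "\<bar>f n z\<bar> \<le> K / (1 + z\<^sup>2)" for n z
  proof -
    define N where "N = real (Suc n)"
    define u where "u = 1 / sqrt N * z"
    have N: "N \<ge> 1" by (simp add: N_def)
    have z: "z\<^sup>2 = N * u\<^sup>2" using N by (simp add: u_def power_mult_distrib power_divide)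
    show ?thesis
    proof (cases "s0 + u \<ge> 0")
      case True
      have y: "0 \<le> 1 - (x (s0 + u))\<^sup>2" "(x (s0 + u))\<^sup>2 \<le> 1"
        using x_bound[OF True] by (auto simp: abs_square_le_1)
      have "(1 + x (s0 + u))\<^sup>2 \<le> 2\<^sup>2" using x_bound[OF True] by (intro power_mono) auto
      then have "\<bar>f n z\<bar> \<le> \<alpha> * exp (- \<alpha> * (s0 + u)) * 4 * (1 - (x (s0 + u))\<^sup>2) ^ Suc n"
        unfolding f_def N_def[symmetric] u_def[symmetric] using True y assms(1)
        by (simp add: abs_mult del: power_Suc) (intro mult_right_mono mult_left_mono, auto)
      also have "\<dots> \<le> \<alpha> * exp (- \<alpha> * (s0 + u)) * 4 * exp (- (N * (c ^ 2 * (min u 1) ^ 2)))"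
      proof (rule mult_left_mono)
        have "(1 - (x (s0 + u))\<^sup>2) ^ Suc n \<le> exp (- (N * (x (s0 + u))\<^sup>2))"
          unfolding N_def by (rule one_minus_power_le_exp[OF y(2)])
        also have "\<dots> \<le> exp (- (N * (c ^ 2 * (min u 1) ^ 2)))"
          using x_lower[of u] N by simp
        finally show "(1 - (x (s0 + u))\<^sup>2) ^ Suc n \<le> exp (- (N * (c ^ 2 * (min u 1) ^ 2)))" .
      qed (use assms in auto)
      also have "\<dots> \<le> K / (1 + z\<^sup>2)"
      proof (cases "u \<le> 1")
        case True': True
        then have m: "N * (c ^ 2 * (min u 1) ^ 2) = c\<^sup>2 * z\<^sup>2" by (simp add: z)
        have "exp (- (c\<^sup>2 * z\<^sup>2)) \<le> 1 / (1 + c\<^sup>2 * z\<^sup>2)" by (rule exp_minus_le) simp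
        also have "\<dots> \<le> (1 + 1 / c\<^sup>2) / (1 + z\<^sup>2)"
        proof -
          have "1 + z\<^sup>2 \<le> (1 + 1 / c\<^sup>2) * (1 + c\<^sup>2 * z\<^sup>2)" using pos by (simp add: algebra_simps)
          then show ?thesis by (simp add: divide_simps add_pos_nonneg mult.commute)
        qed
        finally have e: "exp (- (c\<^sup>2 * z\<^sup>2)) \<le> (1 + 1 / c\<^sup>2) / (1 + z\<^sup>2)" .
        have "\<alpha> * exp (- \<alpha> * (s0 + u)) * 4 * exp (- (c\<^sup>2 * z\<^sup>2)) \<le> \<alpha> * 1 * 4 * ((1 + 1 / c\<^sup>2) / (1 + z\<^sup>2))"
          using assms True e by (intro mult_mono) auto
        also have "\<dots> = 4 * \<alpha> * (1 + 1 / c\<^sup>2) / (1 + z\<^sup>2)" by simp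
        also have "\<dots> \<le> K / (1 + z\<^sup>2)"
          unfolding K_def using assms by (intro divide_right_mono) auto
        finally show ?thesis unfolding m .
      next
        \<comment> \<open>Here the bound on the power no longer improves with \<open>u\<close>; the
          missing decay comes from the density of the freezing time. The bounds
          \<open>2 / (\<alpha> * u)\<^sup>2\<close> and \<open>1 / (N * c\<^sup>2)\<close> multiply
          to a constant over \<open>z\<^sup>2 = N * u\<^sup>2\<close>.\<close>
        case False
        then have u: "u > 1" by simp
        then have "u\<^sup>2 \<ge> 1" by simp
        then have z1: "z\<^sup>2 \<ge> 1" unfolding z using mult_mono[of 1 N 1 "u\<^sup>2"] N by simp
        have "exp (- \<alpha> * (s0 + u)) \<le> exp (- (\<alpha> * u))" using s0 assms by (simp add: algebra_simps)
        also have "\<dots> \<le> 2 / (\<alpha> * u)\<^sup>2" using u assms by (intro exp_minus_le_sq) simp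
        finally have e1: "exp (- \<alpha> * (s0 + u)) \<le> 2 / (\<alpha> * u)\<^sup>2" .
        have "exp (- (N * c\<^sup>2)) \<le> 1 / (1 + N * c\<^sup>2)" using N by (intro exp_minus_le) simp
        also have "\<dots> \<le> 1 / (N * c\<^sup>2)" using N pos by (intro divide_left_mono) (auto intro!: mult_pos_pos add_pos_pos)
        finally have e2: "exp (- (N * c\<^sup>2)) \<le> 1 / (N * c\<^sup>2)" .
        have "\<alpha> * exp (- \<alpha> * (s0 + u)) * 4 * exp (- (N * c\<^sup>2)) \<le> \<alpha> * (2 / (\<alpha> * u)\<^sup>2) * 4 * (1 / (N * c\<^sup>2))"
          using assms N pos e1 e2 by (intro mult_mono mult_nonneg_nonneg) auto
        also have "\<dots> = 8 * \<alpha> / (c\<^sup>2 * \<alpha>\<^sup>2) * (1 / z\<^sup>2)"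
          using assms N pos u by (simp add: z power_mult_distrib field_simps)
        also have "\<dots> \<le> 8 * \<alpha> / (c\<^sup>2 * \<alpha>\<^sup>2) * (2 / (1 + z\<^sup>2))"
        proof (rule mult_left_mono)
          show "1 / z\<^sup>2 \<le> 2 / (1 + z\<^sup>2)" using z1 by (auto simp: divide_simps)
        qed (use assms in auto)
        also have "\<dots> = 16 * \<alpha> / (c\<^sup>2 * \<alpha>\<^sup>2) / (1 + z\<^sup>2)" by simp
        also have "\<dots> \<le> K / (1 + z\<^sup>2)"
          unfolding K_def using assms by (intro divide_right_mono) auto
        finally show ?thesis using u by simp
      qed
      finally show ?thesis .
    next
      case False
      moreover have "K \<ge> 0" using assms by (simp add: K_def)
      ultimately show ?thesis unfolding f_def N_def[symmetric] u_def[symmetric] by simp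
    qed
  qed
  have lim: "(\<lambda>n. f n z) \<longlonglongrightarrow> g z" for z
  proof -
    define v where "v n = 1 / sqrt (real (Suc n)) * z" for n
    have v: "v \<longlonglongrightarrow> 0" unfolding v_def by real_asymp
    have "(\<lambda>n. s0 + v n) \<longlonglongrightarrow> s0 + 0" by (intro tendsto_intros v)
    then have ev: "\<forall>\<^sub>F n in sequentially. s0 + v n > 0" using s0 by (intro order_tendstoD) auto
    have "(\<lambda>n. x (s0 + v n)) \<longlonglongrightarrow> A * (exp (- \<beta> * 0) - 1)"
      unfolding x_shift by (intro tendsto_intros v)
    then have x: "(\<lambda>n. x (s0 + v n)) \<longlonglongrightarrow> 0" by simp
    have "(\<lambda>n. (1 - (A * (exp (- \<beta> * v n) - 1))\<^sup>2) ^ Suc n) \<longlonglongrightarrow> exp (- (A * \<beta> * z)\<^sup>2)"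
    proof -
      consider "z = 0" | "z > 0" | "z < 0" by linarith
      then show ?thesis
      proof cases
        case 1
        then show ?thesis by (simp add: v_def)
      next
        case 2
        with pos show ?thesis unfolding v_def by real_asymp
      next
        case 3
        with pos have "(\<lambda>n. (1 - (A * (exp (- \<beta> * v n) - 1))\<^sup>2) ^ Suc n) \<longlonglongrightarrow> exp (- (A * (\<beta> * z))\<^sup>2)"
          unfolding v_def by real_asymp
        then show ?thesis by (simp add: mult.assoc)
      qed
    qed
    then have "(\<lambda>n. (1 - (x (s0 + v n))\<^sup>2) ^ Suc n) \<longlonglongrightarrow> exp (- (A * \<beta> * z)\<^sup>2)"
      by (simp only: x_shift)
    then have "(\<lambda>n. \<alpha> * exp (- \<alpha> * (s0 + v n)) * (1 + x (s0 + v n))\<^sup>2 * (1 - (x (s0 + v n))\<^sup>2) ^ Suc n)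
        \<longlonglongrightarrow> \<alpha> * exp (- \<alpha> * (s0 + 0)) * (1 + 0)\<^sup>2 * exp (- (A * \<beta> * z)\<^sup>2)"
      by (intro tendsto_mult tendsto_power tendsto_add tendsto_const tendsto_exp x v)
    then have "(\<lambda>n. \<alpha> * exp (- \<alpha> * (s0 + v n)) * (1 + x (s0 + v n))\<^sup>2 * (1 - (x (s0 + v n))\<^sup>2) ^ Suc n) \<longlonglongrightarrow> g z"
      by (simp add: g_def)
    then show ?thesis
    proof (rule Lim_transform_eventually)
      show "\<forall>\<^sub>F n in sequentially. \<alpha> * exp (- \<alpha> * (s0 + v n)) * (1 + x (s0 + v n))\<^sup>2 * (1 - (x (s0 + v n))\<^sup>2) ^ Suc n = f n z"
        using ev by eventually_elim (simp add: f_def v_def)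
    qed
  qed
  have [measurable]: "x \<in> borel_measurable borel" unfolding x_def[abs_def] by measurable
  have meas: "f n \<in> borel_measurable lborel" "g \<in> borel_measurable lborel" for n
    unfolding f_def[abs_def] g_def[abs_def] by measurable
  have g_pos: "g z > 0" for z using assms by (simp add: g_def)
  note conv = dominated_tendsto_pos[of f g K, OF meas lim bound g_pos]
  have "sqrt (real (Suc n)) * (4 ^ Suc (Suc n) * shape_integral \<alpha> 0 (Suc n) (Suc n + 2)) = integral\<^sup>L lborel (f n)" for n
  proof -
    have "4 ^ Suc (Suc n) * shape_integral \<alpha> 0 (Suc n) (Suc n + 2) = 1 / sqrt (real (Suc n)) * integral\<^sup>L lborel (f n)"
      unfolding f_def x_def by (rule shape_integral_rescale) simp
    then show ?thesis by simp
  qed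
  with conv have "(\<lambda>n. sqrt (real (Suc n)) * (4 ^ Suc (Suc n) * shape_integral \<alpha> 0 (Suc n) (Suc n + 2))) \<longlonglongrightarrow> integral\<^sup>L lborel g"
    by simp
  then have "(\<lambda>n. sqrt (real n) * (4 ^ Suc n * shape_integral \<alpha> 0 n (n + 2))) \<longlonglongrightarrow> integral\<^sup>L lborel g"
    by (rule LIMSEQ_imp_Suc)
  with conv(2) that show thesis by blast
qed

text \<open>Since \<open>x s = exp (- 2 * s)\<close>, the power of \<open>1 - (x s)\<^sup>2\<close>
  switches from 0 to 1 around \<open>s = ln n / 4\<close>, in a window of constant width. Time is
  therefore shifted by \<open>s0 n\<close> instead of rescaled, a Gumbel-type profile appears, and
  \<open>exp (- s0 n)\<close> gives the power \<open>- 1 / 4\<close>.\<close>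

lemma critical_integral_asymp:
  obtains C where "C > 0" "(\<lambda>n. real n powr (1 / 4) * (4 ^ Suc n * shape_integral 1 0 n (n + 2))) \<longlonglongrightarrow> C"
proof -
  define x where "x s = 1 - 2 * join_prob 1 s" for s
  have x_eq: "x s = exp (- 2 * s)" for s by (simp add: x_def join_prob_def keep_prob_def diff_divide_distrib)
  define s0 where "s0 n = ln (real (Suc n)) / 4" for n
  have e_s0: "exp (- s0 n) = real (Suc n) powr (- 1 / 4)" for n
    by (simp add: s0_def powr_def del: of_nat_Suc)
  have x2: "(x (s0 n + z))\<^sup>2 = exp (- 4 * z) / real (Suc n)" for n z
  proof -
    have "(x (s0 n + z))\<^sup>2 = exp (- 4 * z - ln (real (Suc n)))"
      by (simp add: x_eq power2_eq_square exp_add[symmetric] s0_def algebra_simps del: of_nat_Suc)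
    then show ?thesis by (simp add: exp_diff del: of_nat_Suc)
  qed
  define f where "f n z = indicator {0..} (s0 n + z) *
    (exp (- z) * (1 + x (s0 n + z))\<^sup>2 * (1 - exp (- 4 * z) / real (Suc n)) ^ Suc n)" for n and z :: real
  define g where "g z = exp (- z) * exp (- exp (- 4 * z))" for z :: real
  have bound: "\<bar>f n z\<bar> \<le> 8 / (1 + z\<^sup>2)" for n z
  proof (cases "s0 n + z \<ge> 0")
    case True
    then have x: "0 \<le> x (s0 n + z)" "x (s0 n + z) \<le> 1" by (auto simp: x_eq)
    then have y: "exp (- 4 * z) / real (Suc n) \<le> 1" unfolding x2[symmetric] by (simp add: power_le_one)
    have "(1 + x (s0 n + z))\<^sup>2 \<le> 2\<^sup>2" using x by (intro power_mono) auto
    then have "\<bar>f n z\<bar> \<le> exp (- z) * 4 * (1 - exp (- 4 * z) / real (Suc n)) ^ Suc n"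
      unfolding f_def using True y
      by (simp add: abs_mult del: power_Suc of_nat_Suc) (intro mult_right_mono mult_left_mono, auto)
    also have "\<dots> \<le> exp (- z) * 4 * exp (- exp (- 4 * z))"
      using one_minus_power_le_exp[OF y, of "Suc n"] by (intro mult_left_mono) (auto simp del: power_Suc of_nat_Suc)
    also have "\<dots> \<le> exp (- z) * 4 * (1 / (1 + exp (- 4 * z)))"
      by (intro mult_left_mono exp_minus_le) auto
    \<comment> \<open>For negative \<open>z\<close> the growth of \<open>exp (- z)\<close> is
      outweighed by the switching factor, already in the weakened form
      \<open>1 / (1 + exp (- 4 * z))\<close>.\<close>
    also have "\<dots> \<le> 4 * exp (- \<bar>z\<bar>)"
    proof (cases "z \<ge> 0")
      case True
      have "1 / (1 + exp (- 4 * z)) \<le> 1" by (simp add: divide_le_eq_1 add_pos_pos)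
      then have "exp (- z) * 4 * (1 / (1 + exp (- 4 * z))) \<le> exp (- z) * 4 * 1" by (intro mult_left_mono) auto
      then show ?thesis using True by simp
    next
      case False
      have "exp (- z) \<le> exp (z + - 4 * z)" using False by simp
      also have "\<dots> = exp z * exp (- 4 * z)" by (rule exp_add)
      also have "\<dots> \<le> exp z * (1 + exp (- 4 * z))" by (intro mult_left_mono) auto
      finally have "exp (- z) * 1 \<le> exp z * (1 + exp (- 4 * z))" by simp
      then show ?thesis using False by (simp add: divide_le_eq add_pos_pos mult.commute)
    qed
    also have "4 * exp (- \<bar>z\<bar>) \<le> 8 / (1 + z\<^sup>2)"
    proof -
      have "1 + z\<^sup>2 \<le> 2 * exp \<bar>z\<bar>" using exp_lower_Taylor_quadratic[of "\<bar>z\<bar>"] by simp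
      then show ?thesis by (simp add: exp_minus divide_simps add_pos_nonneg)
    qed
    finally show ?thesis .
  next
    case False
    then show ?thesis by (simp add: f_def)
  qed
  have lim: "(\<lambda>n. f n z) \<longlonglongrightarrow> g z" for z
  proof -
    have ev: "\<forall>\<^sub>F n in sequentially. s0 n + z \<ge> 0" unfolding s0_def by real_asymp
    have x: "(\<lambda>n. x (s0 n + z)) \<longlonglongrightarrow> 0" unfolding x_eq s0_def by real_asymp
    have "(\<lambda>n. (1 - exp (- 4 * z) / real (Suc n)) ^ Suc n) \<longlonglongrightarrow> exp (- exp (- 4 * z))"
      using LIMSEQ_Suc[OF tendsto_exp_limit_sequentially[of "- exp (- 4 * z)"]] by simp
    then have "(\<lambda>n. exp (- z) * (1 + x (s0 n + z))\<^sup>2 * (1 - exp (- 4 * z) / real (Suc n)) ^ Suc n)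
        \<longlonglongrightarrow> exp (- z) * (1 + 0)\<^sup>2 * exp (- exp (- 4 * z))"
      by (intro tendsto_intros x)
    then have "(\<lambda>n. exp (- z) * (1 + x (s0 n + z))\<^sup>2 * (1 - exp (- 4 * z) / real (Suc n)) ^ Suc n) \<longlonglongrightarrow> g z"
      by (simp add: g_def)
    then show ?thesis
      by (rule Lim_transform_eventually) (use ev in eventually_elim, simp add: f_def)
  qed
  have [measurable]: "x \<in> borel_measurable borel" unfolding x_def[abs_def] by measurable
  have meas: "f n \<in> borel_measurable lborel" "g \<in> borel_measurable lborel" for n
    unfolding f_def[abs_def] g_def[abs_def] by measurable
  have g_pos: "g z > 0" for z by (simp add: g_def)
  note conv = dominated_tendsto_pos[of f g 8, OF meas lim bound g_pos]
  have "real (Suc n) powr (1 / 4) * (4 ^ Suc (Suc n) * shape_integral 1 0 (Suc n) (Suc n + 2)) = integral\<^sup>L lborel (f n)" for n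
  proof -
    have "4 ^ Suc (Suc n) * shape_integral 1 0 (Suc n) (Suc n + 2) = 1 * (LINT z|lborel. indicator {0..} (s0 n + 1 * z) *
    (1 * exp (- 1 * (s0 n + 1 * z)) * (1 + x (s0 n + 1 * z))\<^sup>2 * (1 - (x (s0 n + 1 * z))\<^sup>2) ^ Suc n))"
      unfolding x_def by (rule shape_integral_rescale) simp
    also have "\<dots> = (LINT z|lborel. exp (- s0 n) * f n z)"
      unfolding x2 mult_1 by (intro arg_cong[of _ _ "integral\<^sup>L lborel"] ext) (simp add: f_def x2 exp_add[symmetric] mult_ac)
    also have "\<dots> = real (Suc n) powr (- 1 / 4) * integral\<^sup>L lborel (f n)" by (simp add: e_s0)
    finally show ?thesis by (simp add: powr_add[symmetric] mult.assoc[symmetric] del: power_Suc of_nat_Suc)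
  qed
  with conv have "(\<lambda>n. real (Suc n) powr (1 / 4) * (4 ^ Suc (Suc n) * shape_integral 1 0 (Suc n) (Suc n + 2))) \<longlonglongrightarrow> integral\<^sup>L lborel g"
    by simp
  then have "(\<lambda>n. real n powr (1 / 4) * (4 ^ Suc n * shape_integral 1 0 n (n + 2))) \<longlonglongrightarrow> integral\<^sup>L lborel g"
    by (rule LIMSEQ_imp_Suc)
  with conv(2) that show thesis by blast
qed

lemma shape_integral_0:
  assumes "\<alpha> > 0"
  shows "shape_integral \<alpha> 0 0 0 = 1"
proof -
  have "integral {0..t} (\<lambda>s. \<alpha> * exp (- (\<alpha> + 0) * s) * shape_density \<alpha> 0 0 s) = 1 - exp (- \<alpha> * t)" if "t \<ge> 0" for t
  proof -
    have "((\<lambda>s. \<alpha> * exp (- \<alpha> * s)) has_integral (- exp (- \<alpha> * t)) - (- exp (- \<alpha> * 0))) {0..t}"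
      using that by (intro fundamental_theorem_of_calculus)
        (auto intro!: derivative_eq_intros simp: has_real_derivative_iff_has_vector_derivative[symmetric])
    then have "integral {0..t} (\<lambda>s. \<alpha> * exp (- \<alpha> * s)) = (- exp (- \<alpha> * t)) - (- exp (- \<alpha> * 0))"
      by (rule integral_unique)
    then show ?thesis by (simp only: shape_density_def power_0 mult_1_right add_0_right) simp
  qed
  then have "\<forall>\<^sub>F t in at_top. integral {0..t} (\<lambda>s. \<alpha> * exp (- (\<alpha> + 0) * s) * shape_density \<alpha> 0 0 s) = 1 - exp (- \<alpha> * t)"
    using eventually_ge_at_top[of 0] by (rule eventually_mono[rotated])
  then have "((\<lambda>t. 1 - exp (- \<alpha> * t)) \<longlongrightarrow> shape_integral \<alpha> 0 0 0) at_top"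
    by (rule Lim_transform_eventually[OF shape_integral_tendsto[OF assms order_refl]])
  moreover have "((\<lambda>t. 1 - exp (- \<alpha> * t)) \<longlongrightarrow> 1) at_top" using assms by real_asymp
  ultimately show ?thesis using tendsto_unique[OF trivial_limit_at_top_linorder] by blast
qed

text \<open>\<open>join_prob\<close> stays below 1 / (1 + \<alpha>) < 1/2, and
  \<open>p * (1 - p)\<close> increases on that range; \<open>q\<close> is its value at the
  endpoint.\<close>

lemma subcritical_integral_bound:
  assumes "\<alpha> > 1"
  obtains q where "0 < q" "4 * q < 1" "\<And>n. shape_integral \<alpha> 0 n (n + 2) \<le> q ^ n"
proof
  define p where "p = 1 / (1 + \<alpha>)"
  have p: "0 < p" "p < 1 / 2" using assms by (auto simp: p_def field_simps)
  show "0 < p * (1 - p)" using p by simp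
  have "(1 - 2 * p)\<^sup>2 > 0" using p by simp
  then show "4 * (p * (1 - p)) < 1" by (simp add: power2_eq_square algebra_simps)
  fix n
  let ?q = "p * (1 - p)"
  have le: "shape_density \<alpha> n (n + 2) s \<le> ?q ^ n" if "s \<ge> 0" for s
  proof -
    define j where "j = join_prob \<alpha> s"
    have j: "0 \<le> j" "j \<le> p" using join_prob_bounds[of \<alpha> s] that assms by (auto simp: j_def p_def)
    \<comment> \<open>The product equals \<open>p * (1 - p) - j * (1 - j)\<close>.\<close>
    have "(p - j) * (1 - p - j) \<ge> 0" using j p by (intro mult_nonneg_nonneg) auto
    then have "j * (1 - j) \<le> ?q" by (simp add: algebra_simps)
    then have "(j * (1 - j)) ^ n \<le> ?q ^ n" using j p by (intro power_mono) auto
    moreover have "(1 - j)\<^sup>2 \<le> 1" using j p by (intro power_le_one) auto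
    ultimately have "(j * (1 - j)) ^ n * (1 - j)\<^sup>2 \<le> ?q ^ n * 1"
      using p by (intro mult_mono) auto
    then show ?thesis by (simp add: shape_density_def j_def power_mult_distrib power_add power2_eq_square mult_ac)
  qed
  have \<alpha>: "\<alpha> > 0" using assms by simp
  have int1: "(LINT s:{0..}|lborel. \<alpha> * exp (- \<alpha> * s)) = 1"
    using shape_integral_0[OF \<alpha>] by (simp add: shape_integral_def shape_density_def)
  have "shape_integral \<alpha> 0 n (n + 2) \<le> (LINT s:{0..}|lborel. ?q ^ n * (\<alpha> * exp (- \<alpha> * s)))"
    unfolding shape_integral_def
  proof (rule set_integral_mono)
    show "set_integrable lborel {0..} (\<lambda>s. \<alpha> * exp (- (\<alpha> + 0) * s) * shape_density \<alpha> n (n + 2) s)"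
      by (rule shape_integrable[OF \<alpha>]) simp
    have "set_integrable lborel {0..} (\<lambda>s. exp (- \<alpha> * s) * (?q ^ n * \<alpha>))"
      by (rule set_integrable_exp_mult[OF \<alpha>, where B = "?q ^ n * \<alpha>"]) (use p \<alpha> in auto)
    then show "set_integrable lborel {0..} (\<lambda>s. ?q ^ n * (\<alpha> * exp (- \<alpha> * s)))" by (simp add: mult_ac)
    show "\<alpha> * exp (- (\<alpha> + 0) * s) * shape_density \<alpha> n (n + 2) s \<le> ?q ^ n * (\<alpha> * exp (- \<alpha> * s))" if "s \<in> {0..}" for s
      using mult_left_mono[OF le, of s "\<alpha> * exp (- \<alpha> * s)"] that \<alpha> by (simp add: mult_ac)
  qed
  also have "\<dots> = ?q ^ n" using int1 by simp
  finally show "shape_integral \<alpha> 0 n (n + 2) \<le> ?q ^ n" .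
qed

subsection \<open>The law of the root cluster\<close>

lemma apex_reach:
  assumes "\<not> linked x b"
  shows "{w. apex x w = b} = reach x b"
proof (intro subset_antisym subsetI)
  fix w assume "w \<in> {w. apex x w = b}"
  then show "w \<in> reach x b"
  proof (induction w)
    case (Cons c w)
    then show ?case by (cases "linked x (c # w)") (auto intro: reach.intros)
  qed (auto intro: reach.intros)
next
  fix w assume "w \<in> reach x b"
  then show "w \<in> {w. apex x w = b}" by induction (use assms in auto)
qed

lemma cluster_eq_reach:
  assumes "config_on binary_tree x"
  shows "cluster x v = reach x (apex x v)"
proof -
  have "cluster x v = {w. apex x w = apex x v}"
    unfolding cluster_def
    using assms by (intro component_eq_apex) (auto simp: config_on_def binary_tree_eq tree_on_def)
  then show ?thesis by (simp add: apex_reach)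
qed

lemma matches_restrict:
  "A \<subseteq> Q \<Longrightarrow> N \<subseteq> Q \<Longrightarrow> matches A N (restrict_config (tree_on Q) x) \<longleftrightarrow> matches A N x"
  by (auto simp: matches_def op_restrict)

definition pair_height :: "shape \<times> shape \<Rightarrow> nat" where
  "pair_height q = Suc (max (height (fst q)) (height (snd q)))"

lemma pair_in_ball:
  assumes "length a + pair_height q \<le> n"
  shows "pair_joined a q \<subseteq> ball_at n" "pair_stopped a q \<subseteq> ball_at n"
proof -
  have "length w \<le> n" if "w \<in> pair_joined a q \<union> pair_stopped a q" for w
    using length_pair[OF that] assms by (simp add: pair_height_def)
  then show "pair_joined a q \<subseteq> ball_at n" "pair_stopped a q \<subseteq> ball_at n" by (auto simp: ball_at_def)
qed

definition pair_integral :: "real \<Rightarrow> real \<Rightarrow> shape \<times> shape \<Rightarrow> real" where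
  "pair_integral \<alpha> \<kappa> q =
     shape_integral \<alpha> \<kappa> (num_joined (fst q) + num_joined (snd q)) (num_stopped (fst q) + num_stopped (snd q))"

lemma pair_prob:
  assumes \<alpha>: "\<alpha> > 0" and inf: "infinite_volume_pcf \<alpha> binary_tree M \<eta>"
  shows "{\<omega>\<in>space M. has_pair (\<eta> \<infinity> \<omega>) a q} \<in> sets M"
    and "measure M {\<omega>\<in>space M. has_pair (\<eta> \<infinity> \<omega>) a q} = pair_integral \<alpha> 0 q"
proof -
  define n where "n = length a + pair_height q"
  let ?R = "restrict_config (tree_on (ball_at n))"
  interpret tree_pcf \<alpha> "ball_at n" by (rule tree_pcf_ball[OF \<alpha>])
  note b = pair_in_ball[of a q n, unfolded n_def, OF order_refl, folded n_def]
  have eq: "{\<omega>\<in>space M. has_pair (\<eta> \<infinity> \<omega>) a q} = {\<omega>\<in>space M. ?R (\<eta> \<infinity> \<omega>) \<in> {y. has_pair y a q}}"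
    by (simp add: has_pair_iff matches_restrict b)
  note * = infinite_volume_restrict_prob[OF \<alpha> inf, of n "{y. has_pair y a q}"]
  show "{\<omega>\<in>space M. has_pair (\<eta> \<infinity> \<omega>) a q} \<in> sets M" unfolding eq by (rule *)
  have "fin (\<lambda>x. of_bool (has_pair x a q)) initial_config = pair_integral \<alpha> 0 q"
    using final_shape[OF _ b frame_pair]
    by (simp add: has_pair_iff pair_integral_def card_pair ball_at_def n_def)
  then show "measure M {\<omega>\<in>space M. has_pair (\<eta> \<infinity> \<omega>) a q} = pair_integral \<alpha> 0 q"
    unfolding eq *(2) by simp
qed

lemma whole_pair_unique:
  assumes "whole (fst q)" "whole (snd q)" "whole (fst q')" "whole (snd q')" "has_pair x a q" "has_pair x a q'"
  shows "q = q'"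
  using assms whole_shape_unique[of "fst q" "fst q'" x "False # a"] whole_shape_unique[of "snd q" "snd q'" x "True # a"]
  by (simp add: has_pair_def prod_eq_iff)

lemma sized_pairs_whole: "q \<in> sized_pairs k \<Longrightarrow> whole (fst q) \<and> whole (snd q)"
  by (auto simp: sized_pairs_def)

lemma shape_integral_nonneg:
  assumes "\<alpha> > 0"
  shows "shape_integral \<alpha> \<kappa> i j \<ge> 0"
  unfolding shape_integral_def set_lebesgue_integral_def using assms shape_density_bounds(1)[OF assms]
  by (intro integral_nonneg_AE AE_I2) (auto simp: indicator_def)

text \<open>A root cluster of size \<open>k + 1\<close> has \<open>k\<close> open links and
  \<open>k + 2\<close> closed ones, as each of the two branches has one more closed than open. All
  these shapes are exclusive and equally likely, so only their number enters.\<close>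

lemma cluster_size_prob_eq:
  assumes \<alpha>: "\<alpha> > 0" and inf: "infinite_volume_pcf \<alpha> binary_tree M \<eta>"
  shows "cluster_size_prob M \<eta> [] (Suc k) = catalan (Suc k) * shape_integral \<alpha> 0 k (k + 2)"
    and "cluster_size_prob M \<eta> [] 0 = 0"
proof -
  interpret prob_space M using inf by (simp add: infinite_volume_pcf_def)
  have conf: "config_on binary_tree (\<eta> \<infinity> \<omega>)" if "\<omega> \<in> space M" for \<omega>
    using inf that by (simp add: infinite_volume_pcf_def)
  have cl: "cluster (\<eta> \<infinity> \<omega>) [] = reach (\<eta> \<infinity> \<omega>) []" if "\<omega> \<in> space M" for \<omega>
    using cluster_eq_reach[OF conf[OF that], of "[]"] by simp
  have "{\<omega>\<in>space M. finite (cluster (\<eta> \<infinity> \<omega>) []) \<and> card (cluster (\<eta> \<infinity> \<omega>) []) = Suc k}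
     = (\<Union>q\<in>sized_pairs k. {\<omega>\<in>space M. has_pair (\<eta> \<infinity> \<omega>) [] q})"
  proof -
    have "{\<omega>\<in>space M. finite (cluster (\<eta> \<infinity> \<omega>) []) \<and> card (cluster (\<eta> \<infinity> \<omega>) []) = Suc k}
      = {\<omega>\<in>space M. finite (reach (\<eta> \<infinity> \<omega>) []) \<and> card (reach (\<eta> \<infinity> \<omega>) []) = Suc k}"
      using cl by (intro Collect_cong) (simp cong: conj_cong)
    then show ?thesis unfolding reach_size_iff by blast
  qed
  moreover have "prob (\<Union>q\<in>sized_pairs k. {\<omega>\<in>space M. has_pair (\<eta> \<infinity> \<omega>) [] q})
     = (\<Sum>q\<in>sized_pairs k. prob {\<omega>\<in>space M. has_pair (\<eta> \<infinity> \<omega>) [] q})"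
  proof (intro finite_measure_finite_Union finite_sized_pairs)
    show "(\<lambda>q. {\<omega>\<in>space M. has_pair (\<eta> \<infinity> \<omega>) [] q}) ` sized_pairs k \<subseteq> events"
      using pair_prob(1)[OF \<alpha> inf] by auto
    show "disjoint_family_on (\<lambda>q. {\<omega>\<in>space M. has_pair (\<eta> \<infinity> \<omega>) [] q}) (sized_pairs k)"
      unfolding disjoint_family_on_def using whole_pair_unique by (blast dest: sized_pairs_whole)
  qed
  moreover have "prob {\<omega>\<in>space M. has_pair (\<eta> \<infinity> \<omega>) [] q} = shape_integral \<alpha> 0 k (k + 2)"
    if "q \<in> sized_pairs k" for q
  proof -
    have "num_joined (fst q) + num_joined (snd q) = k" "num_stopped (fst q) + num_stopped (snd q) = k + 2"
      using that by (auto simp: sized_pairs_def num_stopped_whole)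
    then show ?thesis unfolding pair_prob(2)[OF \<alpha> inf] pair_integral_def by simp
  qed
  ultimately show "cluster_size_prob M \<eta> [] (Suc k) = catalan (Suc k) * shape_integral \<alpha> 0 k (k + 2)"
    by (simp add: cluster_size_prob_def card_sized_pairs)
  have "{\<omega>\<in>space M. finite (cluster (\<eta> \<infinity> \<omega>) []) \<and> card (cluster (\<eta> \<infinity> \<omega>) []) = 0} = {}"
  proof -
    have "card (reach x []) = Suc (card (reach x []) - 1)" if "finite (reach x [])" for x
      using card_reach(1)[OF that] by simp
    then show ?thesis using cl by (metis (mono_tags, lifting) Collect_empty_eq nat.distinct(1))
  qed
  then show "cluster_size_prob M \<eta> [] 0 = 0" by (simp only: cluster_size_prob_def measure_empty)
qed

text \<open>Stated for every \<open>f\<close> with these values instead of the cluster law, so that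
  \<open>D\<close> is fixed before the process is. The exponent adds the 3/2 of the Catalan numbers
  and the \<gamma> of the integral.\<close>

lemma cluster_size_asymp:
  assumes lim: "(\<lambda>n. real n powr \<gamma> * (4 ^ Suc n * shape_integral \<alpha> 0 n (n + 2))) \<longlonglongrightarrow> C" and C: "C > 0"
  obtains D where "D > 0" "\<And>f. f 0 = 0 \<Longrightarrow> (\<And>k. f (Suc k) = catalan (Suc k) * shape_integral \<alpha> 0 k (k + 2)) \<Longrightarrow>
    f \<sim>[at_top] (\<lambda>k. D * real k powr (- (3 / 2 + \<gamma>)))"
proof -
  obtain d where d: "d > 0" "(\<lambda>k. real (catalan k) / (4 ^ k * real k powr (- 3 / 2))) \<longlonglongrightarrow> d"
    by (rule catalan_recurrence_asymp[OF catalan_0 catalan_Suc])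
  show thesis
  proof (rule that)
    show "d * C > 0" using d C by simp
    fix f :: "nat \<Rightarrow> real" assume f: "\<And>k. f (Suc k) = catalan (Suc k) * shape_integral \<alpha> 0 k (k + 2)"
    \<comment> \<open>The indices of Catalan number and integral differ by one; this ratio corrects
      the mismatch of powers.\<close>
    have "(\<lambda>k. (real (Suc k) / real k) powr \<gamma>) \<longlonglongrightarrow> 1 powr \<gamma>"
      by (intro tendsto_powr tendsto_const) (real_asymp, simp)
    then have r: "(\<lambda>k. (real (Suc k) / real k) powr \<gamma>) \<longlonglongrightarrow> 1" by simp
    have "(\<lambda>k. (real (catalan (Suc k)) / (4 ^ Suc k * real (Suc k) powr (- 3 / 2)))
        * (real k powr \<gamma> * (4 ^ Suc k * shape_integral \<alpha> 0 k (k + 2))) * (real (Suc k) / real k) powr \<gamma> / (d * C)) \<longlonglongrightarrow> d * C * 1 / (d * C)"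
      using d C by (intro tendsto_mult tendsto_divide tendsto_const LIMSEQ_Suc[OF d(2)] lim r) auto
    then have "(\<lambda>k. f (Suc k) / (d * C * real (Suc k) powr (- (3 / 2 + \<gamma>)))) \<longlonglongrightarrow> d * C * 1 / (d * C)"
    proof (rule Lim_transform_eventually)
      show "\<forall>\<^sub>F k in sequentially. (real (catalan (Suc k)) / (4 ^ Suc k * real (Suc k) powr (- 3 / 2)))
        * (real k powr \<gamma> * (4 ^ Suc k * shape_integral \<alpha> 0 k (k + 2))) * (real (Suc k) / real k) powr \<gamma> / (d * C)
        = f (Suc k) / (d * C * real (Suc k) powr (- (3 / 2 + \<gamma>)))"
        using eventually_gt_at_top[of 0]
      proof eventually_elim
        case (elim k)
        have e: "real k powr \<gamma> * (real (Suc k) / real k) powr \<gamma> = real (Suc k) powr \<gamma>"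
          using elim by (simp add: powr_mult[symmetric] del: of_nat_Suc)
        have "real (Suc k) powr (- 3 / 2) = real (Suc k) powr (- (3 / 2 + \<gamma>)) * real (Suc k) powr \<gamma>"
          by (simp add: powr_add[symmetric] del: of_nat_Suc)
        moreover have "real (Suc k) powr \<gamma> > 0" "real (Suc k) powr (- (3 / 2 + \<gamma>)) > 0" by simp_all
        moreover have "(c / (p * (y * z))) * (kg * (p * s)) * rg / dc = c * s / (dc * y)"
          if "kg * rg = z" "z > 0" "y > 0" "p > 0" "dc > 0" for c p y z kg s rg dc :: real
          using that by (simp add: field_simps)
        ultimately show ?case
          unfolding f using e d(1) C by (simp del: of_nat_Suc power_Suc)
      qed
    qed
    then have "(\<lambda>k. f (Suc k) / (d * C * real (Suc k) powr (- (3 / 2 + \<gamma>)))) \<longlonglongrightarrow> 1" using d C by simp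
    then have "(\<lambda>k. f k / (d * C * real k powr (- (3 / 2 + \<gamma>)))) \<longlonglongrightarrow> 1" by (rule LIMSEQ_imp_Suc)
    then show "f \<sim>[at_top] (\<lambda>k. d * C * real k powr (- (3 / 2 + \<gamma>)))"
      by (rule asymp_equivI')
  qed
qed

text \<open>A bound \<open>B * 4 ^ k\<close> for the Catalan numbers leaves
  \<open>B * 4 ^ k * q ^ (k - 1)\<close>, hence the constant \<open>B / q\<close> and the rate
  \<open>- ln (4 * q)\<close>. Again the constants precede \<open>f\<close>.\<close>

lemma cluster_size_exp_bound:
  assumes "\<alpha> > 1"
  obtains K l where "K > 0" "l > 0" "\<And>f k. f 0 = 0 \<Longrightarrow> (\<And>k. f (Suc k) = catalan (Suc k) * shape_integral \<alpha> 0 k (k + 2)) \<Longrightarrow>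
    f k \<le> K * exp (- l * real k)"
proof -
  obtain d where d: "d > 0" "(\<lambda>k. real (catalan k) / (4 ^ k * real k powr (- 3 / 2))) \<longlonglongrightarrow> d"
    by (rule catalan_recurrence_asymp[OF catalan_0 catalan_Suc])
  have "Bseq (\<lambda>k. real (catalan k) / (4 ^ k * real k powr (- 3 / 2)))"
    by (rule convergent_imp_Bseq[OF convergentI[OF d(2)]])
  then obtain B where "B > 0" "\<forall>k. norm (real (catalan k) / (4 ^ k * real k powr (- 3 / 2))) \<le> B"
    by (rule BseqE)
  then have B: "B > 0" "\<And>k. \<bar>real (catalan k) / (4 ^ k * real k powr (- 3 / 2))\<bar> \<le> B" by auto
  obtain q where q: "0 < q" "4 * q < 1" "\<And>n. shape_integral \<alpha> 0 n (n + 2) \<le> q ^ n"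
    by (rule subcritical_integral_bound[OF assms]) blast
  show thesis
  proof (rule that)
    show "B / q > 0" using B q by simp
    show "- ln (4 * q) > 0" using q by simp
    fix f :: "nat \<Rightarrow> real" and k
    assume f: "f 0 = 0" "\<And>k. f (Suc k) = catalan (Suc k) * shape_integral \<alpha> 0 k (k + 2)"
    have e: "exp (- (- ln (4 * q)) * real k) = (4 * q) ^ k"
      using q by (simp add: exp_of_nat2_mult)
    show "f k \<le> B / q * exp (- (- ln (4 * q)) * real k)"
    proof (cases k)
      case 0
      then show ?thesis using f B q by simp
    next
      case (Suc j)
      have "real (catalan k) \<le> B * (4 ^ k * real k powr (- 3 / 2))"
        using B(2)[of k] Suc by (simp add: divide_le_eq abs_le_iff del: of_nat_Suc power_Suc)
      also have "\<dots> \<le> B * (4 ^ k * 1)"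
        using B(1) Suc by (intro mult_left_mono) (auto intro!: powr_le1 simp: powr_minus_divide ge_one_powr_ge_zero)
      finally have "real (catalan k) * shape_integral \<alpha> 0 j (j + 2) \<le> (B * 4 ^ k) * q ^ j"
        using q B by (intro mult_mono') (use assms in \<open>auto intro!: shape_integral_nonneg\<close>)
      also have "\<dots> = B / q * (4 * q) ^ k" using q Suc by (simp add: power_mult_distrib)
      finally show ?thesis unfolding e using f(2)[of j] Suc by simp
    qed
  qed
qed

subsection \<open>Infinite clusters\<close>

lemma extinct_bounds:
  assumes "0 \<le> p" "p \<le> 1"
  shows "0 \<le> extinct p m" "extinct p m \<le> 1"
proof -
  have "0 \<le> extinct p m \<and> extinct p m \<le> 1"
  proof (induction m)
    case (Suc m)
    then have "p * (extinct p m)\<^sup>2 \<le> p * 1" using assms by (intro mult_left_mono) (auto simp: power_le_one)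
    then show ?case using assms Suc by simp
  qed (use assms in simp)
  then show "0 \<le> extinct p m" "extinct p m \<le> 1" by auto
qed

lemma extinct_mono:
  assumes "0 \<le> p" "p \<le> 1"
  shows "extinct p m \<le> extinct p (Suc m)"
proof (induction m)
  case 0
  then show ?case using assms by simp
next
  case (Suc m)
  then have "(extinct p m)\<^sup>2 \<le> (extinct p (Suc m))\<^sup>2"
    using extinct_bounds(1)[OF assms] by (intro power_mono)
  then have "p * (extinct p m)\<^sup>2 \<le> p * (extinct p (Suc m))\<^sup>2" using assms by (intro mult_left_mono)
  then show ?case by (simp del: extinct.simps add: extinct.simps(2)[of p m] extinct.simps(2)[of p "Suc m"])
qed

text \<open>The increasing limit solves \<open>e = (1 - p) + p * e\<^sup>2\<close>. Besides 1 the
  only root, for positive \<open>p\<close>, is \<open>(1 - p) / p\<close>, which is at least 1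
  here.\<close>

lemma extinct_critical:
  assumes "0 \<le> p" "p \<le> 1 / 2"
  shows "(\<lambda>m. extinct p m) \<longlonglongrightarrow> 1"
proof -
  have p: "0 \<le> p" "p \<le> 1" using assms by auto
  have "incseq (extinct p)" by (rule incseq_SucI) (rule extinct_mono[OF p])
  then obtain e where e: "(\<lambda>m. extinct p m) \<longlonglongrightarrow> e"
    using incseq_convergent extinct_bounds(2)[OF p] by blast
  have "e \<le> 1" by (rule LIMSEQ_le_const2[OF e]) (use extinct_bounds(2)[OF p] in auto)
  have "(\<lambda>m. extinct p (Suc m)) \<longlonglongrightarrow> (1 - p) + p * e\<^sup>2"
    unfolding extinct.simps by (intro tendsto_intros e)
  then have "e = (1 - p) + p * e\<^sup>2" using LIMSEQ_unique[OF LIMSEQ_Suc[OF e]] by blast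
  then have "(1 - e) * (1 - p - p * e) = 0" by (simp add: power2_eq_square algebra_simps)
  moreover have "e = 1" if "1 - p - p * e = 0"
  proof -
    have "p * e \<le> p * 1" using \<open>e \<le> 1\<close> p by (intro mult_left_mono)
    then have "p = 1 / 2" using that assms by linarith
    then show ?thesis using that unfolding \<open>p = 1 / 2\<close> by simp
  qed
  ultimately have "e = 1" by auto
  with e show ?thesis by simp
qed

text \<open>\<open>(1 - p) / p\<close> is a fixed point of the recursion, which is monotone, and the
  starting value \<open>1 - p\<close> lies below it.\<close>

lemma extinct_supercritical:
  assumes "0 < p" "p \<le> 1"
  shows "extinct p m \<le> (1 - p) / p"
proof (induction m)
  case 0
  then show ?case using assms mult_left_mono[of p 1 "1 - p"] by (simp add: field_simps)
next
  case (Suc m)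
  have "(extinct p m)\<^sup>2 \<le> ((1 - p) / p)\<^sup>2" using Suc extinct_bounds(1)[of p m] assms by (intro power_mono) auto
  then have "p * (extinct p m)\<^sup>2 \<le> p * ((1 - p) / p)\<^sup>2" using assms by (intro mult_left_mono) auto
  also have "p * ((1 - p) / p)\<^sup>2 = (1 - p) / p - (1 - p)"
    using assms by (simp add: power2_eq_square field_simps)
  finally show ?case by simp
qed

lemma shape_density_pair:
  "shape_density \<alpha> (num_joined l + num_joined r) (num_stopped l + num_stopped r) s
    = weight (join_prob \<alpha> s) l * weight (join_prob \<alpha> s) r"
  by (simp add: shape_density_def weight_def power_add)

lemma sum_pair_integral:
  assumes "\<alpha> > 0" "\<kappa> \<ge> 0" "finite X"
  shows "(\<Sum>q\<in>X. pair_integral \<alpha> \<kappa> q) = (LINT s:{0..}|lborel. \<alpha> * exp (- (\<alpha> + \<kappa>) * s) *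
    (\<Sum>q\<in>X. weight (join_prob \<alpha> s) (fst q) * weight (join_prob \<alpha> s) (snd q)))"
proof -
  have "(\<Sum>q\<in>X. pair_integral \<alpha> \<kappa> q) = (LINT s:{0..}|lborel. (\<Sum>q\<in>X. \<alpha> * exp (- (\<alpha> + \<kappa>) * s) *
      shape_density \<alpha> (num_joined (fst q) + num_joined (snd q)) (num_stopped (fst q) + num_stopped (snd q)) s))"
    unfolding pair_integral_def shape_integral_def set_lebesgue_integral_def scaleR_sum_right
    using shape_integrable[OF assms(1,2)] by (intro Bochner_Integration.integral_sum[symmetric]) (simp add: set_integrable_def)
  then show ?thesis unfolding shape_density_pair sum_distrib_left .
qed

lemma sum_weight_pairs:
  "(\<Sum>q\<in>A \<times> B. weight p (fst q) * weight p (snd q)) = (\<Sum>s\<in>A. weight p s) * (\<Sum>s\<in>B. weight p s)"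
  by (simp add: sum_product sum.cartesian_product case_prod_unfold)

lemma finite_whole_pairs: "finite (whole_pairs m)"
  by (simp add: whole_pairs_def finite_shapes)

lemma sum_weight_whole_pairs:
  "(\<Sum>q\<in>whole_pairs m. weight p (fst q) * weight p (snd q)) = (extinct p m)\<^sup>2"
  unfolding whole_pairs_def sum_weight_pairs shapes_whole_weight by (simp add: power2_eq_square)

lemma sum_weight_reaching_pairs:
  "(\<Sum>q\<in>reaching_pairs m. weight p (fst q) * weight p (snd q)) = 1 - (extinct p m)\<^sup>2"
proof -
  have "(\<Sum>q\<in>reaching_pairs m. weight p (fst q) * weight p (snd q))
    = (\<Sum>q\<in>shapes m \<times> shapes m. weight p (fst q) * weight p (snd q)) - (\<Sum>q\<in>whole_pairs m. weight p (fst q) * weight p (snd q))"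
    by (intro sum_diff) (auto simp: finite_shapes whole_pairs_def)
  then show ?thesis unfolding sum_weight_whole_pairs sum_weight_pairs shapes_weight by simp
qed

lemma whole_pairs_whole: "q \<in> whole_pairs m \<Longrightarrow> whole (fst q) \<and> whole (snd q)"
  by (auto simp: whole_pairs_def)

text \<open>For \<alpha> \<ge> 1 every freezing time leaves \<open>join_prob\<close> at most 1/2, so
  extinction is certain for each of them; the density of the freezing time dominates.\<close>

lemma whole_pair_integral_tendsto:
  assumes "\<alpha> \<ge> 1"
  shows "(\<lambda>m. \<Sum>q\<in>whole_pairs m. pair_integral \<alpha> 0 q) \<longlonglongrightarrow> 1"
proof -
  have \<alpha>: "\<alpha> > 0" using assms by simp
  let ?f = "\<lambda>m s. indicator {0..} s *\<^sub>R (\<alpha> * exp (- (\<alpha> + 0) * s) * (extinct (join_prob \<alpha> s) m)\<^sup>2)"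
  let ?g = "\<lambda>s. indicator {0..} s *\<^sub>R (\<alpha> * exp (- (\<alpha> + 0) * s) * shape_density \<alpha> 0 0 s)"
  have [measurable]: "(\<lambda>s. extinct (join_prob \<alpha> s) m) \<in> borel_measurable borel" for m
    by (induction m) simp_all
  have [measurable]: "shape_density \<alpha> 0 0 \<in> borel_measurable borel"
    by (simp add: shape_density_def[abs_def])
  have p: "0 \<le> join_prob \<alpha> s" "join_prob \<alpha> s \<le> 1 / 2" if "s \<ge> 0" for s
  proof -
    have "1 / (1 + \<alpha>) \<le> 1 / 2" using assms by (simp add: field_simps)
    then show "0 \<le> join_prob \<alpha> s" "join_prob \<alpha> s \<le> 1 / 2" using join_prob_bounds[OF \<alpha> that] by auto
  qed
  have "(\<lambda>m. integral\<^sup>L lborel (?f m)) \<longlonglongrightarrow> integral\<^sup>L lborel ?g"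
  proof (rule integral_dominated_convergence[where w = ?g])
    show "integrable lborel ?g" using shape_integrable[OF \<alpha>, of 0 0 0] by (simp add: set_integrable_def)
    show "AE s in lborel. (\<lambda>m. ?f m s) \<longlonglongrightarrow> ?g s"
    proof (rule AE_I2)
      fix s :: real
      show "(\<lambda>m. ?f m s) \<longlonglongrightarrow> ?g s"
      proof (cases "s \<ge> 0")
        case True
        have "(\<lambda>m. ?f m s) \<longlonglongrightarrow> indicator {0..} s *\<^sub>R (\<alpha> * exp (- (\<alpha> + 0) * s) * 1\<^sup>2)"
          by (intro tendsto_intros extinct_critical p True)
        then show ?thesis by (simp add: shape_density_def)
      qed simp
    qed
    show "AE s in lborel. norm (?f m s) \<le> ?g s" for m
    proof (rule AE_I2)
      fix s :: real
      show "norm (?f m s) \<le> ?g s"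
      proof (cases "s \<ge> 0")
        case True
        have "(extinct (join_prob \<alpha> s) m)\<^sup>2 \<le> 1"
          using extinct_bounds[of "join_prob \<alpha> s" m] p[OF True] by (intro power_le_one) auto
        then show ?thesis using True \<alpha> by (simp add: shape_density_def abs_mult)
      qed simp
    qed
  qed measurable
  moreover have "integral\<^sup>L lborel ?g = 1"
    using shape_integral_0[OF \<alpha>] by (simp add: shape_integral_def set_lebesgue_integral_def)
  moreover have "integral\<^sup>L lborel (?f m) = (\<Sum>q\<in>whole_pairs m. pair_integral \<alpha> 0 q)" for m
    unfolding sum_pair_integral[OF \<alpha> order_refl finite_whole_pairs] sum_weight_whole_pairs
    by (simp add: set_lebesgue_integral_def)
  ultimately show ?thesis by simp
qed

text \<open>From some time on \<open>join_prob\<close> exceeds a fixed \<open>p > 1 / 2\<close>.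
  Restricting to a window of unit length after it leaves positive mass, and there
  \<open>extinct_supercritical\<close> bounds survival below uniformly in the depth.\<close>

lemma reaching_pair_integral_lower:
  assumes "0 < \<alpha>" "\<alpha> < 1"
  obtains c where "0 < c" "\<And>m. c \<le> (\<Sum>q\<in>reaching_pairs m. pair_integral \<alpha> 1 q)"
proof -
  have "1 / 2 < 1 / (1 + \<alpha>)" using assms by (simp add: field_simps)
  then obtain p where p: "1 / 2 < p" "p < 1 / (1 + \<alpha>)" using dense by blast
  have "1 / (1 + \<alpha>) < 1" using assms by simp
  with p have p1: "p < 1" by linarith
  have "((\<lambda>s. join_prob \<alpha> s) \<longlongrightarrow> inverse (1 + \<alpha>)) at_top"
    unfolding join_prob_def keep_prob_def using assms by real_asymp
  then have "((\<lambda>s. join_prob \<alpha> s) \<longlongrightarrow> 1 / (1 + \<alpha>)) at_top" by (simp add: divide_inverse)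
  then have "\<forall>\<^sub>F s in at_top. p < join_prob \<alpha> s" using p by (intro order_tendstoD)
  then obtain s0 where s0: "\<And>s. s \<ge> s0 \<Longrightarrow> p < join_prob \<alpha> s" by (auto simp: eventually_at_top_linorder)
  define s1 where "s1 = max 0 s0"
  define \<rho> where "\<rho> = (1 - p) / p"
  have \<rho>: "0 \<le> \<rho>" "\<rho> < 1" using p p1 by (auto simp: \<rho>_def field_simps)
  define c where "c = \<alpha> * exp (- (\<alpha> + 1) * (s1 + 1)) * (1 - \<rho>\<^sup>2)"
  have "\<rho>\<^sup>2 < 1" using \<rho> by (simp add: power_less_one_iff abs_square_less_1)
  then have "c > 0" using assms by (simp add: c_def)
  moreover have "c \<le> (\<Sum>q\<in>reaching_pairs m. pair_integral \<alpha> 1 q)" for m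
  proof -
    let ?h = "\<lambda>s. \<alpha> * exp (- (\<alpha> + 1) * s) * (1 - (extinct (join_prob \<alpha> s) m)\<^sup>2)"
    have [measurable]: "(\<lambda>s. extinct (join_prob \<alpha> s) m) \<in> borel_measurable borel" for m
      by (induction m) simp_all
    have e: "0 \<le> 1 - (extinct (join_prob \<alpha> s) m)\<^sup>2" "1 - (extinct (join_prob \<alpha> s) m)\<^sup>2 \<le> 1" if "s \<ge> 0" for s
      using extinct_bounds[of "join_prob \<alpha> s" m] join_prob_bounds[OF assms(1) that] by (auto intro!: power_le_one)
    have "c = (LINT s|lborel. indicator {s1..s1 + 1} s * c)" by simp
    also have "\<dots> \<le> (LINT s|lborel. indicator {0..} s *\<^sub>R ?h s)"
    proof (rule integral_mono)
      show "integrable lborel (\<lambda>s. indicator {s1..s1 + 1} s * c)" by simp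
      have "set_integrable lborel {0..} (\<lambda>s. exp (- (\<alpha> + 1) * s) * (\<alpha> * (1 - (extinct (join_prob \<alpha> s) m)\<^sup>2)))"
        using e assms by (intro set_integrable_exp_mult[where B = \<alpha>]) (auto simp: abs_mult mult_left_le)
      then show "integrable lborel (\<lambda>s. indicator {0..} s *\<^sub>R ?h s)" by (simp add: set_integrable_def mult_ac)
      fix s :: real
      show "indicator {s1..s1 + 1} s * c \<le> indicator {0..} s *\<^sub>R ?h s"
      proof (cases "s \<in> {s1..s1 + 1}")
        case True
        then have s: "s \<ge> 0" "s \<ge> s0" "s \<le> s1 + 1" by (auto simp: s1_def)
        have j: "p < join_prob \<alpha> s" "join_prob \<alpha> s < 1" using s0[OF s(2)] join_prob_bounds[OF assms(1) s(1)] by auto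
        have "extinct (join_prob \<alpha> s) m \<le> (1 - join_prob \<alpha> s) / join_prob \<alpha> s"
          using j p by (intro extinct_supercritical) auto
        also have "\<dots> \<le> \<rho>" unfolding \<rho>_def using j p by (simp add: field_simps)
        finally have "(extinct (join_prob \<alpha> s) m)\<^sup>2 \<le> \<rho>\<^sup>2"
          using extinct_bounds[of "join_prob \<alpha> s" m] j p by (intro power_mono) auto
        moreover have "exp (- (\<alpha> + 1) * (s1 + 1)) \<le> exp (- (\<alpha> + 1) * s)"
          using s assms by (simp add: mult_left_mono)
        ultimately have "c \<le> ?h s"
          unfolding c_def using assms \<open>\<rho>\<^sup>2 < 1\<close> by (intro mult_mono mult_nonneg_nonneg) auto
        then show ?thesis using True s by simp
      next
        case False
        moreover have "0 \<le> indicator {0..} s *\<^sub>R ?h s"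
          by (cases "s \<ge> 0") (use e[of s] assms in auto)
        ultimately show ?thesis by simp
      qed
    qed
    also have "\<dots> = (\<Sum>q\<in>reaching_pairs m. pair_integral \<alpha> 1 q)"
      using assms by (simp add: sum_pair_integral finite_shapes sum_weight_reaching_pairs set_lebesgue_integral_def)
    finally show ?thesis .
  qed
  ultimately show thesis using that by blast
qed

text \<open>Every cluster is what is reached downward from its apex, so it suffices to treat the
  countably many possible tops. For each, the probability of dying out within \<open>m\<close>
  levels tends to 1.\<close>

lemma finite_clusters_AE:
  assumes \<alpha>: "\<alpha> \<ge> 1" and inf: "infinite_volume_pcf \<alpha> binary_tree M \<eta>"
  shows "AE \<omega> in M. \<forall>v. finite (cluster (\<eta> \<infinity> \<omega>) v)"
proof -
  interpret prob_space M using inf by (simp add: infinite_volume_pcf_def)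
  have \<alpha>0: "\<alpha> > 0" using \<alpha> by simp
  have conf: "config_on binary_tree (\<eta> \<infinity> \<omega>)" if "\<omega> \<in> space M" for \<omega>
    using inf that by (simp add: infinite_volume_pcf_def)
  have "AE \<omega> in M. finite (reach (\<eta> \<infinity> \<omega>) a)" for a
  proof -
    let ?E = "\<lambda>m. {\<omega>\<in>space M. \<exists>q\<in>whole_pairs m. has_pair (\<eta> \<infinity> \<omega>) a q}"
    have E: "?E m = (\<Union>q\<in>whole_pairs m. {\<omega>\<in>space M. has_pair (\<eta> \<infinity> \<omega>) a q})" for m by blast
    have E_sets: "?E m \<in> events" for m
      unfolding E by (intro sets.finite_UN finite_whole_pairs pair_prob(1)[OF \<alpha>0 inf])
    have E_prob: "prob (?E m) = (\<Sum>q\<in>whole_pairs m. pair_integral \<alpha> 0 q)" for m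
    proof -
      have "prob (?E m) = (\<Sum>q\<in>whole_pairs m. prob {\<omega>\<in>space M. has_pair (\<eta> \<infinity> \<omega>) a q})"
        unfolding E
      proof (intro finite_measure_finite_Union finite_whole_pairs)
        show "(\<lambda>q. {\<omega>\<in>space M. has_pair (\<eta> \<infinity> \<omega>) a q}) ` whole_pairs m \<subseteq> events"
          using pair_prob(1)[OF \<alpha>0 inf] by auto
        show "disjoint_family_on (\<lambda>q. {\<omega>\<in>space M. has_pair (\<eta> \<infinity> \<omega>) a q}) (whole_pairs m)"
          unfolding disjoint_family_on_def using whole_pair_unique by (blast dest: whole_pairs_whole)
      qed
      then show ?thesis by (simp only: pair_prob(2)[OF \<alpha>0 inf])
    qed
    let ?F = "\<Union>m. ?E m"
    have F_sets: "?F \<in> events" using E_sets by auto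
    have "1 \<le> prob ?F"
    proof (rule LIMSEQ_le_const2[OF whole_pair_integral_tendsto[OF \<alpha>]], intro exI allI impI)
      show "(\<Sum>q\<in>whole_pairs m. pair_integral \<alpha> 0 q) \<le> prob ?F" for m
        unfolding E_prob[symmetric] using F_sets by (intro finite_measure_mono) auto
    qed
    then have "prob ?F = 1" by (intro antisym prob_le_1)
    then have "AE \<omega> in M. \<omega> \<in> ?F" using prob_eq_1[OF F_sets] by simp
    then show ?thesis by eventually_elim (auto simp: finite_reach_iff)
  qed
  then have "AE \<omega> in M. \<forall>a. finite (reach (\<eta> \<infinity> \<omega>) a)" by (simp add: AE_all_countable)
  then show ?thesis
    using AE_space
  proof eventually_elim
    case (elim \<omega>)
    have "cluster (\<eta> \<infinity> \<omega>) v = reach (\<eta> \<infinity> \<omega>) (apex (\<eta> \<infinity> \<omega>) v)" for v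
      by (rule cluster_eq_reach[OF conf[OF elim(2)]])
    then show ?case using elim(1) by simp
  qed
qed

text \<open>With its parent edge closed, the cluster of \<open>a\<close> lies in the subtree of
  \<open>a\<close>, so the event concerns that subtree and that edge alone. If it holds for all
  \<open>m\<close>, the cluster is infinite.\<close>

definition far_reaching :: "nat \<Rightarrow> bool list \<Rightarrow> bool list config \<Rightarrow> bool" where
  "far_reaching m a x \<longleftrightarrow> \<not> linked x a \<and> \<not> (\<exists>q\<in>whole_pairs m. has_pair x a q)"

text \<open>The children hanging off the ray of \<open>True\<close> words; none is an ancestor of
  another, so their subtrees are disjoint.\<close>

definition spine_child :: "nat \<Rightarrow> bool list" where
  "spine_child i = False # replicate i True"

lemma spine_child_suffix: "suffix (spine_child i) (spine_child j) \<Longrightarrow> i = j"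
proof (rule ccontr)
  assume s: "suffix (spine_child i) (spine_child j)" and ne: "i \<noteq> j"
  then have "suffix (spine_child i) (replicate j True)"
    by (auto simp: spine_child_def suffix_Cons)
  then obtain zs where "replicate j True = zs @ spine_child i" by (auto simp: suffix_def)
  then have "set (replicate j True) = set (zs @ spine_child i)" by (rule arg_cong)
  moreover have "False \<in> set (zs @ spine_child i)" by (simp add: spine_child_def)
  ultimately have "False \<in> set (replicate j True)" by blast
  then show False by simp
qed

lemma spine_disjoint:
  assumes "i \<noteq> j" "suffix (spine_child i) w"
  shows "\<not> suffix (spine_child j) w"
  using assms suffix_same_cases[of "spine_child i" w "spine_child j"] spine_child_suffix by metis

lemma length_spine_child: "length (spine_child i) = Suc i"
  by (simp add: spine_child_def)

lemma whole_pairs_height: "q \<in> shapes m \<times> shapes m \<Longrightarrow> pair_height q \<le> Suc m"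
  using shapes_height by (fastforce simp: pair_height_def)

lemma far_reaching_restrict:
  assumes "a \<in> Q" "\<And>w. suffix a w \<Longrightarrow> length w \<le> length a + Suc m \<Longrightarrow> w \<in> Q"
  shows "far_reaching m a (restrict_config (tree_on Q) x) \<longleftrightarrow> far_reaching m a x"
proof -
  have "has_pair (restrict_config (tree_on Q) x) a q \<longleftrightarrow> has_pair x a q" if "q \<in> whole_pairs m" for q
  proof -
    have h: "pair_height q \<le> Suc m" using that whole_pairs_height by (auto simp: whole_pairs_def)
    have "w \<in> Q" if w: "w \<in> pair_joined a q \<union> pair_stopped a q" for w
    proof (rule assms(2))
      show "length w \<le> length a + Suc m" using length_pair[OF w] h by (simp add: pair_height_def max_def split: if_splits)
      have "below a w" using frame_pair[of a q] w by (auto simp: frame_def)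
      then show "suffix a w" by (cases w) (auto simp: below_def suffix_Cons)
    qed
    then show ?thesis unfolding has_pair_iff by (intro matches_restrict) auto
  qed
  then show ?thesis using assms(1) by (auto simp: far_reaching_def op_restrict)
qed

lemma ex_pair: "\<exists>q\<in>shapes m \<times> shapes m. has_pair x a q"
  using ex_shape[of m x "False # a"] ex_shape[of m x "True # a"] by (force simp: has_pair_def)

lemma pair_unique:
  "q \<in> shapes m \<times> shapes m \<Longrightarrow> q' \<in> shapes m \<times> shapes m \<Longrightarrow> has_pair x a q \<Longrightarrow> has_pair x a q' \<Longrightarrow> q = q'"
  using shape_unique by (auto simp: has_pair_def)

text \<open>Exactly one exploration of depth \<open>m\<close> matches, so the event splits into
  exclusive patterns, each within reach of \<open>final_shape_lower_cut\<close>.\<close>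

lemma far_reaching_sum:
  "of_bool (far_reaching m a x) = (\<Sum>q\<in>reaching_pairs m. of_bool (has_pair x a q \<and> \<not> linked x a) :: real)"
proof -
  obtain q where q: "q \<in> shapes m \<times> shapes m" "has_pair x a q" using ex_pair by blast
  have iff: "has_pair x a q' \<longleftrightarrow> q' = q" if "q' \<in> shapes m \<times> shapes m" for q'
    using pair_unique[OF that q(1) _ q(2)] q(2) by blast
  have "(\<exists>q\<in>whole_pairs m. has_pair x a q) \<longleftrightarrow> q \<in> whole_pairs m"
    using iff q by (auto simp: whole_pairs_def)
  moreover have "(\<Sum>q\<in>reaching_pairs m. of_bool (has_pair x a q \<and> \<not> linked x a) :: real)
    = (\<Sum>q'\<in>reaching_pairs m. if q' = q then of_bool (\<not> linked x a) else 0)"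
    using iff by (intro sum.cong) auto
  ultimately show ?thesis using q(1) by (simp add: far_reaching_def finite_shapes)
qed

lemma (in tree_pcf) fin_nonneg: "x \<in> valid P \<Longrightarrow> (\<And>y. y \<in> valid P \<Longrightarrow> 0 \<le> f y) \<Longrightarrow> 0 \<le> fin f x"
  using fin_mono[of "\<lambda>_. 0" f x] fin_absorbing_0[of "\<lambda>_. 0" x] by simp

lemma far_reaching_antimono: "m \<le> n \<Longrightarrow> far_reaching n a x \<Longrightarrow> far_reaching m a x"
  using whole_pairs_mono[of m n] unfolding far_reaching_def by blast

text \<open>The subtrees of distinct children of the spine are disjoint, so the cut bound can be iterated.\<close>

lemma no_far_reaching_bound:
  assumes \<alpha>: "0 < \<alpha>" and c: "\<And>m. c \<le> (\<Sum>q\<in>reaching_pairs m. pair_integral \<alpha> 1 q)"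
    and c1: "c \<le> 1" and k: "k + m + 2 \<le> n"
  shows "jump_chain.fin (pcf_generator \<alpha> (tree_on (ball_at n)))
    (\<lambda>x. of_bool (\<forall>i<k. \<not> far_reaching m (spine_child i) x)) initial_config \<le> (1 - c) ^ k"
  using k
proof (induction k)
  case 0
  interpret tree_pcf \<alpha> "ball_at n" by (rule tree_pcf_ball[OF \<alpha>])
  have init: "initial_config \<in> valid (ball_at n)" by (rule initial_valid)
  have "fin (\<lambda>_. 1) initial_config = 1"
    using final_shape[of "[]" "{}" "{}"] shape_integral_0[OF \<alpha>] Nil_in_P by (simp add: frame_def matches_def)
  then show ?case by simp
next
  case (Suc k)
  interpret tree_pcf \<alpha> "ball_at n" by (rule tree_pcf_ball[OF \<alpha>])
  have init: "initial_config \<in> valid (ball_at n)" by (rule initial_valid)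
  define a where "a = spine_child k"
  define Q where "Q = {v\<in>ball_at n. \<not> suffix a v}"
  define f where "f x = (of_bool (\<forall>i<k. \<not> far_reaching m (spine_child i) x) :: real)" for x
  have a: "a \<noteq> []" "a \<in> ball_at n" using Suc.prems by (simp_all add: a_def spine_child_def ball_at_def)
  have f_pos: "0 \<le> f y" for y by (simp add: f_def)
  \<comment> \<open>The earlier subtrees and their parent edges lie outside the subtree of
    \<open>a\<close>, so \<open>f\<close> is a function of the restricted configuration, as
    \<open>final_shape_lower_cut\<close> requires.\<close>
  have f_res: "f (restrict_config (tree_on Q) x) = f x" for x
  proof -
    have "far_reaching m (spine_child i) (restrict_config (tree_on Q) x) \<longleftrightarrow> far_reaching m (spine_child i) x" if "i < k" for i
    proof (rule far_reaching_restrict)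
      have w: "w \<in> Q" if "suffix (spine_child i) w" "length w \<le> length (spine_child i) + Suc m" for w
        using spine_disjoint[of i k w] that \<open>i < k\<close> Suc.prems by (simp add: Q_def a_def ball_at_def length_spine_child)
      then show "w \<in> Q" if "suffix (spine_child i) w" "length w \<le> length (spine_child i) + Suc m" for w using that .
      show "spine_child i \<in> Q" by (rule w) auto
    qed
    then show ?thesis by (simp add: f_def)
  qed
  \<comment> \<open>The cut bound summed over explorations that reach the required depth: given that
    the first \<open>k\<close> vertices fail, the next one succeeds with probability at least
    \<open>c\<close>.\<close>
  have "c * fin f initial_config \<le> (\<Sum>q\<in>reaching_pairs m. pair_integral \<alpha> 1 q) * fin f initial_config"
    by (intro mult_right_mono c fin_nonneg init) (simp add: f_def)
  also have "\<dots> \<le> (\<Sum>q\<in>reaching_pairs m. fin (\<lambda>x. of_bool (has_pair x a q \<and> \<not> linked x a) * f x) initial_config)"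
    unfolding sum_distrib_right
  proof (rule sum_mono)
    fix q assume "q \<in> reaching_pairs m"
    then have h: "length a + pair_height q \<le> n"
      using whole_pairs_height[of q m] Suc.prems by (simp add: a_def length_spine_child)
    show "pair_integral \<alpha> 1 q * fin f initial_config \<le> fin (\<lambda>x. of_bool (has_pair x a q \<and> \<not> linked x a) * f x) initial_config"
      using final_shape_lower_cut[where f = f, OF a f_pos pair_in_ball[OF h] frame_pair, folded Q_def]
      unfolding f_res has_pair_iff[symmetric] card_pair pair_integral_def .
  qed
  also have "\<dots> = fin (\<lambda>x. of_bool (far_reaching m a x) * f x) initial_config"
    unfolding far_reaching_sum sum_distrib_right by (rule fin_sum[OF init, symmetric])
  finally have ge: "c * fin f initial_config \<le> fin (\<lambda>x. of_bool (far_reaching m a x) * f x) initial_config" .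
  have "(\<lambda>x. of_bool (\<forall>i<Suc k. \<not> far_reaching m (spine_child i) x) :: real) = (\<lambda>x. f x - of_bool (far_reaching m a x) * f x)"
    by (auto simp: fun_eq_iff f_def a_def less_Suc_eq)
  then have "fin (\<lambda>x. of_bool (\<forall>i<Suc k. \<not> far_reaching m (spine_child i) x)) initial_config
      = fin f initial_config - fin (\<lambda>x. of_bool (far_reaching m a x) * f x) initial_config"
    by (simp only: fin_diff[OF init])
  also have "\<dots> \<le> (1 - c) * fin f initial_config" using ge by (simp add: algebra_simps)
  also have "\<dots> \<le> (1 - c) * (1 - c) ^ k"
    using Suc c1 unfolding f_def by (intro mult_left_mono) auto
  finally show ?case by simp
qed

text \<open>The bound \<open>(1 - c) ^ k\<close> does not depend on the depth \<open>m\<close>, so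
  it survives the increasing union of the failure events over \<open>m\<close>; afterwards
  \<open>k\<close> tends to infinity.\<close>

lemma infinite_cluster_AE:
  assumes \<alpha>: "0 < \<alpha>" "\<alpha> < 1" and inf: "infinite_volume_pcf \<alpha> binary_tree M \<eta>"
  shows "AE \<omega> in M. \<exists>v. infinite (cluster (\<eta> \<infinity> \<omega>) v)"
proof -
  interpret prob_space M using inf by (simp add: infinite_volume_pcf_def)
  have conf: "config_on binary_tree (\<eta> \<infinity> \<omega>)" if "\<omega> \<in> space M" for \<omega>
    using inf that by (simp add: infinite_volume_pcf_def)
  obtain c0 where c0: "0 < c0" "\<And>m. c0 \<le> (\<Sum>q\<in>reaching_pairs m. pair_integral \<alpha> 1 q)"
    by (rule reaching_pair_integral_lower[OF \<alpha>]) blast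
  \<comment> \<open>Truncated at 1 so that \<open>1 - c\<close> is nonnegative.\<close>
  define c where "c = min c0 1"
  have c: "0 < c" "c \<le> 1" "\<And>m. c \<le> (\<Sum>q\<in>reaching_pairs m. pair_integral \<alpha> 1 q)"
    using c0 by (auto simp: c_def min.coboundedI1)
  define E where "E k m = {\<omega>\<in>space M. \<forall>i<k. \<not> far_reaching m (spine_child i) (\<eta> \<infinity> \<omega>)}" for k m
  have E: "E k m \<in> events" "prob (E k m) \<le> (1 - c) ^ k" for k m
  proof -
    define n where "n = k + m + 2"
    let ?A = "{x. \<forall>i<k. \<not> far_reaching m (spine_child i) x}"
    have "far_reaching m (spine_child i) (restrict_config (tree_on (ball_at n)) x) \<longleftrightarrow> far_reaching m (spine_child i) x" if "i < k" for i x
      using that by (intro far_reaching_restrict) (auto simp: ball_at_def n_def length_spine_child)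
    then have eq: "E k m = {\<omega>\<in>space M. restrict_config (tree_on (ball_at n)) (\<eta> \<infinity> \<omega>) \<in> ?A}"
      unfolding E_def by (intro Collect_cong) simp
    show "E k m \<in> events" unfolding eq by (rule infinite_volume_restrict_prob(1)[OF \<alpha>(1) inf])
    have "prob (E k m) = jump_chain.fin (pcf_generator \<alpha> (tree_on (ball_at n))) (\<lambda>x. of_bool (x \<in> ?A)) initial_config"
      unfolding eq by (rule infinite_volume_restrict_prob(2)[OF \<alpha>(1) inf])
    also have "\<dots> \<le> (1 - c) ^ k"
      using no_far_reaching_bound[OF \<alpha>(1) c(3,2), of k m n] by (simp add: n_def)
    finally show "prob (E k m) \<le> (1 - c) ^ k" .
  qed
  define F where "F k = (\<Union>m. E k m)" for k
  have F_sets: "F k \<in> events" for k unfolding F_def using E(1) by auto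
  have F_prob: "prob (F k) \<le> (1 - c) ^ k" for k
  proof -
    have "incseq (E k)"
      unfolding E_def incseq_def using far_reaching_antimono by blast
    then have "(\<lambda>m. prob (E k m)) \<longlonglongrightarrow> prob (F k)"
      unfolding F_def using E(1) by (intro finite_Lim_measure_incseq) auto
    then show ?thesis by (rule LIMSEQ_le_const2) (use E(2) in auto)
  qed
  define Z where "Z = (\<Inter>k. F k)"
  have Z_sets: "Z \<in> events" unfolding Z_def using F_sets by auto
  have "prob Z \<le> 0"
  proof (rule LIMSEQ_le_const)
    show "(\<lambda>k. (1 - c) ^ k) \<longlonglongrightarrow> 0" using c by (intro LIMSEQ_power_zero) auto
    have "prob Z \<le> (1 - c) ^ k" for k
    proof -
      have "prob Z \<le> prob (F k)" by (intro finite_measure_mono F_sets) (auto simp: Z_def)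
      then show ?thesis using F_prob[of k] by linarith
    qed
    then show "\<exists>N. \<forall>k\<ge>N. prob Z \<le> (1 - c) ^ k" by blast
  qed
  then have "prob Z = 0" by (simp add: measure_le_0_iff)
  then have "AE \<omega> in M. \<omega> \<notin> Z" using Z_sets by (simp add: prob_eq_0)
  then show ?thesis
    using AE_space
  proof eventually_elim
    case (elim \<omega>)
    then obtain k where "\<omega> \<notin> F k" unfolding Z_def by blast
    then have far: "\<forall>m. \<exists>i<k. far_reaching m (spine_child i) (\<eta> \<infinity> \<omega>)" using elim(2) unfolding F_def E_def by blast
    \<comment> \<open>At each depth some \<open>i < k\<close> succeeds. Success at one depth implies
      success at smaller ones, and there are finitely many \<open>i\<close>, so one of them succeeds
      at all depths.\<close>
    have "\<exists>i<k. \<forall>m. far_reaching m (spine_child i) (\<eta> \<infinity> \<omega>)"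
    proof (rule ccontr)
      assume "\<not> ?thesis"
      then have "\<forall>i\<in>{..<k}. \<exists>m. \<not> far_reaching m (spine_child i) (\<eta> \<infinity> \<omega>)" by blast
      from bchoice[OF this] obtain g where g: "\<And>i. i < k \<Longrightarrow> \<not> far_reaching (g i) (spine_child i) (\<eta> \<infinity> \<omega>)" by auto
      define m where "m = (\<Sum>i<k. g i)"
      obtain i where i: "i < k" "far_reaching m (spine_child i) (\<eta> \<infinity> \<omega>)"
        using far by blast
      have "g i \<le> m" unfolding m_def using i(1) by (intro member_le_sum) auto
      then have "far_reaching (g i) (spine_child i) (\<eta> \<infinity> \<omega>)" using i(2) by (rule far_reaching_antimono)
      with g[OF i(1)] show False by blast
    qed
    then obtain i where i: "\<And>m. far_reaching m (spine_child i) (\<eta> \<infinity> \<omega>)" by blast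
    have "infinite (reach (\<eta> \<infinity> \<omega>) (spine_child i))"
      unfolding finite_reach_iff using i by (simp add: far_reaching_def)
    moreover have "\<not> linked (\<eta> \<infinity> \<omega>) (spine_child i)" using i[of 0] by (simp add: far_reaching_def)
    moreover have "cluster (\<eta> \<infinity> \<omega>) (spine_child i) = reach (\<eta> \<infinity> \<omega>) (apex (\<eta> \<infinity> \<omega>) (spine_child i))"
      by (rule cluster_eq_reach[OF conf[OF elim(2)]])
    ultimately have "infinite (cluster (\<eta> \<infinity> \<omega>) (spine_child i))" by simp
    then show ?case by blast
  qed
qed

theorem theorem1p4:
  fixes \<alpha> :: real
  assumes "\<alpha> > 0"
  shows
    "(\<alpha> < 1 \<longrightarrow> (\<forall>(M :: 'w measure) \<eta>. infinite_volume_pcf \<alpha> binary_tree M \<eta> \<longrightarrow>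
        (AE \<omega> in M. \<exists>v\<in>verts binary_tree. infinite (cluster (\<eta> \<infinity> \<omega>) v)))) \<and>
     (\<alpha> \<ge> 1 \<longrightarrow> (\<forall>(M :: 'w measure) \<eta>. infinite_volume_pcf \<alpha> binary_tree M \<eta> \<longrightarrow>
        (AE \<omega> in M. \<forall>v\<in>verts binary_tree. finite (cluster (\<eta> \<infinity> \<omega>) v)))) \<and>
     (\<alpha> < 1 \<longrightarrow> (\<exists>C>0. \<forall>(M :: 'w measure) \<eta>. infinite_volume_pcf \<alpha> binary_tree M \<eta> \<longrightarrow>
        (\<lambda>k. cluster_size_prob M \<eta> [] k) \<sim>[at_top] (\<lambda>k. C * real k powr (-2)))) \<and>
     (\<alpha> = 1 \<longrightarrow> (\<exists>C>0. \<forall>(M :: 'w measure) \<eta>. infinite_volume_pcf \<alpha> binary_tree M \<eta> \<longrightarrow>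
        (\<lambda>k. cluster_size_prob M \<eta> [] k) \<sim>[at_top] (\<lambda>k. C * real k powr (-7/4)))) \<and>
     (\<alpha> > 1 \<longrightarrow> (\<exists>K>0. \<exists>l>0. \<forall>(M :: 'w measure) \<eta>. infinite_volume_pcf \<alpha> binary_tree M \<eta> \<longrightarrow>
        (\<forall>k. cluster_size_prob M \<eta> [] k \<le> K * exp (- l * real k))))"
proof (intro conjI impI)
  have verts: "verts binary_tree = UNIV" by (simp add: binary_tree_def)
  show "\<forall>(M :: 'w measure) \<eta>. infinite_volume_pcf \<alpha> binary_tree M \<eta> \<longrightarrow>
        (AE \<omega> in M. \<exists>v\<in>verts binary_tree. infinite (cluster (\<eta> \<infinity> \<omega>) v))" if rate: "\<alpha> < 1"
  proof (intro allI impI)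
    fix M :: "'w measure" and \<eta> assume "infinite_volume_pcf \<alpha> binary_tree M \<eta>"
    from infinite_cluster_AE[OF assms rate this]
    show "AE \<omega> in M. \<exists>v\<in>verts binary_tree. infinite (cluster (\<eta> \<infinity> \<omega>) v)" by (simp add: verts)
  qed
  show "\<forall>(M :: 'w measure) \<eta>. infinite_volume_pcf \<alpha> binary_tree M \<eta> \<longrightarrow>
        (AE \<omega> in M. \<forall>v\<in>verts binary_tree. finite (cluster (\<eta> \<infinity> \<omega>) v))" if rate: "\<alpha> \<ge> 1"
  proof (intro allI impI)
    fix M :: "'w measure" and \<eta> assume "infinite_volume_pcf \<alpha> binary_tree M \<eta>"
    from finite_clusters_AE[OF rate this]
    show "AE \<omega> in M. \<forall>v\<in>verts binary_tree. finite (cluster (\<eta> \<infinity> \<omega>) v)" by (simp add: verts)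
  qed
  show "\<exists>C>0. \<forall>(M :: 'w measure) \<eta>. infinite_volume_pcf \<alpha> binary_tree M \<eta> \<longrightarrow>
        (\<lambda>k. cluster_size_prob M \<eta> [] k) \<sim>[at_top] (\<lambda>k. C * real k powr (-2))" if rate: "\<alpha> < 1"
  proof -
    obtain C where C: "C > 0" "(\<lambda>n. sqrt (real n) * (4 ^ Suc n * shape_integral \<alpha> 0 n (n + 2))) \<longlonglongrightarrow> C"
      by (rule supercritical_integral_asymp[OF assms rate])
    then have "(\<lambda>n. real n powr (1 / 2) * (4 ^ Suc n * shape_integral \<alpha> 0 n (n + 2))) \<longlonglongrightarrow> C"
      by (simp add: powr_half_sqrt)
    from cluster_size_asymp[OF this C(1)] obtain D where D: "D > 0"
      "\<And>f. f 0 = 0 \<Longrightarrow> (\<And>k. f (Suc k) = catalan (Suc k) * shape_integral \<alpha> 0 k (k + 2)) \<Longrightarrow>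
        f \<sim>[at_top] (\<lambda>k. D * real k powr (- (3 / 2 + 1 / 2)))" by blast
    show ?thesis
    proof (intro exI[of _ D] conjI allI impI D(1))
      fix M :: "'w measure" and \<eta> assume inf: "infinite_volume_pcf \<alpha> binary_tree M \<eta>"
      show "(\<lambda>k. cluster_size_prob M \<eta> [] k) \<sim>[at_top] (\<lambda>k. D * real k powr (-2))"
        using D(2)[OF cluster_size_prob_eq(2,1)[OF assms inf]] by simp
    qed
  qed
  show "\<exists>C>0. \<forall>(M :: 'w measure) \<eta>. infinite_volume_pcf \<alpha> binary_tree M \<eta> \<longrightarrow>
        (\<lambda>k. cluster_size_prob M \<eta> [] k) \<sim>[at_top] (\<lambda>k. C * real k powr (-7/4))" if rate: "\<alpha> = 1"
  proof -
    obtain C where C: "C > 0" "(\<lambda>n. real n powr (1 / 4) * (4 ^ Suc n * shape_integral 1 0 n (n + 2))) \<longlonglongrightarrow> C"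
      by (rule critical_integral_asymp)
    from cluster_size_asymp[OF C(2,1)] obtain D where D: "D > 0"
      "\<And>f. f 0 = 0 \<Longrightarrow> (\<And>k. f (Suc k) = catalan (Suc k) * shape_integral 1 0 k (k + 2)) \<Longrightarrow>
        f \<sim>[at_top] (\<lambda>k. D * real k powr (- (3 / 2 + 1 / 4)))" by blast
    show ?thesis
    proof (intro exI[of _ D] conjI allI impI D(1))
      fix M :: "'w measure" and \<eta> assume "infinite_volume_pcf \<alpha> binary_tree M \<eta>"
      then have inf: "infinite_volume_pcf 1 binary_tree M \<eta>" using rate by simp
      show "(\<lambda>k. cluster_size_prob M \<eta> [] k) \<sim>[at_top] (\<lambda>k. D * real k powr (-7/4))"
        using D(2)[OF cluster_size_prob_eq(2,1)[OF _ inf]] by simp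
    qed
  qed
  show "\<exists>K>0. \<exists>l>0. \<forall>(M :: 'w measure) \<eta>. infinite_volume_pcf \<alpha> binary_tree M \<eta> \<longrightarrow>
        (\<forall>k. cluster_size_prob M \<eta> [] k \<le> K * exp (- l * real k))" if rate: "\<alpha> > 1"
  proof -
    obtain K l where K: "K > 0" and l: "l > 0" and Kl: "\<And>f k. f 0 = 0 \<Longrightarrow>
        (\<And>k. f (Suc k) = catalan (Suc k) * shape_integral \<alpha> 0 k (k + 2)) \<Longrightarrow> f k \<le> K * exp (- l * real k)"
      by (rule cluster_size_exp_bound[OF rate]) blast
    show ?thesis
    proof (rule exI[of _ K], intro conjI K, rule exI[of _ l], intro conjI l allI impI)
      fix M :: "'w measure" and \<eta> k assume "infinite_volume_pcf \<alpha> binary_tree M \<eta>"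
      from Kl[OF cluster_size_prob_eq(2,1)[OF assms this]]
      show "cluster_size_prob M \<eta> [] k \<le> K * exp (- l * real k)" .
    qed
  qed
qed

end
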